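(* Let $(\phi_t)_{t\ge 0}$ be a continuous one-parameter semigroup of holomorphic functions in the unit disk $\mathbb{D}$. Then every orbit of $(\phi_t)$, forward or backward, is rectifiable. That is, for every $z\in\mathbb{D}$, both the forward orbit $\gamma_z:[0,+\infty)\to\mathbb{D}$, $\gamma_z(t)=\phi_t(z)$, and the backward orbit $\tilde\gamma_z:[0,T_z)\to\mathbb{D}$, $\tilde\gamma_z(t)=\phi_t^{-1}(z)$, have finite length.
   Context: $\mathbb{D}$ is the open unit disk. A (continuous one-parameter) semigroup in $\mathbb{D}$ is a family $(\phi_t)_{t\ge0}$ of holomorphic functions $\phi_t:\mathbb{D}\to\mathbb{D}$ such that $\phi_0=\mathrm{id}_{\mathbb{D}}$, $\phi_{t+s}=\phi_t\circ\phi_s$ for all $t,s\ge0$, and $\phi_t\to\phi_0$ locally uniformly in $\mathbb{D}$ as $t\to0^+$. Every $\phi_t$ is then univalent. For $z\in\mathbb{D}$, $T_z\in(0,+\infty]$ is the supremum of all $T>0$ such that $z\in\phi_t(\mathbb{D})$ for every $t\in[0,T)$ (so $\phi_t^{-1}(z)$ is defined for all $t\in[0,T_z)$). The length of an orbit is the length measure (one-dimensional Hausdorff measure) of its trace (image set). *)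

theory Defs
  imports "HOL-Complex_Analysis.Complex_Analysis"
begin

abbreviation unit_disk :: "complex set" ("\<D>")
  where "\<D> \<equiv> ball 0 1"

text \<open>
  One-dimensional Hausdorff (outer) measure, normalised so that a segment has its usual length.
  Boundedness of the covering sets is required explicitly because \<^const>\<open>diameter\<close> is only
  meaningful for bounded sets. Finite covers are included, as \<open>U i\<close> may be empty
  (the empty set has diameter \<open>0\<close>).
\<close>

definition hausdorff_content_1 :: "real \<Rightarrow> 'a::metric_space set \<Rightarrow> ennreal"
  where "hausdorff_content_1 \<delta> E =
    Inf {(\<Sum>i. ennreal (diameter (U i))) | U :: nat \<Rightarrow> 'a set.
           E \<subseteq> (\<Union>i. U i) \<and> (\<forall>i. bounded (U i) \<and> diameter (U i) \<le> \<delta>)}"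

definition hausdorff_measure_1 :: "'a::metric_space set \<Rightarrow> ennreal"
  where "hausdorff_measure_1 E = (SUP \<delta>\<in>{0<..}. hausdorff_content_1 \<delta> E)"

text \<open>
  The length of a curve is the measure of its trace; an arc traversed repeatedly counts once.
\<close>

definition curve_length :: "real set \<Rightarrow> (real \<Rightarrow> 'a::metric_space) \<Rightarrow> ennreal"
  where "curve_length I \<gamma> = hausdorff_measure_1 (\<gamma> ` I)"

definition rectifiable_curve :: "real set \<Rightarrow> (real \<Rightarrow> 'a::metric_space) \<Rightarrow> bool"
  where "rectifiable_curve I \<gamma> \<longleftrightarrow> curve_length I \<gamma> < \<infinity>"

text \<open>
  Only the values \<open>\<phi> t z\<close> with \<open>t \<ge> 0\<close> and \<open>z \<in> \<D>\<close> are relevant.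
  Locally uniform convergence in the open set \<open>\<D>\<close> is uniform convergence on compact subsets.
\<close>

definition holomorphic_semigroup :: "(real \<Rightarrow> complex \<Rightarrow> complex) \<Rightarrow> bool"
  where "holomorphic_semigroup \<phi> \<longleftrightarrow>
    (\<forall>t\<ge>0. \<phi> t holomorphic_on \<D> \<and> \<phi> t ` \<D> \<subseteq> \<D>) \<and>
    (\<forall>z\<in>\<D>. \<phi> 0 z = z) \<and>
    (\<forall>t\<ge>0. \<forall>s\<ge>0. \<forall>z\<in>\<D>. \<phi> (t + s) z = \<phi> t (\<phi> s z)) \<and>
    (\<forall>K. compact K \<and> K \<subseteq> \<D> \<longrightarrow> uniform_limit K \<phi> (\<phi> 0) (at_right 0))"

definition forward_orbit :: "(real \<Rightarrow> complex \<Rightarrow> complex) \<Rightarrow> complex \<Rightarrow> real \<Rightarrow> complex"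
  where "forward_orbit \<phi> z t = \<phi> t z"

definition backward_time :: "(real \<Rightarrow> complex \<Rightarrow> complex) \<Rightarrow> complex \<Rightarrow> ereal"
  where "backward_time \<phi> z = Sup {ereal T | T. T > 0 \<and> (\<forall>t\<in>{0..<T}. z \<in> \<phi> t ` \<D>)}"

text \<open>
  The maps of a semigroup are injective on \<open>\<D>\<close>, so for \<open>0 \<le> t < backward_time \<phi> z\<close> the
  following is the unique preimage of \<open>z\<close> in \<open>\<D>\<close> under \<open>\<phi> t\<close>.
\<close>

definition backward_orbit :: "(real \<Rightarrow> complex \<Rightarrow> complex) \<Rightarrow> complex \<Rightarrow> real \<Rightarrow> complex"
  where "backward_orbit \<phi> z t = inv_into \<D> (\<phi> t) z"

end

theory Submission
  imports Defs
begin

text \<open>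
  By Berkson and Porta, the generator of the semigroup becomes, in the coordinate of a right
  half-plane \<open>\<H>\<close> covering the disk (a Cayley map if the Denjoy-Wolff point lies on the circle, the
  exponential if it lies inside), a holomorphic function \<open>F\<close> with \<open>Re F \<ge> 0\<close>. Put \<open>q = 1/F\<close> and
  \<open>h' = q\<close>. Along trajectories \<open>h\<close> grows by the real time parameter, so a full orbit, forward and
  backward, lies in one level set \<open>\<Gamma>\<close> of \<open>Im h\<close>, where \<open>Re h' > 0\<close>.

  The key estimate: if \<open>q\<close> is normalised by \<open>q(1) = 1\<close> and \<open>h(1) = 0\<close>, then \<open>Im h\<close> is bounded, by an
  absolute constant, on the part \<open>0 < Re s \<le> 1\<close>, \<open>\<bar>Im s\<bar> \<le> 1\<close> of the half-plane, up to the boundary.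
  Rescaling it shows that if \<open>\<Gamma>\<close> is steep at \<open>p\<close> (that is, \<open>\<bar>Im q\<bar>\<close> is large compared with \<open>Re q\<close>),
  then no point of \<open>\<Gamma>\<close> lies in the cone of opening \<open>\<pi>/2\<close> from \<open>p\<close> towards the boundary. Hence the
  steep points of \<open>\<Gamma>\<close> form a Lipschitz graph over the imaginary axis, and the other points form
  Lipschitz graphs over the pieces of a geometric partition of the real axis. Both parts are mapped
  to sets of finite length in the disk.
\<close>

section \<open>One-dimensional Hausdorff measure\<close>

text \<open>The obstacle is the boundary. The pointwise bound for \<open>q\<close> grows like
  \<open>1 / Re s\<close>, so integrating it towards the boundary would bound \<open>h\<close> only
  up to a logarithm. What stays bounded are averages of \<open>Re q\<close> along vertical segments,
  and they come from Cauchy's theorem with a weight chosen so that \<open>Re q > 0\<close> allows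
  the horizontal edges to be dropped. This controls the oscillation of \<open>Im h\<close> on
  vertical segments. The same identity for \<open>h\<close> itself controls the central value: there
  the horizontal edges reproduce the unknown with a factor less than 1, so that it can be absorbed.
  Since the measure is monotone, it is enough to measure the level set containing the orbit; neither
  the speed of the orbit nor the connectedness of the level set enters. Two points lie outside this
  scheme. If \<open>Re F\<close> vanishes somewhere, \<open>F\<close> is an imaginary constant and
  the orbit lies on a vertical line or a circle. And differentiability in time is not part of the
  definition of a semigroup, so the generator has to be obtained by smoothing in time.\<close>

lemma diameter_le_metric:
  fixes S :: "'a::metric_space set"
  assumes "0 \<le> d" and "\<And>x y. x \<in> S \<Longrightarrow> y \<in> S \<Longrightarrow> dist x y \<le> d"
  shows "bounded S" and "diameter S \<le> d"
proof -
  show "bounded S"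
    unfolding bounded_def using assms(2) by blast
  show "diameter S \<le> d"
    unfolding diameter_def using assms by (auto intro!: cSUP_least)
qed

lemma hausdorff_content_1_le:
  assumes "E \<subseteq> (\<Union>i. U i)" and "\<And>i. bounded (U i)" and "\<And>i. diameter (U i) \<le> \<delta>"
  shows "hausdorff_content_1 \<delta> E \<le> (\<Sum>i. ennreal (diameter (U i)))"
  unfolding hausdorff_content_1_def using assms by (intro Inf_lower) auto

lemma hausdorff_content_1_le_measure:
  "\<delta> > 0 \<Longrightarrow> hausdorff_content_1 \<delta> E \<le> hausdorff_measure_1 E"
  unfolding hausdorff_measure_1_def by (rule SUP_upper) auto

lemma hausdorff_content_1_cover:
  assumes "hausdorff_content_1 \<delta> E < c"
  obtains U where "E \<subseteq> (\<Union>i. U i)" "\<And>i. bounded (U i)" "\<And>i. diameter (U i) \<le> \<delta>"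
    "(\<Sum>i. ennreal (diameter (U i))) < c"
  using assms unfolding hausdorff_content_1_def Inf_less_iff by auto

lemma hausdorff_measure_1_mono:
  assumes "E \<subseteq> F"
  shows "hausdorff_measure_1 E \<le> hausdorff_measure_1 F"
  unfolding hausdorff_measure_1_def hausdorff_content_1_def
  using assms by (intro SUP_mono bexI Inf_superset_mono) auto

lemma hausdorff_measure_1_UN_le:
  fixes E :: "nat \<Rightarrow> 'a::metric_space set"
  shows "hausdorff_measure_1 (\<Union>n. E n) \<le> (\<Sum>n. hausdorff_measure_1 (E n))"
proof (cases "(\<Sum>n. hausdorff_measure_1 (E n)) = \<infinity>")
  case False
  have fin: "hausdorff_measure_1 (E n) < \<infinity>" for n
    using False ennreal_suminf_lessD[of "\<lambda>n. hausdorff_measure_1 (E n)" \<infinity>]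
    by (simp add: less_top)
  have "hausdorff_content_1 \<delta> (\<Union>n. E n) \<le> (\<Sum>n. hausdorff_measure_1 (E n))" if "\<delta> > 0" for \<delta>
  proof (rule ennreal_le_epsilon)
    fix e :: real assume e: "e > 0"
    define c where "c n = e * (1/2)^Suc n" for n
    have c_pos: "c n > 0" for n using e by (simp add: c_def)
    have "\<exists>U. E n \<subseteq> (\<Union>i. U i) \<and> (\<forall>i. bounded (U i) \<and> diameter (U i) \<le> \<delta>) \<and>
        (\<Sum>i. ennreal (diameter (U i))) \<le> hausdorff_measure_1 (E n) + ennreal (c n)" for n
    proof -
      have "hausdorff_content_1 \<delta> (E n) < hausdorff_measure_1 (E n) + ennreal (c n)"
      proof -
        have "hausdorff_content_1 \<delta> (E n) \<le> hausdorff_measure_1 (E n)"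
          by (rule hausdorff_content_1_le_measure[OF that])
        also have "\<dots> < hausdorff_measure_1 (E n) + ennreal (c n)"
          using fin[of n] c_pos[of n] ennreal_add_left_cancel_less[of "hausdorff_measure_1 (E n)" 0]
          by (auto simp: less_top)
        finally show ?thesis .
      qed
      then show ?thesis
        by (metis hausdorff_content_1_cover order_less_imp_le)
    qed
    then obtain U where U: "\<And>n. E n \<subseteq> (\<Union>i. U n i)" "\<And>n i. bounded (U n i)"
      "\<And>n i. diameter (U n i) \<le> \<delta>"
      "\<And>n. (\<Sum>i. ennreal (diameter (U n i))) \<le> hausdorff_measure_1 (E n) + ennreal (c n)"
      by metis
    define V where "V k = (case prod_decode k of (n, i) \<Rightarrow> U n i)" for k
    have "(\<Union>n. E n) \<subseteq> (\<Union>k. V k)"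
    proof
      fix x assume "x \<in> (\<Union>n. E n)"
      then obtain n i where "x \<in> U n i" using U(1) by blast
      then have "x \<in> V (prod_encode (n, i))" by (simp add: V_def)
      then show "x \<in> (\<Union>k. V k)" by blast
    qed
    then have "hausdorff_content_1 \<delta> (\<Union>n. E n) \<le> (\<Sum>k. ennreal (diameter (V k)))"
      by (rule hausdorff_content_1_le) (auto simp: V_def U split: prod.splits)
    also have "\<dots> = (\<Sum>k. (\<lambda>(n, i). ennreal (diameter (U n i))) (prod_decode k))"
      by (simp add: V_def case_prod_beta)
    also have "\<dots> = (\<Sum>n. \<Sum>i. ennreal (diameter (U n i)))"
      by (rule suminf_ennreal_2dimen) simp
    also have "\<dots> \<le> (\<Sum>n. hausdorff_measure_1 (E n) + ennreal (c n))"
      by (intro suminf_le U) auto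
    also have "\<dots> = (\<Sum>n. hausdorff_measure_1 (E n)) + (\<Sum>n. ennreal (c n))"
      by (rule suminf_add[symmetric]) auto
    also have "(\<Sum>n. ennreal (c n)) = ennreal e"
    proof -
      have "c sums (e * 1)"
        unfolding c_def by (intro sums_mult power_half_series)
      then show ?thesis
        using c_pos by (intro suminf_ennreal_eq) (auto intro: less_imp_le)
    qed
    finally show "hausdorff_content_1 \<delta> (\<Union>n. E n) \<le> (\<Sum>n. hausdorff_measure_1 (E n)) + ennreal e" .
  qed
  then show ?thesis
    unfolding hausdorff_measure_1_def[of "\<Union>n. E n"] by (intro SUP_least) auto
qed simp

text \<open>\<open>L\<close> is a real coordinate in which \<open>f\<close> is 1-Lipschitz, so
  slicing \<open>[a, b]\<close> evenly gives covers of total diameter at most \<open>b - a\<close>.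
  As \<open>P\<close> is an arbitrary set, scattered pieces of a level set can be measured without a
  parametrisation. All lengths below are ultimately bounded in this way.\<close>

lemma hausdorff_measure_1_image_le:
  fixes f :: "'b \<Rightarrow> 'a::metric_space" and L :: "'b \<Rightarrow> real"
  assumes lip: "\<And>p q. p \<in> P \<Longrightarrow> q \<in> P \<Longrightarrow> dist (f p) (f q) \<le> \<bar>L p - L q\<bar>"
    and L: "\<And>p. p \<in> P \<Longrightarrow> a \<le> L p \<and> L p \<le> b" and "a \<le> b"
  shows "hausdorff_measure_1 (f ` P) \<le> ennreal (b - a)"
  unfolding hausdorff_measure_1_def
proof (rule SUP_least)
  fix \<delta> :: real assume "\<delta> \<in> {0<..}"
  then have \<delta>: "\<delta> > 0" by simp
  obtain m :: nat where m: "(b - a) / \<delta> < real m"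
    using reals_Archimedean2 by blast
  define n where "n = Suc m"
  define d where "d = (b - a) / n"
  have n: "n > 0" and nd: "n * d = b - a" and d0: "0 \<le> d"
    using \<open>a \<le> b\<close> by (auto simp: d_def n_def)
  have d: "d \<le> \<delta>"
    using m \<delta> unfolding d_def n_def by (simp add: field_simps)
  define U where "U i = (if i < n then f ` {p \<in> P. a + i * d \<le> L p \<and> L p \<le> a + (i + 1) * d} else {})" for i
  have dU: "dist x y \<le> d" if xy: "x \<in> U i" "y \<in> U i" for x y i
  proof -
    from xy have "i < n" by (auto simp: U_def split: if_splits)
    with xy obtain p q where pq: "p \<in> P" "q \<in> P" "x = f p" "y = f q"
      "a + i * d \<le> L p" "L p \<le> a + (real i + 1) * d" "a + i * d \<le> L q" "L q \<le> a + (real i + 1) * d"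
      unfolding U_def by fastforce
    have "dist x y \<le> \<bar>L p - L q\<bar>" using lip pq by simp
    also have "\<dots> \<le> d" using pq by (simp add: algebra_simps abs_le_iff)
    finally show ?thesis .
  qed
  have cover: "f ` P \<subseteq> (\<Union>i. U i)"
  proof
    fix x assume "x \<in> f ` P"
    then obtain p where p: "p \<in> P" "x = f p" by blast
    have "\<exists>i<n. a + real i * d \<le> L p \<and> L p \<le> a + (real i + 1) * d"
    \<comment> \<open>The floor formula of the other case would give the index \<open>n\<close> at
      the right endpoint and divides by \<open>d\<close>; here the last piece, with index
      \<open>m = n - 1\<close>, is used instead.\<close>
    proof (cases "L p = b \<or> d = 0")
      case True
      have "a + real m * d \<le> L p \<and> L p \<le> a + (real m + 1) * d"
        using True nd L[OF p(1)] \<open>a \<le> b\<close> d0 by (auto simp: n_def algebra_simps)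
      then show ?thesis by (auto simp: n_def)
    next
      case False
      with d0 have "d > 0" by simp
      define i where "i = nat \<lfloor>(L p - a) / d\<rfloor>"
      have nn: "(L p - a) / d \<ge> 0" using L[OF p(1)] d0 by simp
      have i: "real i \<le> (L p - a) / d" "(L p - a) / d < real i + 1"
        using nn unfolding i_def by linarith+
      have "L p < b" using False L[OF p(1)] by force
      then have "(L p - a) / d < real n"
        using nd \<open>d > 0\<close> by (simp add: field_simps)
      with i have "i < n" by linarith
      moreover have "a + real i * d \<le> L p" "L p \<le> a + (real i + 1) * d"
        using i \<open>d > 0\<close> by (simp_all add: field_simps)
      ultimately show ?thesis by blast
    qed
    then show "x \<in> (\<Union>i. U i)" using p by (auto simp: U_def)
  qed
  have bU: "bounded (U i)" "diameter (U i) \<le> d" for i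
    by (rule diameter_le_metric[OF d0 dU]; assumption)+
  have "hausdorff_content_1 \<delta> (f ` P) \<le> (\<Sum>i. ennreal (diameter (U i)))"
    using cover bU(1) order_trans[OF bU(2) d] by (rule hausdorff_content_1_le)
  also have "\<dots> = (\<Sum>i<n. ennreal (diameter (U i)))"
    by (rule suminf_finite) (auto simp: U_def)
  also have "\<dots> \<le> (\<Sum>i<n. ennreal d)"
    by (intro sum_mono ennreal_leI bU(2))
  also have "\<dots> = ennreal (b - a)"
    using d0 nd by (simp add: sum_ennreal ennreal_of_nat_eq_real_of_nat flip: ennreal_mult)
  finally show "hausdorff_content_1 \<delta> (f ` P) \<le> ennreal (b - a)" .
qed

lemma hausdorff_measure_1_empty [simp]: "hausdorff_measure_1 ({} :: 'a::metric_space set) = 0"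
  using hausdorff_measure_1_image_le[of "{} :: unit set" "\<lambda>_. undefined :: 'a" _ 0 0] by simp

lemma hausdorff_measure_1_Un_finite:
  assumes "hausdorff_measure_1 E < \<infinity>" "hausdorff_measure_1 F < \<infinity>"
  shows "hausdorff_measure_1 (E \<union> F) < \<infinity>"
proof -
  define A where "A n = (if n = 0 then E else if n = 1 then F else {})" for n :: nat
  have "E \<union> F = (\<Union>n. A n)"
    by (auto simp: A_def split: if_splits)
  then have "hausdorff_measure_1 (E \<union> F) \<le> (\<Sum>n. hausdorff_measure_1 (A n))"
    by (simp add: hausdorff_measure_1_UN_le)
  also have "\<dots> = (\<Sum>n<2. hausdorff_measure_1 (A n))"
    by (rule suminf_finite) (auto simp: A_def)
  also have "\<dots> = hausdorff_measure_1 E + hausdorff_measure_1 F"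
    by (simp add: A_def numeral_2_eq_2)
  also have "\<dots> < \<infinity>" using assms by (simp add: less_top)
  finally show ?thesis .
qed

lemma hausdorff_measure_1_UN_finite:
  fixes E :: "nat \<Rightarrow> 'a::metric_space set"
  assumes "\<And>n. hausdorff_measure_1 (E n) \<le> ennreal (c n)" and "summable c" and "\<And>n. 0 \<le> c n"
  shows "hausdorff_measure_1 (\<Union>n. E n) < \<infinity>"
proof -
  have "hausdorff_measure_1 (\<Union>n. E n) \<le> (\<Sum>n. ennreal (c n))"
    by (rule order_trans[OF hausdorff_measure_1_UN_le]) (auto intro: suminf_le assms(1))
  also have "\<dots> = ennreal (\<Sum>n. c n)"
    using assms(2,3) by (simp add: suminf_ennreal2)
  also have "\<dots> < \<infinity>" by simp
  finally show ?thesis .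
qed

section \<open>Functions with positive real part on a half-plane\<close>

abbreviation half_plane :: "complex set" ("\<H>")
  where "\<H> \<equiv> {z. Re z > 0}"

lemma open_half_plane: "open \<H>"
  by (rule open_halfspace_Re_gt)

lemma convex_half_plane: "convex \<H>"
  by (rule convex_halfspace_Re_gt)

section \<open>Pointwise bounds from the Schwarz lemma\<close>

lemma norm_less_norm_add_1:
  assumes "Re z > 0"
  shows "norm (z - 1) < norm (z + 1)"
  using assms by (simp add: cmod_def power2_eq_square algebra_simps)

lemma Re_pos_add_1_nonzero: "Re w > 0 \<Longrightarrow> w + 1 \<noteq> 0"
  by (auto simp: complex_eq_iff)

text \<open>The Schwarz lemma for the Cayley transforms of \<open>z\<close> and \<open>q z\<close>
  gives |q z - 1| |z + 1| \<le> |z - 1| |q z + 1|. Squared and simplified, this is an inequality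
  with a sum on the left: dropping one summand gives the upper bound for \<open>q\<close>, dropping
  the other the lower bound for \<open>Re q\<close>.\<close>

lemma positive_real_part_bound:
  assumes hol: "q holomorphic_on \<H>" and pos: "\<And>z. z \<in> \<H> \<Longrightarrow> Re (q z) > 0"
    and q1: "q 1 = 1" and z: "z \<in> \<H>"
  shows "((norm (q z))\<^sup>2 + 1) * Re z \<le> Re (q z) * ((norm z)\<^sup>2 + 1)"
proof -
  define C where "C w = (1 + w) / (1 - w)" for w :: complex
  define f where "f w = (q (C w) - 1) / (q (C w) + 1)" for w
  have C_pos: "Re (C w) > 0" if "norm w < 1" for w
  proof -
    have "w \<noteq> 1" using that by auto
    have "Re ((1 + w) * cnj (1 - w)) = 1 - (norm w)\<^sup>2"
      by (simp add: cmod_power2) (simp add: algebra_simps power2_eq_square)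
    moreover have "(norm w)\<^sup>2 < 1" using that by (simp add: power_less_one_iff)
    ultimately show ?thesis
      using \<open>w \<noteq> 1\<close> unfolding C_def
      by (subst complex_div_cnj) (simp add: Re_divide_of_real zero_less_divide_iff flip: of_real_power)
  qed
  have qp: "q (C w) + 1 \<noteq> 0" if "norm w < 1" for w
    using pos[of "C w"] C_pos[OF that] by (intro Re_pos_add_1_nonzero) auto
  have "f holomorphic_on \<D>"
  proof -
    have "C holomorphic_on \<D>"
      unfolding C_def by (intro holomorphic_intros) auto
    moreover have "C ` \<D> \<subseteq> \<H>" using C_pos by auto
    ultimately have "(q \<circ> C) holomorphic_on \<D>"
      using holomorphic_on_compose_gen hol by blast
    then show ?thesis
      unfolding f_def o_def by (intro holomorphic_intros) (use qp in auto)
  qed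
  moreover have "f 0 = 0" by (simp add: f_def C_def q1)
  moreover have "norm (f w) < 1" if "norm w < 1" for w
    using norm_less_norm_add_1[of "q (C w)"] pos[of "C w"] C_pos[OF that] qp[OF that]
    by (simp add: f_def norm_divide)
  moreover have z1: "z + 1 \<noteq> 0" using z Re_pos_add_1_nonzero[of z] by simp
  moreover have w: "norm ((z - 1) / (z + 1)) < 1"
    using norm_less_norm_add_1[of z] z z1 by (simp add: norm_divide)
  ultimately have "norm (f ((z - 1) / (z + 1))) \<le> norm ((z - 1) / (z + 1))"
    by (intro Schwarz_Lemma(1)) auto
  moreover have "C ((z - 1) / (z + 1)) = z"
  proof -
    have "1 + (z - 1) / (z + 1) = 2 * z / (z + 1)" "1 - (z - 1) / (z + 1) = 2 / (z + 1)"
      using z1 by (simp_all add: divide_simps)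
    then show ?thesis using z1 by (simp add: C_def)
  qed
  ultimately have "norm (q z - 1) / norm (q z + 1) \<le> norm (z - 1) / norm (z + 1)"
    by (simp add: f_def norm_divide)
  moreover have "q z + 1 \<noteq> 0" using pos[OF z] by (rule Re_pos_add_1_nonzero)
  ultimately have "norm (q z - 1) * norm (z + 1) \<le> norm (z - 1) * norm (q z + 1)"
    using z1 by (simp add: field_simps)
  then have "(norm (q z - 1) * norm (z + 1))\<^sup>2 \<le> (norm (z - 1) * norm (q z + 1))\<^sup>2"
    by (intro power_mono) auto
  then show ?thesis
    unfolding power_mult_distrib cmod_power2 by (simp add: power2_eq_square algebra_simps)
qed

corollary positive_real_part_upper:
  assumes "q holomorphic_on \<H>" "\<And>z. z \<in> \<H> \<Longrightarrow> Re (q z) > 0" "q 1 = 1" and z: "z \<in> \<H>"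
  shows "norm (q z) \<le> ((norm z)\<^sup>2 + 1) / Re z"
proof -
  have "(norm (q z))\<^sup>2 * Re z \<le> ((norm (q z))\<^sup>2 + 1) * Re z" using z by simp
  also have "\<dots> \<le> Re (q z) * ((norm z)\<^sup>2 + 1)"
    using positive_real_part_bound assms by blast
  also have "\<dots> \<le> norm (q z) * ((norm z)\<^sup>2 + 1)"
    by (intro mult_right_mono complex_Re_le_cmod) auto
  finally have "norm (q z) * (norm (q z) * Re z) \<le> norm (q z) * ((norm z)\<^sup>2 + 1)"
    by (simp add: power2_eq_square mult.assoc)
  moreover have "norm (q z) > 0" using assms(2)[OF z] by force
  ultimately have "norm (q z) * Re z \<le> (norm z)\<^sup>2 + 1"
    by (rule mult_left_le_imp_le)
  then show ?thesis using z by (simp add: field_simps)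
qed

corollary positive_real_part_lower:
  assumes "q holomorphic_on \<H>" "\<And>z. z \<in> \<H> \<Longrightarrow> Re (q z) > 0" "q 1 = 1" and z: "z \<in> \<H>"
  shows "Re (q z) \<ge> Re z / ((norm z)\<^sup>2 + 1)"
proof -
  have "1 * Re z \<le> ((norm (q z))\<^sup>2 + 1) * Re z" using z by (intro mult_right_mono) auto
  also have "\<dots> \<le> Re (q z) * ((norm z)\<^sup>2 + 1)"
    using positive_real_part_bound assms by blast
  finally show ?thesis by (simp add: divide_le_eq add_nonneg_pos)
qed

section \<open>Cauchy's theorem on rectangles with a cosh weight\<close>

lemma has_integral_horizontal:
  assumes "\<And>z. z \<in> \<H> \<Longrightarrow> (\<Phi> has_field_derivative g z) (at z)" and "0 < s" "s \<le> t"
  shows "((\<lambda>x. g (Complex x y)) has_integral (\<Phi> (Complex t y) - \<Phi> (Complex s y))) {s..t}"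
proof (rule fundamental_theorem_of_calculus[OF \<open>s \<le> t\<close>])
  fix x assume x: "x \<in> {s..t}"
  have "((\<lambda>x. Complex x y) has_vector_derivative 1) (at x within {s..t})"
    unfolding Complex_eq by (auto intro!: derivative_eq_intros)
  from field_vector_diff_chain_within[OF this DERIV_subset[OF assms(1)[of "Complex x y"] subset_UNIV]]
  show "((\<lambda>x. \<Phi> (Complex x y)) has_vector_derivative g (Complex x y)) (at x within {s..t})"
    using x \<open>0 < s\<close> by (simp add: o_def)
qed

lemma has_integral_vertical:
  assumes "\<And>z. z \<in> \<H> \<Longrightarrow> (\<Phi> has_field_derivative g z) (at z)" and "0 < s" "a \<le> b"
  shows "((\<lambda>y. \<i> * g (Complex s y)) has_integral (\<Phi> (Complex s b) - \<Phi> (Complex s a))) {a..b}"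
proof (rule fundamental_theorem_of_calculus[OF \<open>a \<le> b\<close>])
  fix y assume y: "y \<in> {a..b}"
  have "((\<lambda>y. Complex s y) has_vector_derivative \<i>) (at y within {a..b})"
    unfolding Complex_eq by (auto intro!: derivative_eq_intros)
  from field_vector_diff_chain_within[OF this DERIV_subset[OF assms(1)[of "Complex s y"] subset_UNIV]]
  show "((\<lambda>y. \<Phi> (Complex s y)) has_vector_derivative \<i> * g (Complex s y)) (at y within {a..b})"
    using \<open>0 < s\<close> by (simp add: o_def mult.commute)
qed

lemma holomorphic_half_plane_primitive:
  assumes "g holomorphic_on \<H>"
  obtains \<Phi> where "\<And>z. z \<in> \<H> \<Longrightarrow> (\<Phi> has_field_derivative g z) (at z)"
  using holomorphic_convex_primitive'[OF convex_half_plane open_half_plane assms]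
    at_within_open[OF _ open_half_plane] by metis

lemma exp_imaginary: "exp (\<i> * of_real t) = cis t" "exp (- (\<i> * of_real t)) = cis (- t)"
  by (simp_all add: cis_conv_exp)

lemma cosh_imaginary: "cosh (\<i> * of_real t) = complex_of_real (cos t)"
  unfolding cosh_def exp_imaginary by (simp add: complex_eq_iff)

lemma sinh_imaginary: "sinh (\<i> * of_real t) = \<i> * complex_of_real (sin t)"
  unfolding sinh_def exp_imaginary by (simp add: complex_eq_iff)

lemma of_real_sinh: "complex_of_real (sinh t) = sinh (of_real t)"
  by (simp add: sinh_def scaleR_conv_of_real exp_of_real flip: of_real_minus)

text \<open>
  Cauchy's theorem on \<open>[s, 1] \<times> [-a, a]\<close>. The weight is real on the left edge and, as \<open>\<omega> a = \<pi>/2\<close>,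
  purely imaginary on the horizontal edges, so that real and imaginary parts of \<open>f\<close> do not mix there.
\<close>

lemma cosh_weighted_integral:
  fixes f :: "complex \<Rightarrow> complex" and \<omega> a s :: real
  defines "W \<equiv> \<lambda>z. cosh (of_real \<omega> * (z - of_real s))"
  assumes hol: "f holomorphic_on \<H>" and s: "0 < s" "s \<le> 1" and a: "0 \<le> a" "\<omega> * a = pi / 2"
  shows "((\<lambda>y. f (Complex s y) * of_real (cos (\<omega> * y))) has_integral
      (integral {-a..a} (\<lambda>y. f (Complex 1 y) * W (Complex 1 y)) -
       integral {s..1} (\<lambda>x. (f (Complex x a) + f (Complex x (-a))) * of_real (sinh (\<omega> * (x - s))))))
     {-a..a}"
proof -
  have "(\<lambda>z. f z * W z) holomorphic_on \<H>"
    unfolding W_def cosh_def by (intro holomorphic_intros hol)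
  then obtain \<Phi> where \<Phi>: "\<And>z. z \<in> \<H> \<Longrightarrow> (\<Phi> has_field_derivative f z * W z) (at z)"
    using holomorphic_half_plane_primitive by blast
  have W_left: "W (Complex s y) = of_real (cos (\<omega> * y))" for y
  proof -
    have "of_real \<omega> * (Complex s y - of_real s) = \<i> * of_real (\<omega> * y)"
      by (simp add: complex_eq_iff)
    then show ?thesis unfolding W_def by (simp only: cosh_imaginary)
  qed
  have W_side: "W (Complex x (e * a)) = of_real e * \<i> * of_real (sinh (\<omega> * (x - s)))"
    if "e = 1 \<or> e = -1" for x e
  proof -
    have "of_real \<omega> * (Complex x (e * a) - of_real s) = of_real (\<omega> * (x - s)) + \<i> * of_real (e * (pi / 2))"
      using a(2) by (simp add: complex_eq_iff algebra_simps)
    then have "W (Complex x (e * a)) = cosh (of_real (\<omega> * (x - s)) + \<i> * of_real (e * (pi / 2)))"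
      unfolding W_def by simp
    also have "\<dots> = sinh (of_real (\<omega> * (x - s))) * (\<i> * of_real e)"
      unfolding cosh_add cosh_imaginary sinh_imaginary using that by auto
    finally show ?thesis by (simp only: of_real_sinh mult_ac)
  qed
  note H = has_integral_horizontal[OF \<Phi> s] and V = has_integral_vertical[OF \<Phi>]
  have i1: "((\<lambda>y. \<i> * (f (Complex s y) * of_real (cos (\<omega> * y)))) has_integral
      \<Phi> (Complex s a) - \<Phi> (Complex s (-a))) {-a..a}"
    using V[of s "-a" a] s a by (simp add: W_left)
  have i2: "((\<lambda>y. \<i> * (f (Complex 1 y) * W (Complex 1 y))) has_integral
      \<Phi> (Complex 1 a) - \<Phi> (Complex 1 (-a))) {-a..a}"
    using V[of 1 "-a" a] a by simp
  have i3: "((\<lambda>x. \<i> * (f (Complex x a) * of_real (sinh (\<omega> * (x - s))))) has_integral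
      \<Phi> (Complex 1 a) - \<Phi> (Complex s a)) {s..1}"
    using H[of a] W_side[of 1] by (simp add: mult_ac)
  have i4: "((\<lambda>x. - (\<i> * (f (Complex x (-a)) * of_real (sinh (\<omega> * (x - s)))))) has_integral
      \<Phi> (Complex 1 (-a)) - \<Phi> (Complex s (-a))) {s..1}"
    using H[of "-a"] W_side[of "-1"] by (simp add: mult_ac)
  have j: "((\<lambda>x. \<i> * ((f (Complex x a) + f (Complex x (-a))) * of_real (sinh (\<omega> * (x - s))))) has_integral
      (\<Phi> (Complex 1 a) - \<Phi> (Complex s a)) - (\<Phi> (Complex 1 (-a)) - \<Phi> (Complex s (-a)))) {s..1}"
    using has_integral_diff[OF i3 i4] by (simp add: algebra_simps)
  have div: "(F has_integral I / \<i>) S" if "((\<lambda>y. \<i> * F y) has_integral I) S"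
    for F :: "real \<Rightarrow> complex" and I S
    using has_integral_mult_right[OF that, of "-\<i>"] by (simp add: mult.assoc[symmetric] mult.commute)
  show ?thesis
    using div[OF i1] unfolding integral_unique[OF div[OF i2]] integral_unique[OF div[OF j]]
    by (simp add: algebra_simps)
qed

lemma norm_cosh_le: "norm (cosh z) \<le> exp \<bar>Re z\<bar>" for z :: complex
proof -
  have "norm (cosh z) \<le> (norm (exp z) + norm (exp (- z))) / 2"
    unfolding cosh_def using norm_triangle_ineq[of "exp z" "exp (- z)"] by simp
  also have "\<dots> \<le> (exp \<bar>Re z\<bar> + exp \<bar>Re z\<bar>) / 2"
    by (intro divide_right_mono add_mono) auto
  finally show ?thesis by simp
qed

lemma continuous_on_holomorphic_Complex:
  assumes "f holomorphic_on \<H>" "continuous_on A u" "continuous_on A v" "\<And>x. x \<in> A \<Longrightarrow> u x > 0"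
  shows "continuous_on A (\<lambda>x. f (Complex (u x) (v x)))"
proof (rule continuous_on_compose2[OF holomorphic_on_imp_continuous_on[OF assms(1)]])
  show "continuous_on A (\<lambda>x. Complex (u x) (v x))"
    unfolding Complex_eq using assms by (intro continuous_intros)
qed (use assms in auto)

lemma norm_integral_right_edge_le:
  assumes f: "f holomorphic_on \<H>" and B: "\<And>y. \<bar>y\<bar> \<le> a \<Longrightarrow> norm (f (Complex 1 y)) \<le> B"
    and "0 < s" "s \<le> 1" "0 \<le> a" "0 \<le> \<omega>" "\<omega> \<le> 1"
  shows "norm (integral {-a..a} (\<lambda>y. f (Complex 1 y) *
    cosh (of_real \<omega> * (Complex 1 y - of_real s)))) \<le> 2 * a * (3 * B)"
proof -
  have "norm (integral {-a..a} (\<lambda>y. f (Complex 1 y) *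
      cosh (of_real \<omega> * (Complex 1 y - of_real s)))) \<le> B * 3 * (a - (-a))"
  proof (rule integral_bound)
    show "continuous_on {-a..a} (\<lambda>y. f (Complex 1 y) * cosh (of_real \<omega> * (Complex 1 y - of_real s)))"
      unfolding cosh_def
      by (intro continuous_intros continuous_on_holomorphic_Complex[OF f]
          continuous_on_holomorphic_Complex[of "\<lambda>z. z"]) auto
    fix y assume y: "y \<in> {-a..a}"
    have "norm (cosh (of_real \<omega> * (Complex 1 y - of_real s))) \<le> exp \<bar>Re (of_real \<omega> * (Complex 1 y - of_real s))\<bar>"
      by (rule norm_cosh_le)
    also have "\<dots> \<le> exp 1"
      using assms(3,4,6,7) by (simp add: abs_mult mult_le_one)
    also have "\<dots> \<le> 3" by (rule exp_le)
    finally show "norm (f (Complex 1 y) * cosh (of_real \<omega> * (Complex 1 y - of_real s))) \<le> B * 3"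
      using y B[of y] order_trans[OF norm_ge_zero B[of y]]
      by (auto simp: norm_mult intro!: mult_mono)
  qed (use assms in auto)
  then show ?thesis by (simp add: mult_ac)
qed

text \<open>Real part of the weighted Cauchy identity with \<open>\<omega> = 1/2\<close> and
  \<open>a = pi\<close>. The horizontal edges enter with a minus sign and a nonnegative integrand,
  so only the right edge, where \<open>q\<close> is bounded, remains. The bound is independent of
  \<open>s\<close>: this is the control of \<open>q\<close> up to the boundary.\<close>

lemma integral_Re_cos_le:
  fixes q :: "complex \<Rightarrow> complex"
  assumes hol: "q holomorphic_on \<H>" and pos: "\<And>z. z \<in> \<H> \<Longrightarrow> Re (q z) > 0"
    and q1: "q 1 = 1" and s: "0 < s" "s \<le> 1"
  shows "integral {-pi..pi} (\<lambda>y. Re (q (Complex s y)) * cos (y / 2)) \<le> 400"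
proof -
  define I1 where "I1 = integral {-pi..pi} (\<lambda>y. q (Complex 1 y) *
    cosh (of_real (1/2) * (Complex 1 y - of_real s)))"
  define I2 where "I2 = integral {s..1} (\<lambda>x. (q (Complex x pi) + q (Complex x (-pi))) *
    of_real (sinh (1/2 * (x - s))))"
  have "((\<lambda>y. q (Complex s y) * of_real (cos (1/2 * y))) has_integral (I1 - I2)) {-pi..pi}"
    using cosh_weighted_integral[OF hol s, of pi "1/2"] unfolding I1_def I2_def by simp
  from integral_unique[OF has_integral_Re[OF this]]
  have "integral {-pi..pi} (\<lambda>y. Re (q (Complex s y)) * cos (y / 2)) = Re I1 - Re I2"
    by simp
  also have "Re I2 \<ge> 0"
  proof -
    have c: "continuous_on {s..1} (\<lambda>x. q (Complex x b))" for b
      by (rule continuous_on_holomorphic_Complex[OF hol]) (use s in auto)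
    have cont: "continuous_on {s..1} (\<lambda>x. (q (Complex x pi) + q (Complex x (-pi))) *
        of_real (sinh (1/2 * (x - s))))"
      by (intro continuous_on_mult continuous_on_add c continuous_on_of_real continuous_on_sinh continuous_intros)
    have "Re I2 = integral {s..1} (\<lambda>x. Re ((q (Complex x pi) + q (Complex x (-pi))) *
        of_real (sinh (1/2 * (x - s)))))"
      unfolding I2_def
      by (rule integral_unique[OF has_integral_Re[OF integrable_integral[OF
          integrable_continuous_real[OF cont]]], symmetric])
    also have "\<dots> \<ge> 0"
    proof (intro integral_nonneg integrable_continuous_real continuous_on_Re cont)
      fix x assume "x \<in> {s..1}"
      then have "Re (q (Complex x pi)) > 0" "Re (q (Complex x (-pi))) > 0" "sinh (1/2 * (x - s)) \<ge> 0"
        using s by (auto intro!: pos)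
      then show "Re ((q (Complex x pi) + q (Complex x (-pi))) * of_real (sinh (1/2 * (x - s)))) \<ge> 0"
        by (simp add: mult_nonneg_nonneg)
    qed
    finally show ?thesis .
  qed
  then have "Re I1 - Re I2 \<le> Re I1" by simp
  also have "\<dots> \<le> norm I1" by (rule complex_Re_le_cmod)
  also have "\<dots> \<le> 2 * pi * (3 * (2 + pi\<^sup>2))"
    unfolding I1_def
  proof (rule norm_integral_right_edge_le[OF hol _ s])
    fix y assume "\<bar>y\<bar> \<le> pi"
    then have "y\<^sup>2 \<le> pi\<^sup>2" by (metis abs_le_square_iff abs_of_pos pi_gt_zero)
    then show "norm (q (Complex 1 y)) \<le> 2 + pi\<^sup>2"
      using positive_real_part_upper[OF hol pos q1, of "Complex 1 y"] by (simp add: cmod_power2)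
  qed auto
  also have "\<dots> \<le> 2 * 3.2 * (3 * (2 + 3.2\<^sup>2))"
    using pi_approx by (intro mult_mono add_mono power_mono) auto
  also have "\<dots> \<le> 400" by (simp add: power2_eq_square)
  finally show ?thesis by simp
qed

lemma cosh_1_le: "cosh (1::real) \<le> 17/10"
proof -
  have "inverse (exp (1::real)) \<le> inverse 2"
    using exp_ge_add_one_self[of "1::real"] by (intro le_imp_inverse_le) auto
  then show ?thesis using e_less_272 by (simp add: cosh_def exp_minus)
qed

lemma has_integral_abs_le:
  fixes f g :: "'n::euclidean_space \<Rightarrow> real"
  assumes "(f has_integral I) S" "(g has_integral J) S" "\<And>x. x \<in> S \<Longrightarrow> \<bar>f x\<bar> \<le> g x"
  shows "\<bar>I\<bar> \<le> J"
proof -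
  have "I \<le> J" using assms(3) by (intro has_integral_le[OF assms(1,2)]) (auto simp: abs_le_iff)
  moreover have "- I \<le> J"
    using assms(3) by (intro has_integral_le[OF has_integral_neg[OF assms(1)] assms(2)]) (auto simp: abs_le_iff)
  ultimately show ?thesis by simp
qed

section \<open>The bound on \<open>Im h\<close> for a normalised pair, uniform up to the
  boundary\<close>

locale half_plane_primitive =
  fixes q h :: "complex \<Rightarrow> complex"
  assumes hol: "q holomorphic_on \<H>" and pos: "\<And>z. z \<in> \<H> \<Longrightarrow> Re (q z) > 0"
    and prim: "\<And>z. z \<in> \<H> \<Longrightarrow> (h has_field_derivative q z) (at z)"
begin

lemma holomorphic_h: "h holomorphic_on \<H>"
  using prim open_half_plane by (auto simp: holomorphic_on_open)

lemma has_integral_Im_h: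
  assumes "0 < s" "a \<le> b"
  shows "((\<lambda>y. Re (q (Complex s y))) has_integral (Im (h (Complex s b)) - Im (h (Complex s a)))) {a..b}"
  using has_integral_Im[OF has_integral_vertical[OF prim assms]] by simp

lemma continuous_on_q_line: "0 < s \<Longrightarrow> continuous_on A (\<lambda>y. Re (q (Complex s y)))"
  by (intro continuous_on_Re continuous_on_holomorphic_Complex[OF hol] continuous_intros) auto

lemma Im_h_mono:
  assumes "0 < s" "a \<le> b"
  shows "Im (h (Complex s a)) \<le> Im (h (Complex s b))"
  using has_integral_nonneg[OF has_integral_Im_h[OF assms]] pos[of "Complex s _"] assms(1)
  by (auto simp: less_imp_le)

end

locale normalized_half_plane_primitive = half_plane_primitive +
  assumes q1: "q 1 = 1" and h1: "h 1 = 0"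
begin

text \<open>The increment of \<open>Im h\<close> is the unweighted integral of \<open>Re q\<close>.
  On this range \<open>cos (y / 2)\<close> is at least 1/2, so it is at most twice the weighted
  integral; hence 800 = 2 * 400.\<close>

lemma Im_h_oscillation:
  assumes s: "0 < s" "s \<le> 1" and y: "-(pi/2) \<le> a" "a \<le> b" "b \<le> pi/2"
  shows "Im (h (Complex s b)) - Im (h (Complex s a)) \<le> 800"
proof -
  let ?g = "\<lambda>y. 2 * (Re (q (Complex s y)) * cos (y / 2))"
  have posq: "Re (q (Complex s y)) > 0" for y using pos s by simp
  have cont: "continuous_on A ?g" for A
    by (intro continuous_intros continuous_on_q_line s) auto
  have "Im (h (Complex s b)) - Im (h (Complex s a)) \<le> integral {a..b} ?g"
  proof (rule has_integral_le[OF has_integral_Im_h[OF s(1) y(2)]])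
    show "(?g has_integral integral {a..b} ?g) {a..b}"
      by (intro integrable_integral integrable_continuous_real cont)
    fix t assume "t \<in> {a..b}"
    then have "\<bar>t / 2\<bar> \<le> pi / 3" using y by auto
    then have "cos (pi / 3) \<le> cos \<bar>t / 2\<bar>"
      by (intro cos_monotone_0_pi_le) auto
    then have "1 / 2 \<le> cos (t / 2)" by (simp only: cos_60 cos_abs_real)
    then have "Re (q (Complex s t)) * (1/2) \<le> Re (q (Complex s t)) * cos (t / 2)"
      using posq[of t] by (intro mult_left_mono) auto
    then show "Re (q (Complex s t)) \<le> ?g t" by simp
  qed
  also have "\<dots> \<le> integral {-pi..pi} ?g"
  proof (rule integral_subset_le)
    show "{a..b} \<subseteq> {-pi..pi}" using y pi_gt_zero by auto
    show "\<forall>t \<in> {-pi..pi}. 0 \<le> ?g t"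
      using posq by (auto intro!: mult_nonneg_nonneg cos_ge_zero simp: less_imp_le)
  qed (intro integrable_continuous_real cont)+
  also have "\<dots> \<le> 800"
    using integral_Re_cos_le[OF hol pos q1 s] by simp
  finally show ?thesis .
qed

lemma Im_h_diff_center:
  assumes s: "0 < s" "s \<le> 1" and y: "\<bar>y\<bar> \<le> pi/2"
  shows "\<bar>Im (h (Complex s y)) - Im (h (Complex s 0))\<bar> \<le> 800"
proof (cases "0 \<le> y")
  case True
  then show ?thesis using Im_h_oscillation[OF s, of 0 y] Im_h_mono[of s 0 y] s y by auto
next
  case False
  then show ?thesis using Im_h_oscillation[OF s, of y 0] Im_h_mono[of s y 0] s y by auto
qed

text \<open>\<open>positive_real_part_upper\<close> integrated along the segment from 1, where
  \<open>h\<close> vanishes.\<close>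

lemma norm_h_le:
  assumes "z \<in> \<H>" and "\<And>w. w \<in> closed_segment 1 z \<Longrightarrow> ((norm w)\<^sup>2 + 1) \<le> B * Re w"
  shows "norm (h z) \<le> B * norm (z - 1)"
proof -
  have sub: "closed_segment 1 z \<subseteq> \<H>"
    using assms(1) by (intro closed_segment_subset convex_half_plane) auto
  have "norm (h z - h 1) \<le> B * norm (z - 1)"
  proof (rule field_differentiable_bound[where S = "closed_segment 1 z"])
    fix w assume w: "w \<in> closed_segment 1 z"
    with sub have wH: "w \<in> \<H>" by blast
    show "(h has_field_derivative q w) (at w within closed_segment 1 z)"
      using prim[OF wH] by (rule DERIV_subset) auto
    have "norm (q w) \<le> ((norm w)\<^sup>2 + 1) / Re w"
      by (rule positive_real_part_upper[OF hol pos q1 wH])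
    also have "\<dots> \<le> B" using assms(2)[OF w] wH by (simp add: divide_le_eq)
    finally show "norm (q w) \<le> B" .
  qed auto
  then show ?thesis by (simp add: h1)
qed

lemma norm_h_right_edge:
  assumes "\<bar>y\<bar> \<le> pi/2"
  shows "norm (h (Complex 1 y)) \<le> 10"
proof -
  have y: "\<bar>y\<bar> \<le> 16/10" using assms pi_approx by auto
  have "norm (h (Complex 1 y)) \<le> 5 * norm (Complex 1 y - 1)"
  proof (rule norm_h_le)
    fix w assume w: "w \<in> closed_segment 1 (Complex 1 y)"
    then obtain u where u: "0 \<le> u" "u \<le> 1" "w = Complex 1 (u * y)"
      by (auto simp: closed_segment_def complex_eq_iff algebra_simps)
    have "\<bar>u * y\<bar> \<le> 1 * (16/10)"
      unfolding abs_mult using u y by (intro mult_mono) auto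
    then have "\<bar>u * y\<bar>\<^sup>2 \<le> (16/10)\<^sup>2" by (intro power_mono) auto
    then show "(norm w)\<^sup>2 + 1 \<le> 5 * Re w"
      unfolding cmod_power2 using u by (simp add: power2_eq_square)
  qed auto
  also have "Complex 1 y - 1 = \<i> * of_real y" by (simp add: complex_eq_iff)
  also have "5 * norm (\<i> * of_real y) \<le> 10" using y by (simp add: norm_mult)
  finally show ?thesis .
qed

text \<open>The coefficient \<open>14/10\<close> of \<open>S\<close> is an upper bound of \<open>2 (cosh 1 - 1)\<close>; it matters that it is less than \<open>2\<close>.\<close>

lemma Im_h_center_absorb:
  assumes s: "0 < s" "s \<le> 1"
    and S: "\<And>x. s \<le> x \<Longrightarrow> x \<le> 1 \<Longrightarrow> \<bar>Im (h (Complex x 0))\<bar> \<le> S"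
  shows "2 * \<bar>Im (h (Complex s 0))\<bar> \<le> 1800 + 14/10 * (S + 800)"
proof -
  let ?v = "\<lambda>x y. Im (h (Complex x y))"
  let ?a = "pi / 2"
  define I1 where "I1 = integral {-?a..?a} (\<lambda>y. h (Complex 1 y) *
    cosh (of_real 1 * (Complex 1 y - of_real s)))"
  define I2 where "I2 = integral {s..1} (\<lambda>x. (h (Complex x ?a) + h (Complex x (-?a))) *
    of_real (sinh (1 * (x - s))))"
  \<comment> \<open>Now the Cauchy identity is applied to \<open>h\<close>, with
    \<open>\<omega> = 1\<close> and \<open>a = pi / 2\<close>. In its imaginary part the left and
    horizontal edges involve only \<open>Im h\<close>, and the horizontal ones only at heights where
    it differs from the central value by at most 800.\<close>
  have "((\<lambda>y. h (Complex s y) * of_real (cos (1 * y))) has_integral (I1 - I2)) {-?a..?a}"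
    using cosh_weighted_integral[OF holomorphic_h s, of ?a 1] unfolding I1_def I2_def by simp
  from has_integral_Im[OF this]
  have J: "((\<lambda>y. ?v s y * cos y) has_integral (Im I1 - Im I2)) {-?a..?a}"
    by simp
  have "\<bar>Im I1\<bar> \<le> norm I1" by (rule abs_Im_le_cmod)
  also have "\<dots> \<le> 2 * ?a * (3 * 10)"
    unfolding I1_def by (rule norm_integral_right_edge_le[OF holomorphic_h _ s]) (auto intro: norm_h_right_edge)
  also have "\<dots> \<le> 200" using pi_approx by simp
  finally have I1: "\<bar>Im I1\<bar> \<le> 200" .
  have I2: "\<bar>Im I2\<bar> \<le> 14/10 * (S + 800)"
  proof -
    let ?g = "\<lambda>x. (h (Complex x ?a) + h (Complex x (-?a))) * of_real (sinh (1 * (x - s)))"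
    have c: "continuous_on {s..1} (\<lambda>x. h (Complex x b))" for b
      by (rule continuous_on_holomorphic_Complex[OF holomorphic_h]) (use s in auto)
    have cont: "continuous_on {s..1} ?g"
      by (intro continuous_on_mult continuous_on_add c continuous_on_of_real continuous_on_sinh continuous_intros)
    have sinh: "((\<lambda>x. sinh (x - s)) has_integral cosh (1 - s) - cosh (s - s)) {s..1}"
      by (rule fundamental_theorem_of_calculus[OF s(2)])
        (auto intro!: derivative_eq_intros simp: has_real_derivative_iff_has_vector_derivative[symmetric])
    have Im: "((\<lambda>x. Im (?g x)) has_integral Im I2) {s..1}"
      unfolding I2_def by (intro has_integral_Im integrable_integral integrable_continuous_real cont)
    have "\<bar>Im I2\<bar> \<le> (2 * (S + 800)) * (cosh (1 - s) - cosh (s - s))"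
    proof (rule has_integral_abs_le[OF Im has_integral_mult_right[OF sinh]])
      fix x assume x: "x \<in> {s..1}"
      then have "\<bar>?v x ?a - ?v x 0\<bar> \<le> 800" "\<bar>?v x (-?a) - ?v x 0\<bar> \<le> 800" "\<bar>?v x 0\<bar> \<le> S"
        using s by (auto intro!: Im_h_diff_center S)
      then have "\<bar>?v x ?a + ?v x (-?a)\<bar> \<le> 2 * S + 1600" by linarith
      then have "\<bar>?v x ?a + ?v x (-?a)\<bar> \<le> 2 * (S + 800)" by simp
      then have "\<bar>?v x ?a + ?v x (-?a)\<bar> * \<bar>sinh (x - s)\<bar> \<le> (2 * (S + 800)) * \<bar>sinh (x - s)\<bar>"
        by (intro mult_right_mono) auto
      moreover have "\<bar>sinh (x - s)\<bar> = sinh (x - s)" using x by simp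
      ultimately show "\<bar>Im (?g x)\<bar> \<le> 2 * (S + 800) * sinh (x - s)"
        by (simp add: abs_mult)
    qed
    also have "\<dots> \<le> (2 * (S + 800)) * (7 / 10)"
    proof (rule mult_left_mono)
      have "cosh (1 - s) \<le> cosh 1" using s by (subst cosh_real_nonneg_le_iff) auto
      then show "cosh (1 - s) - cosh (s - s) \<le> 7 / 10" using cosh_1_le by simp
      show "0 \<le> 2 * (S + 800)" using S[of 1] s by simp
    qed
    finally show ?thesis by simp
  qed
  have cos: "(cos has_integral (sin ?a - sin (-?a))) {-?a..?a}"
    by (rule fundamental_theorem_of_calculus)
      (auto intro!: derivative_eq_intros simp: has_real_derivative_iff_has_vector_derivative[symmetric])
  \<comment> \<open>Replacing \<open>Im h\<close> on the left edge by its central value costs at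
    most 800 times the integral of \<open>cos\<close>, which is 2; with the 200 from the right edge
    this makes the 1800.\<close>
  have D: "((\<lambda>y. (?v s y - ?v s 0) * cos y) has_integral (Im I1 - Im I2 - ?v s 0 * 2)) {-?a..?a}"
    using has_integral_diff[OF J has_integral_mult_right[OF cos, of "?v s 0"]] by (simp add: algebra_simps)
  have "\<bar>Im I1 - Im I2 - ?v s 0 * 2\<bar> \<le> 800 * (sin ?a - sin (-?a))"
  proof (rule has_integral_abs_le[OF D has_integral_mult_right[OF cos]])
    fix y assume y: "y \<in> {-?a..?a}"
    then have "\<bar>?v s y - ?v s 0\<bar> * \<bar>cos y\<bar> \<le> 800 * \<bar>cos y\<bar>"
      using s by (intro mult_right_mono Im_h_diff_center) auto
    moreover have "cos y \<ge> 0" using y by (intro cos_ge_zero) auto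
    ultimately show "\<bar>(?v s y - ?v s 0) * cos y\<bar> \<le> 800 * cos y"
      by (simp add: abs_mult)
  qed
  then have "2 * \<bar>?v s 0\<bar> \<le> 1600 + \<bar>Im I1\<bar> + \<bar>Im I2\<bar>" by simp
  also have "\<dots> \<le> 1600 + 200 + 14/10 * (S + 800)" by (intro add_mono I1 I2 order_refl)
  finally show ?thesis by simp
qed

text \<open>At a maximum point on \<open>[s, 1]\<close> the previous lemma bounds twice the maximum
  by 14/10 of the maximum plus a constant. The maximum exists because \<open>s > 0\<close> keeps the
  segment away from the boundary, but its bound does not involve \<open>s\<close>.\<close>

lemma Im_h_center_le:
  assumes s: "0 < s" "s \<le> 1"
  shows "\<bar>Im (h (Complex s 0))\<bar> \<le> 5000"
proof -
  let ?m = "\<lambda>x. \<bar>Im (h (Complex x 0))\<bar>"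
  have "continuous_on {s..1} ?m"
    by (intro continuous_intros continuous_on_holomorphic_Complex[OF holomorphic_h]) (use s in auto)
  then obtain x where x: "x \<in> {s..1}" "\<And>y. y \<in> {s..1} \<Longrightarrow> ?m y \<le> ?m x"
    using continuous_attains_sup[of "{s..1}" ?m] s by auto
  have "2 * ?m x \<le> 1800 + 14/10 * (?m x + 800)"
    using x s by (intro Im_h_center_absorb) auto
  then have "?m x \<le> 5000" by (simp add: field_simps)
  then show ?thesis using x(2)[of s] s by auto
qed

lemma Im_h_le:
  assumes s: "0 < s" "s \<le> 1" and y: "\<bar>y\<bar> \<le> 1"
  shows "\<bar>Im (h (Complex s y))\<bar> \<le> 6000"
proof -
  have "\<bar>y\<bar> \<le> pi / 2" using y pi_ge_two by linarith
  then show ?thesis using Im_h_center_le[OF s] Im_h_diff_center[OF s, of y] by linarith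
qed

lemma norm_h_near:
  assumes s: "1/2 \<le> s" "s \<le> 3/2" and y: "\<bar>y\<bar> \<le> 1"
  shows "norm (h (Complex s y)) \<le> 9 * (\<bar>s - 1\<bar> + \<bar>y\<bar>)"
proof -
  have "norm (h (Complex s y)) \<le> 9 * norm (Complex s y - 1)"
  proof (rule norm_h_le)
    fix w assume w: "w \<in> closed_segment 1 (Complex s y)"
    have "closed_segment 1 (Complex s y) \<subseteq> cbox (Complex (1/2) (-1)) (Complex (3/2) 1)"
      using s y by (intro closed_segment_subset convex_box) (auto simp: in_cbox_complex_iff)
    with w have w: "1/2 \<le> Re w" "Re w \<le> 3/2" "\<bar>Im w\<bar> \<le> 1"
      by (auto simp: in_cbox_complex_iff abs_le_iff)
    then have "(Re w)\<^sup>2 \<le> (3/2)\<^sup>2" "\<bar>Im w\<bar>\<^sup>2 \<le> 1\<^sup>2" by (intro power_mono; simp)+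
    then show "(norm w)\<^sup>2 + 1 \<le> 9 * Re w"
      unfolding cmod_power2 using w by (simp add: power2_eq_square)
  qed (use s in auto)
  also have "\<dots> \<le> 9 * (\<bar>s - 1\<bar> + \<bar>y\<bar>)"
    using cmod_le[of "Complex s y - 1"] by simp
  finally show ?thesis .
qed

text \<open>In this rectangle \<open>positive_real_part_lower\<close> gives
  \<open>Re q \<ge> 1/9\<close>, since (1/2) / (9/4 + 1 + 1) exceeds 1/9.\<close>

lemma Im_h_growth:
  assumes s: "1/2 \<le> s" "s \<le> 3/2" and ab: "-1 \<le> a" "a \<le> b" "b \<le> 1"
  shows "(b - a) / 9 \<le> Im (h (Complex s b)) - Im (h (Complex s a))"
proof -
  have "((\<lambda>y. 1/9 :: real) has_integral (b - a) *\<^sub>R (1/9)) {a..b}"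
    using has_integral_const_real[of "1/9::real" a b] ab by simp
  then have "(b - a) *\<^sub>R (1/9) \<le> Im (h (Complex s b)) - Im (h (Complex s a))"
  proof (rule has_integral_le[OF _ has_integral_Im_h])
    fix y assume "y \<in> {a..b}"
    then have y: "\<bar>y\<bar> \<le> 1" using ab by auto
    have s2: "s\<^sup>2 \<le> (3/2)\<^sup>2" using s by (intro power_mono) auto
    have "(norm (Complex s y))\<^sup>2 \<le> (3/2)\<^sup>2 + 1\<^sup>2"
      unfolding cmod_power2 using s2 y abs_square_le_1[of y] by simp
    then have "1/9 \<le> s / ((norm (Complex s y))\<^sup>2 + 1)"
      using s by (simp add: field_simps add_pos_nonneg power2_eq_square)
    also have "\<dots> \<le> Re (q (Complex s y))"
      using positive_real_part_lower[OF hol pos q1, of "Complex s y"] s by simp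
    finally show "1/9 \<le> Re (q (Complex s y))" .
  qed (use s ab in auto)
  then show ?thesis by simp
qed

text \<open>\<open>lev\<close> is the shape that a level set takes after \<open>normalize\<close>,
  with \<open>B\<close> its ratio \<open>Im q / Re q\<close> at the base point. For
  \<open>s \<le> 1/2\<close> the global bound gives |B| / 2 \<le> 6000; nearer to the vertex the
  linear bound on \<open>h\<close> gives |B| \<le> 18. Hence the threshold 12000 in
  \<open>steep\<close>.\<close>

lemma steep_bound:
  assumes lev: "Im (h (Complex s y)) = B * (1 - s)" and "0 < s" "s \<le> 1" "\<bar>y\<bar> \<le> 1 - s" "Complex s y \<noteq> 1"
  shows "\<bar>B\<bar> \<le> 12000"
proof -
  have s1: "s < 1" using assms by (auto simp: complex_eq_iff)
  show ?thesis
  proof (cases "s \<le> 1/2")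
    case True
    have "\<bar>B * (1 - s)\<bar> \<le> 6000" using Im_h_le[of s y] assms by simp
    moreover have "\<bar>B\<bar> * (1/2) \<le> \<bar>B\<bar> * (1 - s)" using True by (intro mult_left_mono) auto
    ultimately show ?thesis using s1 by (simp add: abs_mult)
  next
    case False
    have "\<bar>B * (1 - s)\<bar> \<le> norm (h (Complex s y))" using abs_Im_le_cmod lev by metis
    also have "\<dots> \<le> 9 * (\<bar>s - 1\<bar> + \<bar>y\<bar>)" using False assms by (intro norm_h_near) auto
    also have "\<dots> \<le> 18 * (1 - s)" using assms by simp
    finally have "\<bar>B\<bar> * (1 - s) \<le> 18 * (1 - s)" using s1 by (simp add: abs_mult)
    then have "\<bar>B\<bar> \<le> 18" using s1 by (intro mult_right_le_imp_le[of "\<bar>B\<bar>" "1 - s" 18]) auto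
    then show ?thesis by simp
  qed
qed

text \<open>With \<open>B\<close> bounded, \<open>Im h\<close> is of order |s - 1| at this point,
  while near 1 it increases in \<open>y\<close> at a rate of at least 1/9; so \<open>y\<close> is of
  order |s - 1| too.\<close>

lemma flat_bound:
  assumes lev: "Im (h (Complex s y)) = B * (1 - s)" and s: "\<bar>s - 1\<bar> \<le> 1/200000" and B: "\<bar>B\<bar> \<le> 12000"
  shows "\<bar>y\<bar> \<le> 110000 * \<bar>s - 1\<bar>"
proof -
  \<comment> \<open>\<open>y\<close> is clamped to the range where \<open>Im_h_growth\<close>
    applies. Monotonicity of \<open>Im h\<close> lets \<open>y'\<close> replace \<open>y\<close> in
    the estimate, and the smallness of |s - 1| shows at the end that nothing was clamped.\<close>
  define y' where "y' = max (-1) (min 1 y)"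
  have s': "1/2 \<le> s" "s \<le> 3/2" using s unfolding abs_le_iff by linarith+
  have "\<bar>Im (h (Complex s 0))\<bar> \<le> 9 * \<bar>s - 1\<bar>"
    using norm_h_near[of s 0] s' abs_Im_le_cmod[of "h (Complex s 0)"] by simp
  moreover have "\<bar>B * (1 - s)\<bar> \<le> 12000 * \<bar>s - 1\<bar>"
    unfolding abs_mult abs_minus_commute[of 1 s] using B by (intro mult_right_mono) auto
  moreover have "\<bar>y'\<bar> / 9 \<le> \<bar>Im (h (Complex s y)) - Im (h (Complex s 0))\<bar>"
  proof (cases "0 \<le> y")
    case True
    then have "y' / 9 \<le> Im (h (Complex s y')) - Im (h (Complex s 0))"
      using Im_h_growth[OF s', of 0 y'] by (simp add: y'_def)
    moreover have "Im (h (Complex s y')) \<le> Im (h (Complex s y))"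
      using s' True by (intro Im_h_mono) (auto simp: y'_def)
    ultimately show ?thesis using True by (simp add: y'_def)
  next
    case False
    then have "- y' / 9 \<le> Im (h (Complex s 0)) - Im (h (Complex s y'))"
      using Im_h_growth[OF s', of y' 0] by (simp add: y'_def)
    moreover have "Im (h (Complex s y)) \<le> Im (h (Complex s y'))"
      using s' False by (intro Im_h_mono) (auto simp: y'_def)
    ultimately show ?thesis using False by (simp add: y'_def)
  qed
  \<comment> \<open>12009 is 12000 + 9. The constants 110000 and 200000 are round numbers above 9 *
    12009.\<close>
  ultimately have *: "\<bar>y'\<bar> \<le> 9 * (12009 * \<bar>s - 1\<bar>)" using lev by linarith
  have "200000 * \<bar>s - 1\<bar> \<le> 1" using s by simp
  with * have "\<bar>y'\<bar> < 1" by linarith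
  then have "y' = y" by (auto simp: y'_def max_def min_def split: if_splits)
  with * show ?thesis by simp
qed

end

section \<open>Rescaling: steep and flat points of a level set\<close>

context half_plane_primitive
begin

text \<open>The numerical constants here and below come from crude estimates and have no significance.\<close>

definition steep :: "complex \<Rightarrow> bool"
  where "steep p \<longleftrightarrow> \<bar>Im (q p)\<bar> > 12000 * Re (q p)"

text \<open>An affine map takes 1 to \<open>p\<close>. Subtracting an imaginary constant from
  \<open>q\<close> preserves the positive real part and makes the value at 1 real, so that it can be
  scaled to 1. The price is a linear term in \<open>h'\<close>, which turns the level set through
  \<open>p\<close> into the line-like condition of \<open>steep_bound\<close> and
  \<open>flat_bound\<close>.\<close>

lemma normalize:
  fixes p :: complex
  assumes p: "p \<in> \<H>"
  defines "B \<equiv> Im (q p) / Re (q p)"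
  obtains q' h' where "normalized_half_plane_primitive q' h'"
    "\<And>p'. p' \<in> \<H> \<Longrightarrow> Im (h p') = Im (h p) \<Longrightarrow>
      Im (h' (Complex (Re p' / Re p) ((Im p' - Im p) / Re p))) = B * (1 - Re p' / Re p)"
proof -
  define x u where "x = Re p" and "u = Re (q p)"
  have x: "x > 0" and u: "u > 0" using p pos by (auto simp: x_def u_def)
  define A where "A z = of_real x * z + \<i> * of_real (Im p)" for z
  have A_in: "A z \<in> \<H>" if "z \<in> \<H>" for z using that x by (simp add: A_def)
  have A1: "A 1 = p" by (simp add: A_def x_def complex_eq_iff)
  define q' where "q' z = (q (A z) - \<i> * of_real (Im (q p))) / of_real u" for z
  define h' where "h' z = (h (A z) - h p) / of_real (x * u) - \<i> * of_real B * (z - 1)" for z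
  have B: "Im (q p) = B * u" using u by (simp add: B_def u_def)
  have "normalized_half_plane_primitive q' h'"
  proof
    have "A holomorphic_on \<H>" unfolding A_def by (intro holomorphic_intros)
    then have "(q \<circ> A) holomorphic_on \<H>"
      using A_in by (intro holomorphic_on_compose_gen[OF _ hol]) auto
    then show "q' holomorphic_on \<H>"
      unfolding q'_def o_def using u by (intro holomorphic_intros) auto
    show "Re (q' z) > 0" if "z \<in> \<H>" for z
      using pos[OF A_in[OF that]] u by (simp add: q'_def)
    show "q' 1 = 1" using u by (simp add: q'_def A1 complex_eq_iff u_def)
    show "h' 1 = 0" by (simp add: h'_def A1)
    show "(h' has_field_derivative q' z) (at z)" if "z \<in> \<H>" for z
    proof -
      have "(A has_field_derivative of_real x) (at z)"
        unfolding A_def by (auto intro!: derivative_eq_intros)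
      from DERIV_chain2[OF prim[OF A_in[OF that]] this]
      have "((\<lambda>z. h (A z)) has_field_derivative q (A z) * of_real x) (at z)" .
      then have "(h' has_field_derivative (q (A z) * of_real x) / of_real (x * u) - \<i> * of_real B) (at z)"
        unfolding h'_def using x u by (auto intro!: derivative_eq_intros)
      also have "(q (A z) * of_real x) / of_real (x * u) - \<i> * of_real B = q' z"
        using x u by (simp add: q'_def B field_simps)
      finally show ?thesis .
    qed
  qed
  moreover have "Im (h' (Complex (Re p' / Re p) ((Im p' - Im p) / Re p))) = B * (1 - Re p' / Re p)"
    if "p' \<in> \<H>" "Im (h p') = Im (h p)" for p'
  proof -
    have "A (Complex (Re p' / Re p) ((Im p' - Im p) / Re p)) = p'"
      using x by (simp add: A_def complex_eq_iff x_def)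
    then have "Im (h' (Complex (Re p' / Re p) ((Im p' - Im p) / Re p))) =
        Im (h p' - h p) / (x * u) - B * (Re p' / Re p - 1)"
      by (simp add: h'_def Im_divide_of_real del: of_real_mult)
    then show ?thesis using that by (simp add: algebra_simps)
  qed
  ultimately show thesis by (rule that)
qed

text \<open>A point violating the conclusion would lie, after \<open>normalize\<close>, in the cone
  of \<open>steep_bound\<close>, contradicting the steepness of \<open>p\<close>.\<close>

lemma steep_level_set_aux:
  assumes "p \<in> \<H>" "p' \<in> \<H>" "Im (h p') = Im (h p)" "steep p" "Re p' \<le> Re p"
  shows "\<bar>Re p' - Re p\<bar> \<le> \<bar>Im p' - Im p\<bar>"
proof (rule ccontr)
  assume neg: "\<not> ?thesis"
  obtain q' h' where "normalized_half_plane_primitive q' h'"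
    and lev: "Im (h' (Complex (Re p' / Re p) ((Im p' - Im p) / Re p))) =
      Im (q p) / Re (q p) * (1 - Re p' / Re p)"
    using normalize[OF assms(1)] assms(2,3) by metis
  interpret N: normalized_half_plane_primitive q' h' by fact
  have x: "Re p > 0" and u: "Re (q p) > 0" using assms(1) pos by auto
  have "\<bar>Im (q p) / Re (q p)\<bar> \<le> 12000"
  proof (rule N.steep_bound[OF lev])
    show "\<bar>(Im p' - Im p) / Re p\<bar> \<le> 1 - Re p' / Re p"
      using neg x assms(5) by (simp add: field_simps)
    show "Complex (Re p' / Re p) ((Im p' - Im p) / Re p) \<noteq> 1"
      using neg x by (auto simp: complex_eq_iff)
  qed (use x assms in auto)
  then show False using assms(4) u by (simp add: steep_def field_simps)
qed

text \<open>The cone opens towards the boundary, so the estimate has to be used at whichever point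
  has the larger real part; assuming both points steep makes it symmetric.\<close>

lemma steep_level_set:
  assumes "p \<in> \<H>" "p' \<in> \<H>" "Im (h p') = Im (h p)" "steep p" "steep p'"
  shows "\<bar>Re p' - Re p\<bar> \<le> \<bar>Im p' - Im p\<bar>"
  using steep_level_set_aux[of p p'] steep_level_set_aux[of p' p] assms
  by (cases "Re p' \<le> Re p") (auto simp: abs_minus_commute)

lemma flat_level_set:
  assumes "p \<in> \<H>" "p' \<in> \<H>" "Im (h p') = Im (h p)" "\<not> steep p"
    and close: "\<bar>Re p' - Re p\<bar> \<le> Re p / 200000"
  shows "\<bar>Im p' - Im p\<bar> \<le> 110000 * \<bar>Re p' - Re p\<bar>"
proof -
  obtain q' h' where "normalized_half_plane_primitive q' h'"
    and lev: "Im (h' (Complex (Re p' / Re p) ((Im p' - Im p) / Re p))) =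
      Im (q p) / Re (q p) * (1 - Re p' / Re p)"
    using normalize[OF assms(1)] assms(2,3) by metis
  interpret N: normalized_half_plane_primitive q' h' by fact
  have x: "Re p > 0" and u: "Re (q p) > 0" using assms(1) pos by auto
  have eq: "\<bar>Re p' / Re p - 1\<bar> = \<bar>Re p' - Re p\<bar> / Re p"
    using x by (simp add: diff_divide_distrib[symmetric] abs_divide divide_simps)
  have "\<bar>(Im p' - Im p) / Re p\<bar> \<le> 110000 * \<bar>Re p' / Re p - 1\<bar>"
    using lev
  proof (rule N.flat_bound)
    show "\<bar>Re p' / Re p - 1\<bar> \<le> 1 / 200000"
      unfolding eq using close x by (simp add: field_simps)
    show "\<bar>Im (q p) / Re (q p)\<bar> \<le> 12000"
      using assms(4) u by (simp add: steep_def field_simps)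
  qed
  then show ?thesis unfolding eq using x by (simp add: abs_divide field_simps)
qed

end

section \<open>The generator of a semigroup\<close>

lemma Schwarz_Pick:
  assumes hol: "f holomorphic_on \<D>" and f: "f ` \<D> \<subseteq> \<D>" and z: "z \<in> \<D>" and w: "w \<in> \<D>"
  shows "norm (f w - f z) * norm (1 - cnj z * w) \<le> norm (w - z) * norm (1 - cnj (f z) * f w)"
proof -
  let ?M = "Moebius_function 0"
  have fD: "norm (f x) < 1" if "norm x < 1" for x using f that by force
  have nz: "norm z < 1" and nw: "norm w < 1" using z w by auto
  define g where "g = (\<lambda>x. ?M (f z) (f (?M (- z) x)))"
  have M1: "norm (?M (- z) x) < 1" if "norm x < 1" for x
    using Moebius_function_norm_lt_1[of "- z" x 0] nz that by simp
  have "?M (- z) holomorphic_on \<D>"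
    using nz by (intro Moebius_function_holomorphic) auto
  then have "(f \<circ> ?M (- z)) holomorphic_on \<D>"
    using M1 by (intro holomorphic_on_compose_gen[OF _ hol]) auto
  then have "(?M (f z) \<circ> (f \<circ> ?M (- z))) holomorphic_on \<D>"
    using M1 fD nz by (intro holomorphic_on_compose_gen[OF _ Moebius_function_holomorphic]) auto
  then have 1: "g holomorphic_on \<D>" by (simp add: g_def o_def)
  have 2: "g 0 = 0" by (simp add: g_def Moebius_function_simple)
  have 3: "norm (g x) < 1" if "norm x < 1" for x
    unfolding g_def using that by (intro Moebius_function_norm_lt_1 fD nz M1)
  define u where "u = ?M z w"
  have u: "norm u < 1" unfolding u_def using nz nw by (rule Moebius_function_norm_lt_1)
  have Mu: "?M (- z) u = w"
    unfolding u_def using nz nw by (intro Moebius_function_compose) auto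
  have ne: "1 - cnj a * b \<noteq> 0" if "norm a < 1" "norm b < 1" for a b :: complex
  proof
    assume "1 - cnj a * b = 0"
    then have "norm a * norm b = 1" by (metis complex_mod_cnj norm_mult norm_one right_minus_eq)
    moreover have "norm a * norm b < 1 * 1" using that by (intro mult_strict_mono') auto
    ultimately show False by simp
  qed
  have "norm (g u) \<le> norm u" by (rule Schwarz_Lemma(1)[OF 1 2 3 u])
  then have "norm (f w - f z) / norm (1 - cnj (f z) * f w) \<le> norm (w - z) / norm (1 - cnj z * w)"
    unfolding g_def Mu by (simp add: u_def Moebius_function_simple norm_divide)
  then show ?thesis
    using ne[OF nz nw] ne[OF fD[OF nz] fD[OF nw]] by (simp add: field_simps)
qed

text \<open>The constant is the same for all self-maps of the disk, so it serves every
  \<open>\<phi> t\<close> at once, however large \<open>t\<close> is.\<close>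

lemma Schwarz_Pick_Lipschitz:
  assumes "f holomorphic_on \<D>" "f ` \<D> \<subseteq> \<D>" and z: "z \<in> \<D>" and w: "w \<in> \<D>"
  shows "norm (f w - f z) \<le> 2 / (1 - norm z) * norm (w - z)"
proof -
  have nz: "norm z < 1" and nw: "norm w < 1" using z w by auto
  have "norm (f z) < 1" "norm (f w) < 1" using assms by force+
  then have le2: "norm (1 - cnj (f z) * f w) \<le> 2"
    using norm_triangle_ineq4[of 1 "cnj (f z) * f w"] mult_le_one[of "norm (f z)" "norm (f w)"]
    by (simp add: norm_mult)
  have "norm z * norm w \<le> norm z * 1" using nw by (intro mult_left_mono) auto
  then have "1 - norm z \<le> norm (1 - cnj z * w)"
    using norm_triangle_ineq2[of 1 "cnj z * w"] by (simp add: norm_mult)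
  then have "norm (f w - f z) * (1 - norm z) \<le> norm (f w - f z) * norm (1 - cnj z * w)"
    by (intro mult_left_mono) auto
  also have "\<dots> \<le> norm (w - z) * norm (1 - cnj (f z) * f w)"
    by (rule Schwarz_Pick) fact+
  also have "\<dots> \<le> norm (w - z) * 2" using le2 by (intro mult_left_mono) auto
  finally show ?thesis using nz by (simp add: field_simps)
qed

lemma has_vector_derivative_iff_tendsto:
  "(f has_vector_derivative D) (at x within S) \<longleftrightarrow>
   ((\<lambda>y. (f y - f x) /\<^sub>R (y - x)) \<longlongrightarrow> D) (at x within S)"
proof -
  have "(f has_vector_derivative D) (at x within S) \<longleftrightarrow>
      ((\<lambda>y. (1 / norm (y - x)) *\<^sub>R (f y - (f x + (y - x) *\<^sub>R D))) \<longlongrightarrow> 0) (at x within S)"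
    by (simp add: has_vector_derivative_def has_derivative_within bounded_linear_scaleR_left)
  also have "\<dots> \<longleftrightarrow> ((\<lambda>y. norm ((1 / norm (y - x)) *\<^sub>R (f y - (f x + (y - x) *\<^sub>R D)))) \<longlongrightarrow> 0) (at x within S)"
    by (rule tendsto_norm_zero_iff[symmetric])
  also have "\<dots> \<longleftrightarrow> ((\<lambda>y. norm ((f y - f x) /\<^sub>R (y - x) - D)) \<longlongrightarrow> 0) (at x within S)"
  proof (rule filterlim_cong[OF refl refl])
    show "\<forall>\<^sub>F y in at x within S. norm ((1 / norm (y - x)) *\<^sub>R (f y - (f x + (y - x) *\<^sub>R D))) =
        norm ((f y - f x) /\<^sub>R (y - x) - D)"
    proof (rule eventually_at_filter[THEN iffD2, OF always_eventually], intro allI impI)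
      fix y assume "y \<noteq> x"
      then have "f y - (f x + (y - x) *\<^sub>R D) = (y - x) *\<^sub>R ((f y - f x) /\<^sub>R (y - x) - D)"
        unfolding scaleR_right_diff_distrib by simp
      then show "norm ((1 / norm (y - x)) *\<^sub>R (f y - (f x + (y - x) *\<^sub>R D))) =
          norm ((f y - f x) /\<^sub>R (y - x) - D)"
        using \<open>y \<noteq> x\<close> by simp
    qed
  qed
  also have "\<dots> \<longleftrightarrow> ((\<lambda>y. (f y - f x) /\<^sub>R (y - x)) \<longlongrightarrow> D) (at x within S)"
    unfolding tendsto_norm_zero_iff by (rule Lim_null[symmetric])
  finally show ?thesis .
qed

text \<open>The chain rule read backwards. With the Caratheodory slope \<open>g\<close> of
  \<open>M\<close> at \<open>f t\<close>, the difference quotient of \<open>f\<close> is that of the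
  composition divided by \<open>g (f u)\<close>, which tends to \<open>m\<close> by continuity of
  \<open>f\<close>.\<close>

lemma has_vector_derivative_cancel_outer:
  fixes f :: "real \<Rightarrow> complex"
  assumes comp: "((\<lambda>t. M (f t)) has_vector_derivative d) (at t within S)"
    and M: "(M has_field_derivative m) (at (f t))" and "m \<noteq> 0"
    and cont: "continuous (at t within S) f"
  shows "(f has_vector_derivative d / m) (at t within S)"
proof -
  obtain g where g: "\<And>w. M w - M (f t) = g w * (w - f t)" "isCont g (f t)" "g (f t) = m"
    using M unfolding CARAT_DERIV by blast
  have lim: "((\<lambda>u. g (f u)) \<longlongrightarrow> m) (at t within S)"
    using isCont_tendsto_compose[OF g(2) cont[unfolded continuous_within]] g(3) by simp
  have "((\<lambda>u. ((M (f u) - M (f t)) /\<^sub>R (u - t)) / g (f u)) \<longlongrightarrow> d / m) (at t within S)"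
    using comp lim \<open>m \<noteq> 0\<close> unfolding has_vector_derivative_iff_tendsto by (intro tendsto_divide)
  moreover have "\<forall>\<^sub>F u in at t within S. ((M (f u) - M (f t)) /\<^sub>R (u - t)) / g (f u) = (f u - f t) /\<^sub>R (u - t)"
    using tendsto_imp_eventually_ne[OF lim \<open>m \<noteq> 0\<close>]
    by eventually_elim (simp add: g(1) field_simps)
  ultimately show ?thesis
    unfolding has_vector_derivative_iff_tendsto by (rule Lim_transform_eventually)
qed

section \<open>Smoothing in time and differentiability of the semigroup\<close>

locale disk_semigroup =
  fixes \<phi> :: "real \<Rightarrow> complex \<Rightarrow> complex"
  assumes semigroup: "holomorphic_semigroup \<phi>"
begin

lemma holomorphic: "0 \<le> t \<Longrightarrow> \<phi> t holomorphic_on \<D>"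
  and maps: "0 \<le> t \<Longrightarrow> \<phi> t ` \<D> \<subseteq> \<D>"
  and zero: "z \<in> \<D> \<Longrightarrow> \<phi> 0 z = z"
  and add: "0 \<le> t \<Longrightarrow> 0 \<le> s \<Longrightarrow> z \<in> \<D> \<Longrightarrow> \<phi> (t + s) z = \<phi> t (\<phi> s z)"
  and unif: "compact K \<Longrightarrow> K \<subseteq> \<D> \<Longrightarrow> uniform_limit K \<phi> (\<phi> 0) (at_right 0)"
  using semigroup unfolding holomorphic_semigroup_def by blast+

lemma in_disk: "0 \<le> t \<Longrightarrow> z \<in> \<D> \<Longrightarrow> \<phi> t z \<in> \<D>"
  using maps by blast

lemma uniformly_near_identity:
  assumes K: "compact K" "K \<subseteq> \<D>" and "\<epsilon> > 0"
  obtains \<delta> where "\<delta> > 0" "\<And>s z. 0 \<le> s \<Longrightarrow> s < \<delta> \<Longrightarrow> z \<in> K \<Longrightarrow> norm (\<phi> s z - z) < \<epsilon>"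
proof -
  have "\<forall>\<^sub>F s in at_right 0. \<forall>z\<in>K. dist (\<phi> s z) (\<phi> 0 z) < \<epsilon>"
    using unif[OF K] \<open>\<epsilon> > 0\<close> by (auto simp: uniform_limit_iff)
  then obtain \<delta> where \<delta>: "\<delta> > 0" "\<And>s. 0 < s \<Longrightarrow> s < \<delta> \<Longrightarrow> \<forall>z\<in>K. dist (\<phi> s z) (\<phi> 0 z) < \<epsilon>"
    unfolding eventually_at_right_field by blast
  have "norm (\<phi> s z - z) < \<epsilon>" if "0 \<le> s" "s < \<delta>" "z \<in> K" for s z
  proof -
    have "\<phi> 0 z = z" using that(3) K(2) by (intro zero) blast
    then show ?thesis
      using \<delta>(2)[of s] that \<open>\<epsilon> > 0\<close> by (cases "s = 0") (auto simp: dist_norm)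
  qed
  with \<delta>(1) show thesis by (rule that)
qed

lemma norm_space_diff_le:
  assumes "0 \<le> t" "z \<in> \<D>" "w \<in> \<D>"
  shows "norm (\<phi> t w - \<phi> t z) \<le> 2 / (1 - norm z) * norm (w - z)"
  using assms by (intro Schwarz_Pick_Lipschitz holomorphic maps)

text \<open>For \<open>t' \<le> t\<close> the semigroup law writes \<open>\<phi> t z\<close> as
  \<open>\<phi> t'\<close> at \<open>\<phi> (t - t') z\<close>, which turns a difference in time
  into one in space.\<close>

lemma norm_time_diff_le:
  assumes "0 \<le> t" "0 \<le> t'" "z \<in> \<D>"
  shows "norm (\<phi> t z - \<phi> t' z) \<le> 2 / (1 - norm z) * norm (\<phi> \<bar>t - t'\<bar> z - z)"
proof -
  have *: "norm (\<phi> t z - \<phi> t' z) \<le> 2 / (1 - norm z) * norm (\<phi> (t - t') z - z)"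
    if "0 \<le> t'" "t' \<le> t" for t t'
    using norm_space_diff_le[of t' z "\<phi> (t - t') z"] add[of t' "t - t'" z] in_disk[of "t - t'" z] that assms(3)
    by simp
  show ?thesis
    using *[of t' t] *[of t t'] assms(1,2) by (cases "t' \<le> t") (auto simp: norm_minus_commute)
qed

lemma continuous_on_time:
  assumes z: "z \<in> \<D>"
  shows "continuous_on {0..} (\<lambda>t. \<phi> t z)"
proof (rule continuous_onI)
  fix t \<epsilon> :: real assume t: "t \<in> {0..}" and "\<epsilon> > 0"
  define c where "c = 2 / (1 - norm z)"
  have c: "c > 0" using z by (simp add: c_def)
  obtain \<delta> where \<delta>: "\<delta> > 0" "\<And>s w. 0 \<le> s \<Longrightarrow> s < \<delta> \<Longrightarrow> w \<in> {z} \<Longrightarrow> norm (\<phi> s w - w) < \<epsilon> / c"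
    using uniformly_near_identity[of "{z}" "\<epsilon> / c"] z c \<open>\<epsilon> > 0\<close> by auto
  have "dist (\<phi> t' z) (\<phi> t z) \<le> \<epsilon>" if "t' \<in> {0..}" "dist t' t < \<delta>" for t'
  proof -
    have "norm (\<phi> t' z - \<phi> t z) \<le> c * norm (\<phi> \<bar>t' - t\<bar> z - z)"
      unfolding c_def using t that z by (intro norm_time_diff_le) auto
    also have "\<dots> \<le> c * (\<epsilon> / c)"
      using c that by (intro mult_left_mono less_imp_le[OF \<delta>(2)]) (auto simp: dist_real_def)
    finally show ?thesis using c by (simp add: dist_norm)
  qed
  then show "\<exists>d>0. \<forall>x'\<in>{0..}. dist x' t < d \<longrightarrow> dist (\<phi> x' z) (\<phi> t z) \<le> \<epsilon>"
    using \<delta>(1) by blast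
qed

text \<open>Cauchy's inequality for \<open>\<phi> t\<close> minus a translate of
  \<open>\<phi> t'\<close> that brings \<open>z'\<close> to \<open>z\<close>. The radius, a third of
  the distance to the circle, keeps the translated disk inside \<open>\<D>\<close>.\<close>

lemma norm_deriv_diff_le:
  assumes z: "z \<in> \<D>" and r: "r = (1 - norm z) / 3" and z': "norm (z' - z) < r" and t: "0 \<le> t" "0 \<le> t'"
    and e: "\<And>w. w \<in> cball z r \<Longrightarrow> norm (\<phi> \<bar>t - t'\<bar> w - w) \<le> e"
  shows "norm (deriv (\<phi> t) z - deriv (\<phi> t') z') \<le> (e + norm (z' - z)) / r\<^sup>2"
proof -
  have r0: "r > 0" and zr: "norm z = 1 - 3 * r" using z r by auto
  define g where "g w = \<phi> t w - \<phi> t' (w + (z' - z))" for w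
  have in1: "norm w \<le> 1 - 2 * r" if "w \<in> cball z r" for w
    using that norm_triangle_ineq[of z "w - z"] zr by (simp add: dist_norm norm_minus_commute)
  have in2: "w + (z' - z) \<in> \<D>" if "w \<in> cball z r" for w
    using in1[OF that] norm_triangle_ineq[of w "z' - z"] z' r0 by simp
  have inD: "w \<in> \<D>" if "w \<in> cball z r" for w using in1[OF that] r0 by simp
  have "((\<lambda>w. \<phi> t' (w + (z' - z)))) holomorphic_on cball z r"
    by (rule holomorphic_on_compose_gen[OF _ holomorphic[OF t(2)], unfolded o_def])
      (use in2 in \<open>auto intro!: holomorphic_intros\<close>)
  then have hol: "g holomorphic_on cball z r"
    unfolding g_def using inD by (intro holomorphic_intros holomorphic_on_subset[OF holomorphic[OF t(1)]]) auto
  have bound: "norm (g w) \<le> (e + norm (z' - z)) / r" if w: "w \<in> cball z r" for w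
  proof -
    have c: "2 / (1 - norm w) \<le> 1 / r"
      using in1[OF w] r0 by (simp add: field_simps)
    have e0: "0 \<le> e" using e[OF w] norm_ge_zero order_trans by blast
    have "norm (g w) \<le> norm (\<phi> t w - \<phi> t' w) + norm (\<phi> t' (w + (z' - z)) - \<phi> t' w)"
      unfolding g_def by (metis dist_norm dist_triangle2)
    also have "\<dots> \<le> 1 / r * e + 1 / r * norm (z' - z)"
    proof (rule add_mono)
      have "norm (\<phi> t w - \<phi> t' w) \<le> 2 / (1 - norm w) * norm (\<phi> \<bar>t - t'\<bar> w - w)"
        using t inD[OF w] by (intro norm_time_diff_le)
      also have "\<dots> \<le> 1 / r * e" using c e[OF w] r0 by (intro mult_mono) auto
      finally show "norm (\<phi> t w - \<phi> t' w) \<le> 1 / r * e" .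
      have "norm (\<phi> t' (w + (z' - z)) - \<phi> t' w) \<le> 2 / (1 - norm w) * norm (w + (z' - z) - w)"
        using t inD[OF w] in2[OF w] by (intro norm_space_diff_le)
      also have "\<dots> \<le> 1 / r * norm (z' - z)" using c r0 by (intro mult_mono) auto
      finally show "norm (\<phi> t' (w + (z' - z)) - \<phi> t' w) \<le> 1 / r * norm (z' - z)" .
    qed
    finally show ?thesis by (simp add: add_divide_distrib)
  qed
  have "norm ((deriv ^^ 1) g z) \<le> fact 1 * ((e + norm (z' - z)) / r) / r ^ 1"
    by (rule Cauchy_inequality)
      (use hol r0 bound in \<open>auto intro: holomorphic_on_subset holomorphic_on_imp_continuous_on simp: dist_norm\<close>)
  moreover have "deriv g z = deriv (\<phi> t) z - deriv (\<phi> t') z'"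
  proof -
    have z'D: "z' \<in> \<D>" using in2[of z] r0 by simp
    have "((\<lambda>w. w + (z' - z)) has_field_derivative 1) (at z)"
      by (auto intro!: derivative_eq_intros)
    moreover have "(\<phi> t' has_field_derivative deriv (\<phi> t') z') (at (z + (z' - z)))"
      using holomorphic_derivI[OF holomorphic[OF t(2)] open_ball z'D] by simp
    ultimately have "((\<lambda>w. \<phi> t' (w + (z' - z))) has_field_derivative deriv (\<phi> t') z' * 1) (at z)"
      by (rule DERIV_chain2[rotated])
    then have "(g has_field_derivative deriv (\<phi> t) z - deriv (\<phi> t') z') (at z)"
      unfolding g_def using holomorphic_derivI[OF holomorphic[OF t(1)] open_ball z]
      by (auto intro!: derivative_eq_intros)
    then show ?thesis by (rule DERIV_imp_deriv)
  qed
  ultimately show ?thesis using r0 by (simp add: power2_eq_square)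
qed

text \<open>The joint continuity under which the Leibniz rule makes \<open>time_integral\<close>
  holomorphic.\<close>

lemma continuous_on_deriv: "continuous_on (\<D> \<times> {0..s}) (\<lambda>(z, t). deriv (\<phi> t) z)"
  unfolding continuous_on_iff
proof (intro ballI allI impI)
  fix p :: "complex \<times> real" and \<epsilon> :: real
  assume p: "p \<in> \<D> \<times> {0..s}" and "\<epsilon> > 0"
  obtain z t where zt: "p = (z, t)" "z \<in> \<D>" "0 \<le> t" using p by (cases p) auto
  define r where "r = (1 - norm z) / 3"
  have r0: "r > 0" using zt by (simp add: r_def)
  have "cball z r \<subseteq> \<D>"
  proof
    fix w assume "w \<in> cball z r"
    then show "w \<in> \<D>" using norm_triangle_ineq[of z "w - z"] r0
      by (simp add: dist_norm norm_minus_commute r_def field_simps)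
  qed
  then obtain \<delta> where \<delta>: "\<delta> > 0"
    "\<And>s w. 0 \<le> s \<Longrightarrow> s < \<delta> \<Longrightarrow> w \<in> cball z r \<Longrightarrow> norm (\<phi> s w - w) < \<epsilon> * r\<^sup>2 / 2"
    using uniformly_near_identity[of "cball z r" "\<epsilon> * r\<^sup>2 / 2"] \<open>\<epsilon> > 0\<close> r0 by auto
  define d where "d = min \<delta> (min r (\<epsilon> * r\<^sup>2 / 2))"
  have "d > 0" using \<delta> r0 \<open>\<epsilon> > 0\<close> by (simp add: d_def)
  moreover have "dist (deriv (\<phi> t') z') (deriv (\<phi> t) z) < \<epsilon>"
    if "z' \<in> \<D>" "t' \<in> {0..s}" "dist (z', t') (z, t) < d" for z' t'
  proof -
    have dz: "norm (z' - z) < d" and dt: "\<bar>t - t'\<bar> < d"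
      using that(3) dist_fst_le[of "(z', t')" "(z, t)"] dist_snd_le[of "(z', t')" "(z, t)"]
      by (auto simp: dist_norm abs_minus_commute)
    have "norm (deriv (\<phi> t) z - deriv (\<phi> t') z') \<le> (\<epsilon> * r\<^sup>2 / 2 + norm (z' - z)) / r\<^sup>2"
      using dz dt that zt by (intro norm_deriv_diff_le r_def less_imp_le[OF \<delta>(2)]) (auto simp: d_def)
    also have "\<dots> < (\<epsilon> * r\<^sup>2 / 2 + \<epsilon> * r\<^sup>2 / 2) / r\<^sup>2"
      using dz r0 by (intro divide_strict_right_mono) (auto simp: d_def)
    also have "\<dots> = \<epsilon>" using r0 by simp
    finally show ?thesis by (simp add: dist_norm norm_minus_commute)
  qed
  ultimately show "\<exists>d>0. \<forall>p'\<in>\<D> \<times> {0..s}. dist p' p < d \<longrightarrow>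
      dist (case p' of (z, t) \<Rightarrow> deriv (\<phi> t) z) (case p of (z, t) \<Rightarrow> deriv (\<phi> t) z) < \<epsilon>"
    unfolding zt(1) by force
qed

text \<open>A smoothing device: after composition with it \<open>t \<mapsto> \<phi> t z\<close> is
  differentiable, and where its derivative is nonzero it can be stripped off again by
  \<open>has_vector_derivative_cancel_outer\<close>.\<close>

definition time_integral :: "real \<Rightarrow> complex \<Rightarrow> complex"
  where "time_integral s z = integral {0..s} (\<lambda>u. \<phi> u z)"

lemma time_integrable: "z \<in> \<D> \<Longrightarrow> 0 \<le> a \<Longrightarrow> (\<lambda>u. \<phi> u z) integrable_on {a..b}"
  by (intro integrable_continuous_real continuous_on_subset[OF continuous_on_time]) auto

lemma holomorphic_time_integral: "time_integral s holomorphic_on \<D>"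
  unfolding time_integral_def[abs_def] cbox_interval[symmetric]
proof (rule leibniz_rule_holomorphic[where fx = "\<lambda>z t. deriv (\<phi> t) z"])
  show "((\<lambda>z. \<phi> t z) has_field_derivative deriv (\<phi> t) z) (at z within \<D>)"
    if "z \<in> \<D>" "t \<in> cbox 0 s" for z t
    using holomorphic_derivI[OF holomorphic open_ball, of t z] that DERIV_subset[OF _ subset_UNIV]
    by auto
  show "(\<lambda>t. \<phi> t z) integrable_on cbox 0 s" if "z \<in> \<D>" for z
    using time_integrable[OF that, of 0 s] by simp
  show "continuous_on (\<D> \<times> cbox 0 s) (\<lambda>(z, t). deriv (\<phi> t) z)"
    using continuous_on_deriv[of s] by simp
qed auto

text \<open>
  \<open>t \<mapsto> \<phi> t z\<close> is differentiable after composition with the time integral, because the result is a difference of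
  two values of an antiderivative.
\<close>

lemma time_integral_has_vector_derivative:
  assumes z: "z \<in> \<D>" and s: "0 \<le> s" and t: "t \<in> {0..T}"
  shows "((\<lambda>\<tau>. time_integral s (\<phi> \<tau> z)) has_vector_derivative (\<phi> s (\<phi> t z) - \<phi> t z)) (at t within {0..T})"
proof -
  let ?I = "\<lambda>\<tau>. time_integral \<tau> z"
  have D: "(?I has_vector_derivative \<phi> u z) (at u within {0..b})" if "u \<in> {0..b}" for u b
    unfolding time_integral_def
    by (rule integral_has_vector_derivative)
      (use that z in \<open>auto intro: continuous_on_subset[OF continuous_on_time]\<close>)
  have eq: "time_integral s (\<phi> \<tau> z) = ?I (\<tau> + s) - ?I \<tau>" if "0 \<le> \<tau>" for \<tau>
  proof -
    have "time_integral s (\<phi> \<tau> z) = integral {0..s} (\<lambda>u. \<phi> (u + \<tau>) z)"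
      unfolding time_integral_def using that z by (intro integral_cong) (auto simp: add)
    also have "\<dots> = integral {\<tau>..\<tau> + s} (\<lambda>u. \<phi> u z)"
      using integral_shift_Icc_real[of 0 s "\<lambda>u. \<phi> u z" \<tau>] by (simp add: o_def add.commute)
    also have "\<dots> = ?I (\<tau> + s) - ?I \<tau>"
      using Henstock_Kurzweil_Integration.integral_combine[of 0 \<tau> "\<tau> + s" "\<lambda>u. \<phi> u z"]
        that s z time_integrable[OF z, of 0]
      by (auto simp: time_integral_def algebra_simps)
    finally show ?thesis .
  qed
  have "((?I \<circ> (\<lambda>\<tau>. \<tau> + s)) has_vector_derivative 1 *\<^sub>R \<phi> (t + s) z) (at t within {0..T})"
  proof (rule vector_diff_chain_within)
    show "((\<lambda>\<tau>. \<tau> + s) has_vector_derivative 1) (at t within {0..T})"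
      by (auto intro!: derivative_eq_intros)
    show "(?I has_vector_derivative \<phi> (t + s) z) (at (t + s) within (\<lambda>\<tau>. \<tau> + s) ` {0..T})"
      by (rule has_vector_derivative_within_subset[OF D[of _ "T + s"]]) (use t s in auto)
  qed
  from has_vector_derivative_diff[OF this D[OF t]]
  have "((\<lambda>\<tau>. ?I (\<tau> + s) - ?I \<tau>) has_vector_derivative \<phi> (t + s) z - \<phi> t z) (at t within {0..T})"
    by (simp add: o_def)
  then have "((\<lambda>\<tau>. time_integral s (\<phi> \<tau> z)) has_vector_derivative \<phi> (t + s) z - \<phi> t z) (at t within {0..T})"
    by (rule has_vector_derivative_transform[OF t, rotated]) (auto simp: eq)
  moreover have "\<phi> (t + s) z = \<phi> s (\<phi> t z)" using add[of s t z] t s z by (simp add: add.commute)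
  ultimately show ?thesis by simp
qed

text \<open>For small \<open>s\<close> the maps \<open>\<phi> u\<close> with
  \<open>u \<le> s\<close> are close to the identity, so \<open>time_integral s\<close> is close to
  \<open>s\<close> times the identity; Cauchy's inequality puts its derivative within
  \<open>s / 2\<close> of \<open>s\<close>. That one \<open>s\<close> serves a whole ball is what
  the holomorphy of \<open>generator\<close> rests on.\<close>

lemma deriv_time_integral_nonzero:
  assumes z0: "z0 \<in> \<D>"
  obtains s r where "s > 0" "r > 0" "ball z0 r \<subseteq> \<D>" "\<And>z. z \<in> ball z0 r \<Longrightarrow> deriv (time_integral s) z \<noteq> 0"
proof -
  define r where "r = (1 - norm z0) / 3"
  have r0: "r > 0" using z0 by (simp add: r_def)
  have sub: "cball z0 (2 * r) \<subseteq> \<D>"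
  proof
    fix w assume "w \<in> cball z0 (2 * r)"
    then show "w \<in> \<D>" using norm_triangle_ineq[of z0 "w - z0"] r0
      by (simp add: dist_norm norm_minus_commute r_def field_simps)
  qed
  obtain \<delta> where \<delta>: "\<delta> > 0"
    "\<And>s w. 0 \<le> s \<Longrightarrow> s < \<delta> \<Longrightarrow> w \<in> cball z0 (2 * r) \<Longrightarrow> norm (\<phi> s w - w) < r / 2"
    using uniformly_near_identity[OF compact_cball sub, of "r / 2"] r0 by auto
  define s where "s = \<delta> / 2"
  have s: "s > 0" "s < \<delta>" using \<delta> by (auto simp: s_def)
  have "deriv (time_integral s) z \<noteq> 0" if z: "z \<in> ball z0 r" for z
  proof
    assume zero: "deriv (time_integral s) z = 0"
    have cb: "cball z r \<subseteq> cball z0 (2 * r)"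
      using z by (intro cball_subset_cball_iff[THEN iffD2]) (auto simp: dist_commute)
    define g where "g w = time_integral s w - of_real s * w" for w
    have hol: "g holomorphic_on \<D>"
      unfolding g_def by (intro holomorphic_intros holomorphic_time_integral)
    have bound: "norm (g w) \<le> r / 2 * s" if "w \<in> cball z r" for w
    proof -
      have w: "w \<in> cball z0 (2 * r)" "w \<in> \<D>" by (rule subsetD[OF cb that], rule subsetD[OF sub subsetD[OF cb that]])
      have I: "((\<lambda>u. \<phi> u w - w) has_integral (time_integral s w - s *\<^sub>R w)) {0..s}"
        using has_integral_diff[OF integrable_integral[OF time_integrable[OF w(2), of 0 s]]
            has_integral_const_real[of w 0 s]] s by (simp add: time_integral_def)
      have "norm (time_integral s w - s *\<^sub>R w) \<le> r / 2 * measure lborel {0..s}"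
      proof (rule has_integral_bound_real[OF _ finite.emptyI I])
        fix u assume "u \<in> {0..s} - {}"
        then show "norm (\<phi> u w - w) \<le> r / 2" using s w by (intro less_imp_le[OF \<delta>(2)]) auto
      qed (use r0 in auto)
      then show ?thesis using s by (simp add: g_def scaleR_conv_of_real)
    qed
    have hol': "g holomorphic_on cball z r"
      by (rule holomorphic_on_subset[OF hol order_trans[OF cb sub]])
    have "norm ((deriv ^^ 1) g z) \<le> fact 1 * (r / 2 * s) / r ^ 1"
      by (rule Cauchy_inequality)
        (use hol' r0 bound in \<open>auto intro: holomorphic_on_subset holomorphic_on_imp_continuous_on simp: dist_norm\<close>)
    moreover have "deriv g z = - of_real s"
    proof -
      have "z \<in> \<D>" using cb sub r0 by (meson centre_in_cball less_imp_le subsetD)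
      then have "(time_integral s has_field_derivative 0) (at z)"
        using holomorphic_derivI[OF holomorphic_time_integral open_ball, of z s] zero by simp
      then have "(g has_field_derivative - of_real s) (at z)"
        unfolding g_def by (auto intro!: derivative_eq_intros)
      then show ?thesis by (rule DERIV_imp_deriv)
    qed
    ultimately show False using s r0 by simp
  qed
  moreover have "ball z0 r \<subseteq> \<D>"
    using sub r0 by (auto intro!: order_trans[OF _ sub])
  ultimately show thesis using s(1) r0 that by blast
qed

definition generator :: "complex \<Rightarrow> complex"
  where "generator z = vector_derivative (\<lambda>t. \<phi> t z) (at 0 within {0..1})"

lemma has_vector_derivative_quotient:
  assumes z: "z \<in> \<D>" and s: "0 \<le> s" and t: "t \<in> {0..T}" and nz: "deriv (time_integral s) (\<phi> t z) \<noteq> 0"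
  shows "((\<lambda>t. \<phi> t z) has_vector_derivative (\<phi> s (\<phi> t z) - \<phi> t z) / deriv (time_integral s) (\<phi> t z))
    (at t within {0..T})"
proof (rule has_vector_derivative_cancel_outer[where M = "time_integral s" and f = "\<lambda>t. \<phi> t z",
      OF time_integral_has_vector_derivative[OF z s t] _ nz])
  show "(time_integral s has_field_derivative deriv (time_integral s) (\<phi> t z)) (at (\<phi> t z))"
    using t z by (intro holomorphic_derivI[OF holomorphic_time_integral open_ball] in_disk) auto
  show "continuous (at t within {0..T}) (\<lambda>t. \<phi> t z)"
    using t continuous_on_subset[OF continuous_on_time[OF z], of "{0..T}"]
    by (auto simp: continuous_on_eq_continuous_within)
qed

text \<open>The left side does not depend on \<open>s\<close>. Fixing \<open>s\<close> on a ball
  thus exhibits \<open>generator\<close> there as a quotient of holomorphic functions.\<close>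

lemma generator_eq:
  assumes z: "z \<in> \<D>" and s: "0 \<le> s" and nz: "deriv (time_integral s) z \<noteq> 0"
  shows "generator z = (\<phi> s z - z) / deriv (time_integral s) z"
proof -
  have "((\<lambda>t. \<phi> t z) has_vector_derivative (\<phi> s z - z) / deriv (time_integral s) z) (at 0 within cbox 0 1)"
    using has_vector_derivative_quotient[OF z s, of 0 1] nz zero[OF z] by simp
  from vector_derivative_within_cbox[OF _ _ this] show ?thesis by (simp add: generator_def)
qed

lemma flow:
  assumes z: "z \<in> \<D>" and t: "t \<in> {0..T}"
  shows "((\<lambda>t. \<phi> t z) has_vector_derivative generator (\<phi> t z)) (at t within {0..T})"
proof -
  have "\<phi> t z \<in> \<D>" using t z by (intro in_disk) auto
  then obtain s r where "s > 0" "r > 0" "ball (\<phi> t z) r \<subseteq> \<D>"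
      "\<And>w. w \<in> ball (\<phi> t z) r \<Longrightarrow> deriv (time_integral s) w \<noteq> 0"
    using deriv_time_integral_nonzero by blast
  then have s: "0 \<le> s" "deriv (time_integral s) (\<phi> t z) \<noteq> 0" by auto
  show ?thesis
    using has_vector_derivative_quotient[OF z s(1) t s(2)] generator_eq[OF \<open>\<phi> t z \<in> \<D>\<close> s] by simp
qed

lemma holomorphic_generator: "generator holomorphic_on \<D>"
proof (unfold holomorphic_on_def, intro ballI)
  fix z assume "z \<in> \<D>"
  then obtain s r where sr: "s > 0" "r > 0" "ball z r \<subseteq> \<D>"
      "\<And>w. w \<in> ball z r \<Longrightarrow> deriv (time_integral s) w \<noteq> 0"
    using deriv_time_integral_nonzero by blast
  have "(\<lambda>w. (\<phi> s w - w) / deriv (time_integral s) w) holomorphic_on ball z r"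
    using sr by (intro holomorphic_intros holomorphic_on_subset[OF holomorphic]
        holomorphic_deriv holomorphic_on_subset[OF holomorphic_time_integral]) auto
  then have "generator holomorphic_on ball z r"
    by (rule holomorphic_transform) (use sr in \<open>auto intro!: generator_eq[symmetric]\<close>)
  then have "generator field_differentiable at z"
    using sr(2) by (intro holomorphic_on_imp_differentiable_at[of _ "ball z r"]) auto
  then show "generator field_differentiable at z within \<D>"
    by (rule field_differentiable_at_within)
qed

lemma quotient_tendsto_generator:
  assumes z: "z \<in> \<D>" and t: "t \<longlonglongrightarrow> 0" "\<And>n. 0 < t n" "\<And>n. t n \<le> 1"
  shows "(\<lambda>n. (\<phi> (t n) z - z) / of_real (t n)) \<longlonglongrightarrow> generator z"
proof -
  have "((\<lambda>u. (\<phi> u z - z) /\<^sub>R u) \<longlongrightarrow> generator z) (at 0 within {0..1})"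
    using flow[OF z, of 0 1] zero[OF z] by (simp add: has_vector_derivative_iff_tendsto)
  moreover have "filterlim t (at 0 within {0..1}) sequentially"
    using t by (auto simp: filterlim_at less_imp_le intro!: always_eventually) (metis less_irrefl)
  ultimately have "(\<lambda>n. (\<phi> (t n) z - z) /\<^sub>R t n) \<longlonglongrightarrow> generator z"
    by (rule filterlim_compose)
  then show ?thesis by (simp add: scaleR_conv_of_real divide_inverse mult.commute)
qed

end

section \<open>The Berkson-Porta inequality\<close>

lemma norm_add_scaled_square:
  "(norm (A + of_real t * B))\<^sup>2 = (norm A)\<^sup>2 + 2 * t * Re (cnj A * B) + t\<^sup>2 * (norm B)\<^sup>2"
  unfolding cmod_power2 by (simp add: power2_eq_square algebra_simps)

text \<open>A form of Schwarz-Pick, of the type of Julia's lemma, that survives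
  \<open>norm b\<close> tending to 1: after cancellation both sides carry the factor
  \<open>1 - (norm b)^2\<close>, which is divided out.\<close>

lemma Schwarz_Pick_fixed_point:
  assumes "f holomorphic_on \<D>" "f ` \<D> \<subseteq> \<D>" and b: "b \<in> \<D>" "f b = b" and z: "z \<in> \<D>"
  shows "(1 - (norm z)\<^sup>2) * (norm (1 - cnj b * f z))\<^sup>2 \<le> (1 - (norm (f z))\<^sup>2) * (norm (1 - cnj b * z))\<^sup>2"
proof -
  have id: "(norm (w - b))\<^sup>2 = (norm (1 - cnj b * w))\<^sup>2 - (1 - (norm b)\<^sup>2) * (1 - (norm w)\<^sup>2)" for w
    unfolding cmod_power2 by (simp add: power2_eq_square algebra_simps)
  have "norm (f z - b) * norm (1 - cnj b * z) \<le> norm (z - b) * norm (1 - cnj b * f z)"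
    using Schwarz_Pick[OF assms(1,2) b(1) z] b(2) by simp
  then have "(norm (f z - b) * norm (1 - cnj b * z))\<^sup>2 \<le> (norm (z - b) * norm (1 - cnj b * f z))\<^sup>2"
    by (intro power_mono) auto
  then have "(1 - (norm b)\<^sup>2) * ((1 - (norm z)\<^sup>2) * (norm (1 - cnj b * f z))\<^sup>2) \<le>
      (1 - (norm b)\<^sup>2) * ((1 - (norm (f z))\<^sup>2) * (norm (1 - cnj b * z))\<^sup>2)"
    unfolding power_mult_distrib id by (simp add: algebra_simps)
  moreover have "0 < 1 - (norm b)\<^sup>2" using b(1) by (simp add: power_less_one_iff)
  ultimately show ?thesis by (simp only: mult_le_cancel_left_pos)
qed

context disk_semigroup
begin

text \<open>
  The point \<open>a\<close> is a limit of fixed points of the strict contractions \<open>(1 - t\<^sup>2) \<phi> t\<close> as \<open>t \<rightarrow> 0\<close>; the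
  inequality is the derivative at \<open>t = 0\<close> of the Schwarz-Pick inequality at these points.
\<close>

theorem Berkson_Porta:
  obtains a where "norm a \<le> 1"
    "\<And>z. z \<in> \<D> \<Longrightarrow> 0 \<le> Re (generator z * cnj ((1 - cnj a * z) * (a - z)))"
proof -
  define t where "t n = 1 / (real n + 2)" for n
  \<comment> \<open>The factor pushes the image into a smaller closed disk, to which Brouwer's
    theorem applies. It differs from 1 by \<open>t^2\<close> only, so it does not change the limit
    of the difference quotients.\<close>
  define \<rho> where "\<rho> n = 1 - (t n)\<^sup>2" for n
  have t: "0 < t n" "t n < 1" for n by (simp_all add: t_def)
  have t2: "(t n)\<^sup>2 < 1" "0 < (t n)\<^sup>2" for n
    using power_strict_mono[of "t n" 1 2] t(1)[of n] t(2)[of n] by simp_all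
  have \<rho>: "0 < \<rho> n" "\<rho> n < 1" for n using t2[of n] by (simp_all add: \<rho>_def)
  have t0: "t \<longlonglongrightarrow> 0"
    using LIMSEQ_ignore_initial_segment[OF lim_1_over_n[where 'a = real], of 2] by (simp add: t_def[abs_def] add.commute)
  define f where "f n z = of_real (\<rho> n) * \<phi> (t n) z" for n z
  have hol: "f n holomorphic_on \<D>" for n
    unfolding f_def by (intro holomorphic_intros holomorphic less_imp_le[OF t(1)])
  have f_le: "norm (f n z) \<le> \<rho> n" if "z \<in> \<D>" for n z
  proof -
    have "norm (\<phi> (t n) z) \<le> 1" using in_disk[OF less_imp_le[OF t(1)] that, of n] by simp
    then have "\<rho> n * norm (\<phi> (t n) z) \<le> \<rho> n * 1" using \<rho>(1)[of n] by (intro mult_left_mono) auto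
    then show ?thesis using \<rho>(1)[of n] by (simp add: f_def norm_mult)
  qed
  have f_in: "f n ` \<D> \<subseteq> \<D>" for n
  proof (rule image_subsetI)
    fix z assume "z \<in> \<D>"
    then show "f n z \<in> \<D>" using f_le[of z n] \<rho>(2)[of n] by simp
  qed
  have "\<exists>b\<in>cball 0 (\<rho> n). f n b = b" for n
  proof (rule brouwer_ball[OF \<rho>(1)])
    have sub: "cball 0 (\<rho> n) \<subseteq> \<D>" using \<rho>(2)[of n] by auto
    show "continuous_on (cball 0 (\<rho> n)) (f n)"
      by (rule continuous_on_subset[OF holomorphic_on_imp_continuous_on[OF hol] sub])
    show "f n \<in> cball 0 (\<rho> n) \<rightarrow> cball 0 (\<rho> n)" using f_le sub by auto
  qed blast
  then obtain b where b: "\<And>n. b n \<in> cball 0 (\<rho> n)" "\<And>n. f n (b n) = b n" by metis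
  have bD: "b n \<in> \<D>" for n using b(1)[of n] \<rho>(2)[of n] by auto
  then have "\<forall>n. b n \<in> cball 0 1" using ball_subset_cball by blast
  then obtain a r where a: "a \<in> cball 0 1" "strict_mono r" "(b \<circ> r) \<longlonglongrightarrow> a"
    using compact_cball[of "0::complex" 1] unfolding compact_def by blast
  have "0 \<le> Re (generator z * cnj ((1 - cnj a * z) * (a - z)))" if z: "z \<in> \<D>" for z
  proof -
    define g where "g n = (f n z - z) / of_real (t n)" for n
    have fz: "f n z = z + of_real (t n) * g n" for n using t[of n] by (simp add: g_def)
    have "g = (\<lambda>n. of_real (\<rho> n) * ((\<phi> (t n) z - z) / of_real (t n)) - of_real (t n) * z)"
    proof
      fix n show "g n = of_real (\<rho> n) * ((\<phi> (t n) z - z) / of_real (t n)) - of_real (t n) * z"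
        using t[of n] by (simp add: g_def f_def \<rho>_def power2_eq_square field_simps)
    qed
    moreover have "(\<lambda>n. of_real (\<rho> n) * ((\<phi> (t n) z - z) / of_real (t n)) - of_real (t n) * z)
        \<longlonglongrightarrow> of_real (1 - 0\<^sup>2) * generator z - of_real 0 * z"
      unfolding \<rho>_def
      by (intro tendsto_intros t0 quotient_tendsto_generator z t(1) less_imp_le[OF t(2)])
    ultimately have g: "g \<longlonglongrightarrow> generator z" by simp
    \<comment> \<open>The right side minus the left side of Schwarz-Pick, expanded in
      \<open>t\<close>; the terms of order 0 cancel and one factor \<open>t\<close> is divided out.
      It depends continuously on its arguments, so its sign passes to the limit along the
      subsequence.\<close>
    define E where "E c \<tau> G = (norm (1 - cnj c * z))\<^sup>2 * (- 2 * Re (cnj z * G) - \<tau> * (norm G)\<^sup>2) -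
      (1 - (norm z)\<^sup>2) * (- 2 * Re (cnj (1 - cnj c * z) * cnj c * G) + \<tau> * (norm (cnj c * G))\<^sup>2)" for c \<tau> G
    have expand: "0 \<le> \<tau> * (A * (- 2 * S - \<tau> * G) - (1 - Z) * (- 2 * R + \<tau> * B))"
      if "(1 - Z) * (A - 2 * \<tau> * R + \<tau>\<^sup>2 * B) \<le> (1 - (Z + 2 * \<tau> * S + \<tau>\<^sup>2 * G)) * A"
      for Z A \<tau> R B S G :: real
      using that by (simp add: algebra_simps power2_eq_square)
    have "0 \<le> E (b n) (t n) (g n)" for n
    proof -
      have SP: "(1 - (norm z)\<^sup>2) * (norm (1 - cnj (b n) * f n z))\<^sup>2 \<le>
          (1 - (norm (f n z))\<^sup>2) * (norm (1 - cnj (b n) * z))\<^sup>2"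
        by (rule Schwarz_Pick_fixed_point[OF hol f_in bD b(2) z])
      have "0 \<le> t n * E (b n) (t n) (g n)"
      proof -
        have e: "1 - cnj (b n) * f n z = (1 - cnj (b n) * z) + of_real (t n) * (- (cnj (b n) * g n))"
          by (simp add: fz algebra_simps)
        have 1: "(norm (1 - cnj (b n) * f n z))\<^sup>2 = (norm (1 - cnj (b n) * z))\<^sup>2 -
            2 * t n * Re (cnj (1 - cnj (b n) * z) * cnj (b n) * g n) + (t n)\<^sup>2 * (norm (cnj (b n) * g n))\<^sup>2"
          unfolding e norm_add_scaled_square by (simp add: algebra_simps)
        have 2: "(norm (f n z))\<^sup>2 = (norm z)\<^sup>2 + 2 * t n * Re (cnj z * g n) + (t n)\<^sup>2 * (norm (g n))\<^sup>2"
          unfolding fz by (rule norm_add_scaled_square)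
        show ?thesis
          using SP unfolding 1 2 E_def by (rule expand)
      qed
      then show ?thesis using t[of n] by (simp add: zero_le_mult_iff)
    qed
    moreover have "(\<lambda>n. E ((b \<circ> r) n) ((t \<circ> r) n) ((g \<circ> r) n)) \<longlonglongrightarrow> E a 0 (generator z)"
      unfolding E_def
      by (intro tendsto_intros a(3) LIMSEQ_subseq_LIMSEQ[OF t0 a(2)] LIMSEQ_subseq_LIMSEQ[OF g a(2)])
    ultimately have "0 \<le> E a 0 (generator z)"
      by (intro LIMSEQ_le_const) auto
    also have "E a 0 (generator z) = 2 * Re (generator z * cnj ((1 - cnj a * z) * (a - z)))"
    proof -
      define A where "A = 1 - cnj a * z"
      define G where "G = generator z"
      have "of_real ((norm A)\<^sup>2) * (- 2 * (cnj z * G)) - of_real (1 - (norm z)\<^sup>2) * (- 2 * (cnj A * cnj a * G)) =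
          2 * (G * cnj (A * (a - z)))"
        unfolding of_real_diff complex_norm_square by (simp add: A_def algebra_simps)
      then have "Re (of_real ((norm A)\<^sup>2) * (- 2 * (cnj z * G)) - of_real (1 - (norm z)\<^sup>2) * (- 2 * (cnj A * cnj a * G))) =
          Re (2 * (G * cnj (A * (a - z))))"
        by (rule arg_cong)
      moreover have R: "Re (of_real u * (- 2 * v) - of_real u' * (- 2 * v')) = u * (- 2 * Re v) - u' * (- 2 * Re v')"
        for u u' v v' by simp
      moreover have "Re (2 * v) = 2 * Re v" for v by simp
      ultimately have "(norm A)\<^sup>2 * (- 2 * Re (cnj z * G)) - (1 - (norm z)\<^sup>2) * (- 2 * Re (cnj A * cnj a * G)) =
          2 * Re (G * cnj (A * (a - z)))"
        by metis
      then show ?thesis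
        unfolding E_def A_def[symmetric] G_def[symmetric]
        by (simp only: mult_zero_left diff_0_right add_0_right)
    qed
    finally show ?thesis by simp
  qed
  moreover have "norm a \<le> 1" using a(1) by simp
  ultimately show thesis by (rule that[rotated])
qed

end

section \<open>Trajectories and level sets\<close>

lemma geometric_interval:
  fixes x l :: real
  assumes "1 < l" "1 \<le> x"
  obtains n where "l ^ n \<le> x" "x \<le> l ^ Suc n"
proof -
  define m where "m = (LEAST n. x < l ^ n)"
  have "\<exists>n. x < l ^ n" using real_arch_pow[OF assms(1)] .
  then have m: "x < l ^ m" unfolding m_def by (rule LeastI_ex)
  then have "m \<noteq> 0" using assms(2) by (intro notI) simp
  then obtain n where n: "m = Suc n" using not0_implies_Suc by blast
  have "\<not> x < l ^ n" using not_less_Least[of n "\<lambda>n. x < l ^ n"] n by (simp add: m_def)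
  with m n show thesis by (intro that[of n]) auto
qed

context half_plane_primitive
begin

definition level_set :: "real \<Rightarrow> complex set"
  where "level_set c = {p \<in> \<H>. Im (h p) = c}"

text \<open>The slab is so thin that any two of its points satisfy \<open>close\<close> in
  \<open>flat_level_set\<close>; hence \<open>Re\<close> is a Lipschitz coordinate on the flat
  points. 110001 adds the horizontal displacement to the vertical one, and 110001 / 200000 < 1
  absorbs it.\<close>

lemma hausdorff_measure_1_flat_piece:
  fixes C :: "complex \<Rightarrow> complex"
  assumes C: "\<And>p p' X. 0 < X \<Longrightarrow> X \<le> Re p \<Longrightarrow> X \<le> Re p' \<Longrightarrow>
      dist (C p) (C p') \<le> K / (1 + X)\<^sup>2 * dist p p'" and "0 \<le> K" and X: "0 < X"
  shows "hausdorff_measure_1 (C ` {p \<in> level_set c. \<not> steep p \<and> X \<le> Re p \<and> Re p \<le> (1 + 1/200000) * X})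
    \<le> ennreal (K * X / (1 + X)\<^sup>2)"
proof -
  define k where "k = K / (1 + X)\<^sup>2"
  have k: "0 \<le> k" using \<open>0 \<le> K\<close> by (simp add: k_def)
  have "hausdorff_measure_1 (C ` {p \<in> level_set c. \<not> steep p \<and> X \<le> Re p \<and> Re p \<le> (1 + 1/200000) * X})
      \<le> ennreal (k * 110001 * ((1 + 1/200000) * X) - k * 110001 * X)"
  proof (rule hausdorff_measure_1_image_le[where L = "\<lambda>p. k * 110001 * Re p"])
    fix p p' assume p: "p \<in> {p \<in> level_set c. \<not> steep p \<and> X \<le> Re p \<and> Re p \<le> (1 + 1/200000) * X}"
      and p': "p' \<in> {p \<in> level_set c. \<not> steep p \<and> X \<le> Re p \<and> Re p \<le> (1 + 1/200000) * X}"
    have "200000 * Re p \<le> 200001 * X" "200000 * Re p' \<le> 200001 * X" "X \<le> Re p" "X \<le> Re p'"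
      using p p' by auto
    then have "Re p' - Re p \<le> Re p / 200000" "Re p - Re p' \<le> Re p / 200000" by simp_all
    then have "\<bar>Re p' - Re p\<bar> \<le> Re p / 200000" by (simp only: abs_le_iff minus_diff_eq)
    then have "\<bar>Im p' - Im p\<bar> \<le> 110000 * \<bar>Re p' - Re p\<bar>"
      using p p' by (intro flat_level_set) (auto simp: level_set_def)
    moreover have "dist p p' \<le> \<bar>Re p' - Re p\<bar> + \<bar>Im p' - Im p\<bar>"
      using cmod_le[of "p' - p"] by (simp add: dist_norm norm_minus_commute)
    ultimately have "dist p p' \<le> 110001 * \<bar>Re p' - Re p\<bar>" by simp
    then have "k * dist p p' \<le> k * (110001 * \<bar>Re p' - Re p\<bar>)"
      using k by (intro mult_left_mono)
    moreover have "dist (C p) (C p') \<le> k * dist p p'"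
      unfolding k_def using p p' X by (intro C) auto
    ultimately show "dist (C p) (C p') \<le> \<bar>k * 110001 * Re p - k * 110001 * Re p'\<bar>"
      using k by (simp add: right_diff_distrib[symmetric] abs_mult abs_minus_commute)
  next
    fix p assume "p \<in> {p \<in> level_set c. \<not> steep p \<and> X \<le> Re p \<and> Re p \<le> (1 + 1/200000) * X}"
    then show "k * 110001 * X \<le> k * 110001 * Re p \<and> k * 110001 * Re p \<le> k * 110001 * ((1 + 1/200000) * X)"
      using k by (intro conjI mult_left_mono) auto
  qed (use k X in \<open>auto intro!: mult_left_mono\<close>)
  also have "\<dots> \<le> ennreal (K * X / (1 + X)\<^sup>2)"
  proof (rule ennreal_leI)
    have "k * 110001 * ((1 + 1/200000) * X) - k * 110001 * X = k * X * (110001/200000)"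
      by (simp add: algebra_simps)
    also have "\<dots> \<le> k * X" using k X by (intro mult_left_le) auto
    finally show "k * 110001 * ((1 + 1/200000) * X) - k * 110001 * X \<le> K * X / (1 + X)\<^sup>2"
      by (simp add: k_def)
  qed
  finally show ?thesis .
qed

text \<open>Along a geometric sequence of scales \<open>K * X / (1 + X)^2\<close> is summable in
  both directions, being of order \<open>1 / X\<close> at infinity and \<open>X\<close> at
  0.\<close>

lemma hausdorff_measure_1_flat:
  fixes C :: "complex \<Rightarrow> complex"
  assumes C: "\<And>p p' X. 0 < X \<Longrightarrow> X \<le> Re p \<Longrightarrow> X \<le> Re p' \<Longrightarrow>
      dist (C p) (C p') \<le> K / (1 + X)\<^sup>2 * dist p p'" and K: "0 \<le> K"
  shows "hausdorff_measure_1 (C ` {p \<in> level_set c. \<not> steep p}) < \<infinity>"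
proof -
  define l :: real where "l = 1 + 1/200000"
  define S where "S X = C ` {p \<in> level_set c. \<not> steep p \<and> X \<le> Re p \<and> Re p \<le> l * X}" for X
  have l: "1 < l" "l \<noteq> 0" by (simp_all add: l_def)
  have S_le: "hausdorff_measure_1 (S X) \<le> ennreal (K * X / (1 + X)\<^sup>2)" if "0 < X" for X
    unfolding S_def l_def by (rule hausdorff_measure_1_flat_piece[OF C K that])
  have summable: "summable (\<lambda>n. K * (1 / l) ^ n)"
    using l by (intro summable_mult summable_geometric) auto
  have "hausdorff_measure_1 (\<Union>n. S (l ^ n)) < \<infinity>"
  proof (rule hausdorff_measure_1_UN_finite[OF _ summable])
    fix n :: nat
    have X: "0 < l ^ n" using l by simp
    have "K * l ^ n / (1 + l ^ n)\<^sup>2 \<le> K * l ^ n / (l ^ n)\<^sup>2"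
      using X K l by (intro divide_left_mono power_mono mult_pos_pos zero_less_power add_pos_pos) auto
    also have "\<dots> = K * (1 / l) ^ n"
      using l(2) by (simp add: power2_eq_square power_one_over)
    finally show "hausdorff_measure_1 (S (l ^ n)) \<le> ennreal (K * (1 / l) ^ n)"
      using S_le[OF X] ennreal_leI order_trans by blast
  qed (use K l in auto)
  moreover have "hausdorff_measure_1 (\<Union>n. S ((1 / l) ^ Suc n)) < \<infinity>"
  proof (rule hausdorff_measure_1_UN_finite[OF _ summable])
    fix n :: nat
    have X: "0 < (1 / l) ^ Suc n" using l by simp
    have "K * (1 / l) ^ Suc n / (1 + (1 / l) ^ Suc n)\<^sup>2 \<le> K * (1 / l) ^ Suc n / 1"
    proof (rule divide_left_mono)
      show one: "1 \<le> (1 + (1 / l) ^ Suc n)\<^sup>2" using X by (intro one_le_power) simp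
      show "0 < (1 + (1 / l) ^ Suc n)\<^sup>2 * 1" using one by linarith
      show "0 \<le> K * (1 / l) ^ Suc n" using K less_imp_le[OF X] by (rule mult_nonneg_nonneg)
    qed
    also have "\<dots> \<le> K * (1 / l) ^ n"
      using l K by (simp add: mult_left_mono power_decreasing del: power_Suc)
    finally show "hausdorff_measure_1 (S ((1 / l) ^ Suc n)) \<le> ennreal (K * (1 / l) ^ n)"
      using S_le[OF X] ennreal_leI order_trans by blast
  qed (use K l in auto)
  ultimately have "hausdorff_measure_1 ((\<Union>n. S (l ^ n)) \<union> (\<Union>n. S ((1 / l) ^ Suc n))) < \<infinity>"
    by (rule hausdorff_measure_1_Un_finite)
  moreover have "C ` {p \<in> level_set c. \<not> steep p} \<subseteq> (\<Union>n. S (l ^ n)) \<union> (\<Union>n. S ((1 / l) ^ Suc n))"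
  proof
    fix x assume "x \<in> C ` {p \<in> level_set c. \<not> steep p}"
    then obtain p where p: "p \<in> level_set c" "\<not> steep p" "x = C p" by blast
    then have pos: "0 < Re p" by (simp add: level_set_def)
    show "x \<in> (\<Union>n. S (l ^ n)) \<union> (\<Union>n. S ((1 / l) ^ Suc n))"
    proof (cases "1 \<le> Re p")
      case True
      then obtain n where "l ^ n \<le> Re p" "Re p \<le> l ^ Suc n" using geometric_interval[OF l(1)] by blast
      then have "x \<in> S (l ^ n)" using p by (auto simp: S_def)
      then show ?thesis by blast
    next
      case False
      then have "1 \<le> 1 / Re p" using pos by simp
      then obtain n where "l ^ n \<le> 1 / Re p" "1 / Re p \<le> l ^ Suc n" using geometric_interval[OF l(1)] by blast
      moreover have "0 < l ^ n" using l by simp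
      \<comment> \<open>Taking reciprocals exchanges the ends of the slab, so its left end is the
        power with exponent \<open>Suc n\<close>.\<close>
      ultimately have "(1 / l) ^ Suc n \<le> Re p" "Re p \<le> l * (1 / l) ^ Suc n"
        using pos l by (auto simp: power_one_over field_simps)
      then have "x \<in> S ((1 / l) ^ Suc n)" using p by (auto simp: S_def)
      then show ?thesis by blast
    qed
  qed
  ultimately show ?thesis using hausdorff_measure_1_mono le_less_trans by blast
qed

end

section \<open>Trajectories of a vector field and changes of coordinates\<close>

definition trajectory :: "(complex \<Rightarrow> complex) \<Rightarrow> complex set \<Rightarrow> complex \<Rightarrow> complex \<Rightarrow> bool"
  where "trajectory G U z w \<longleftrightarrow> (\<exists>T\<ge>0. \<exists>\<gamma>. \<gamma> 0 = z \<and> \<gamma> T = w \<and>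
    (\<forall>t\<in>{0..T}. \<gamma> t \<in> U \<and> (\<gamma> has_vector_derivative G (\<gamma> t)) (at t within {0..T})))"

text \<open>The past of \<open>z\<close> is expressed by forward trajectories that end at
  \<open>z\<close>, which is the form in which backward orbits of a semigroup arise.\<close>

definition full_orbit :: "(complex \<Rightarrow> complex) \<Rightarrow> complex set \<Rightarrow> complex \<Rightarrow> complex set"
  where "full_orbit G U z = {w. trajectory G U z w \<or> trajectory G U w z}"

lemma trajectory_in:
  assumes "trajectory G U z w"
  shows "z \<in> U" "w \<in> U"
proof -
  obtain T :: real and \<gamma> where \<gamma>: "0 \<le> T" "\<gamma> 0 = z" "\<gamma> T = w" "\<And>t. t \<in> {0..T} \<Longrightarrow> \<gamma> t \<in> U"
    using assms unfolding trajectory_def by blast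
  show "z \<in> U" "w \<in> U" using \<gamma>(4)[of 0] \<gamma>(4)[of T] \<gamma>(1-3) by simp_all
qed

lemma full_orbit_subset: "full_orbit G U z \<subseteq> U"
  using trajectory_in unfolding full_orbit_def by blast

lemma trajectory_map:
  assumes "trajectory G U z w"
    and Z: "\<And>x. x \<in> U \<Longrightarrow> (Z has_field_derivative Z' x) (at x)"
    and F: "\<And>x. x \<in> U \<Longrightarrow> Z' x * G x = F (Z x)" and "Z ` U \<subseteq> V"
  shows "trajectory F V (Z z) (Z w)"
proof -
  obtain T \<gamma> where T: "0 \<le> T" and \<gamma>: "\<gamma> 0 = z" "\<gamma> T = w"
    "\<And>t. t \<in> {0..T} \<Longrightarrow> \<gamma> t \<in> U \<and> (\<gamma> has_vector_derivative G (\<gamma> t)) (at t within {0..T})"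
    using assms(1) unfolding trajectory_def by blast
  have "((Z \<circ> \<gamma>) has_vector_derivative F (Z (\<gamma> t))) (at t within {0..T})" if "t \<in> {0..T}" for t
  proof -
    have "((Z \<circ> \<gamma>) has_vector_derivative G (\<gamma> t) * Z' (\<gamma> t)) (at t within {0..T})"
      using \<gamma>(3)[OF that] Z by (intro field_vector_diff_chain_within) (auto intro: DERIV_subset)
    then show ?thesis using F[of "\<gamma> t"] \<gamma>(3)[OF that] by (simp add: mult.commute)
  qed
  then show ?thesis
    unfolding trajectory_def using T \<gamma> assms(4) by (intro exI[of _ T] conjI exI[of _ "Z \<circ> \<gamma>"]) auto
qed

lemma full_orbit_map:
  assumes "w \<in> full_orbit G U z"
    and "\<And>x. x \<in> U \<Longrightarrow> (Z has_field_derivative Z' x) (at x)"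
    and "\<And>x. x \<in> U \<Longrightarrow> Z' x * G x = F (Z x)" and "Z ` U \<subseteq> V"
  shows "Z w \<in> full_orbit F V (Z z)"
  using assms trajectory_map[OF _ assms(2-4)] unfolding full_orbit_def by blast

lemma zero_vector_derivative_imp_eq:
  fixes f :: "real \<Rightarrow> 'a::banach"
  assumes "0 \<le> T" "\<And>t. t \<in> {0..T} \<Longrightarrow> (f has_vector_derivative 0) (at t within {0..T})"
  shows "f T = f 0"
proof -
  have "((\<lambda>_. 0) has_integral (f T - f 0)) {0..T}"
    using assms by (rule fundamental_theorem_of_calculus)
  then show ?thesis by (simp add: has_integral_0_eq)
qed

lemma trajectory_exponential:
  assumes "trajectory (\<lambda>x. \<mu> * x) UNIV z w"
  shows "\<exists>t. w = exp (\<mu> * of_real t) * z"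
proof -
  obtain T \<gamma> where T: "0 \<le> T" and \<gamma>: "\<gamma> 0 = z" "\<gamma> T = w"
    "\<And>t. t \<in> {0..T} \<Longrightarrow> (\<gamma> has_vector_derivative \<mu> * \<gamma> t) (at t within {0..T})"
    using assms unfolding trajectory_def by blast
  have "((\<lambda>t. exp (- \<mu> * of_real t) * \<gamma> t) has_vector_derivative 0) (at t within {0..T})" if "t \<in> {0..T}" for t
  proof -
    have "((\<lambda>t. exp (- \<mu> * of_real t)) has_vector_derivative (- \<mu> * exp (- \<mu> * of_real t))) (at t within {0..T})"
      by (rule has_vector_derivative_real_field) (auto intro!: derivative_eq_intros)
    from has_vector_derivative_mult[OF this \<gamma>(3)[OF that]] show ?thesis by (simp add: algebra_simps)
  qed
  from zero_vector_derivative_imp_eq[OF T this] have "exp (- \<mu> * of_real T) * \<gamma> T = \<gamma> 0" by simp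
  then have "exp (\<mu> * of_real T) * (exp (- \<mu> * of_real T) * w) = exp (\<mu> * of_real T) * z"
    using \<gamma> by simp
  then have "w = exp (\<mu> * of_real T) * z"
    by (simp add: mult.assoc[symmetric] exp_minus)
  then show ?thesis by blast
qed

text \<open>Used for a primitive \<open>h\<close> of \<open>1 / F\<close>, which moves at unit real
  speed along the flow of \<open>F\<close>, and for multiplication by \<open>\<i>\<close> when
  \<open>F\<close> is an imaginary constant.\<close>

lemma trajectory_Im_const:
  assumes "trajectory G U z w"
    and k: "\<And>x. x \<in> U \<Longrightarrow> (k has_field_derivative k' x) (at x)"
    and eq: "\<And>x. x \<in> U \<Longrightarrow> Im (k' x * G x) = 0"
  shows "Im (k w) = Im (k z)"
proof -
  obtain T \<gamma> where T: "0 \<le> T" and \<gamma>: "\<gamma> 0 = z" "\<gamma> T = w"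
    "\<And>t. t \<in> {0..T} \<Longrightarrow> \<gamma> t \<in> U \<and> (\<gamma> has_vector_derivative G (\<gamma> t)) (at t within {0..T})"
    using assms(1) unfolding trajectory_def by blast
  have "((\<lambda>t. Im ((k \<circ> \<gamma>) t)) has_vector_derivative 0) (at t within {0..T})" if "t \<in> {0..T}" for t
  proof -
    have "((k \<circ> \<gamma>) has_vector_derivative G (\<gamma> t) * k' (\<gamma> t)) (at t within {0..T})"
      using \<gamma>(3)[OF that] k by (intro field_vector_diff_chain_within) (auto intro: DERIV_subset)
    from bounded_linear.has_vector_derivative[OF bounded_linear_Im this] show ?thesis
      using eq[of "\<gamma> t"] \<gamma>(3)[OF that] by (simp add: mult.commute)
  qed
  from zero_vector_derivative_imp_eq[OF T this] \<gamma> show ?thesis by simp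
qed

text \<open>The image of a nonconstant \<open>f\<close> is open and so cannot touch the imaginary
  axis from one side. Constants with positive real part belong to the first alternative.\<close>

lemma nonneg_real_part_cases:
  assumes hol: "f holomorphic_on S" and S: "open S" "connected S" and nonneg: "\<And>z. z \<in> S \<Longrightarrow> 0 \<le> Re (f z)"
  obtains "\<And>z. z \<in> S \<Longrightarrow> 0 < Re (f z)" | c where "Re c = 0" "\<And>z. z \<in> S \<Longrightarrow> f z = c"
proof (cases "f constant_on S")
  case True
  then obtain c where "\<And>z. z \<in> S \<Longrightarrow> f z = c" unfolding constant_on_def by blast
  then show thesis using that nonneg by (metis order_le_less)
next
  case False
  then have op: "open (f ` S)" using open_mapping_thm[OF hol S S(1)] by blast
  have "0 < Re (f z)" if z: "z \<in> S" for z
  proof -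
    obtain e where e: "e > 0" "ball (f z) e \<subseteq> f ` S"
      by (rule openE[OF op imageI[OF z]])
    have "f z - of_real (e / 2) \<in> ball (f z) e" using e(1) by (simp add: dist_norm)
    then have "f z - of_real (e / 2) \<in> f ` S" by (rule subsetD[OF e(2)])
    then obtain w where w: "f z - of_real (e / 2) = f w" "w \<in> S" by (rule imageE)
    then have "Re (f z) - e / 2 = Re (f w)" by (metis Re_complex_of_real minus_complex.sel(1))
    then have "Re (f z) - e / 2 \<ge> 0" using nonneg[OF w(2)] by simp
    then show ?thesis using e(1) by simp
  qed
  then show thesis using that by blast
qed

text \<open>\<open>C\<close> stands for the Cayley map, or for the exponential followed by a
  Lipschitz map. The decay of its Lipschitz constant settles the flat part. The steep part is a
  graph over a possibly unbounded set of imaginary parts, and each \<open>C\<close> has its own way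
  to handle that; hence the hypothesis \<open>steep\<close>.\<close>

lemma hausdorff_measure_1_level_set:
  fixes C :: "complex \<Rightarrow> complex"
  assumes "half_plane_primitive q h" and K: "0 \<le> K"
    and C: "\<And>p p' X. 0 < X \<Longrightarrow> X \<le> Re p \<Longrightarrow> X \<le> Re p' \<Longrightarrow>
      dist (C p) (C p') \<le> K / (1 + X)\<^sup>2 * dist p p'"
    and steep: "\<And>P. (\<And>p. p \<in> P \<Longrightarrow> p \<in> \<H> \<and> Im (h p) = c) \<Longrightarrow>
      (\<And>p p'. p \<in> P \<Longrightarrow> p' \<in> P \<Longrightarrow> \<bar>Re p - Re p'\<bar> \<le> \<bar>Im p - Im p'\<bar>) \<Longrightarrow>
      hausdorff_measure_1 (C ` P) < \<infinity>"
  shows "hausdorff_measure_1 (C ` {p \<in> \<H>. Im (h p) = c}) < \<infinity>"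
proof -
  interpret half_plane_primitive q h by fact
  have "hausdorff_measure_1 (C ` {p \<in> level_set c. steep p}) < \<infinity>"
    using steep_level_set by (intro steep) (auto simp: level_set_def)
  with hausdorff_measure_1_flat[OF C K, of c]
  have "hausdorff_measure_1 (C ` {p \<in> level_set c. \<not> steep p} \<union> C ` {p \<in> level_set c. steep p}) < \<infinity>"
    by (intro hausdorff_measure_1_Un_finite)
  moreover have "C ` {p \<in> level_set c. \<not> steep p} \<union> C ` {p \<in> level_set c. steep p} = C ` {p \<in> \<H>. Im (h p) = c}"
    by (auto simp: level_set_def)
  ultimately show ?thesis by simp
qed

section \<open>Denjoy-Wolff point on the circle\<close>

text \<open>The left side is |sin (arctan x - arctan y)|. It makes the arctangent a coordinate of
  finite range for graphs over the imaginary axis.\<close>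

lemma abs_diff_le_arctan:
  "\<bar>x - y\<bar> / (sqrt (1 + x\<^sup>2) * sqrt (1 + y\<^sup>2)) \<le> \<bar>arctan x - arctan y\<bar>"
proof -
  have "sin (arctan x - arctan y) = (x - y) / (sqrt (1 + x\<^sup>2) * sqrt (1 + y\<^sup>2))"
    by (simp add: sin_diff sin_arctan cos_arctan diff_divide_distrib)
  then have "\<bar>x - y\<bar> / (sqrt (1 + x\<^sup>2) * sqrt (1 + y\<^sup>2)) = \<bar>sin (arctan x - arctan y)\<bar>"
    by (simp add: abs_divide abs_mult)
  then show ?thesis using abs_sin_x_le_abs_x by metis
qed

text \<open>The inverse of \<open>(a + z) / (a - z)\<close>. It sends infinity to \<open>a\<close>,
  so a Denjoy-Wolff point \<open>a\<close> on the circle becomes the point at infinity of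
  \<open>\<H>\<close>.\<close>

definition cayley :: "complex \<Rightarrow> complex \<Rightarrow> complex"
  where "cayley a s = a * (s - 1) / (s + 1)"

lemma dist_cayley:
  assumes a: "norm a = 1" and "0 < Re p" "0 < Re p'"
  shows "dist (cayley a p) (cayley a p') = 2 * dist p p' / (norm (p + 1) * norm (p' + 1))"
proof -
  have nz: "p + 1 \<noteq> 0" "p' + 1 \<noteq> 0" by (rule Re_pos_add_1_nonzero, fact)+
  then have "cayley a p - cayley a p' = a * (2 * (p - p')) / ((p + 1) * (p' + 1))"
    unfolding cayley_def by (simp add: divide_simps) (simp add: algebra_simps)
  then show ?thesis by (simp only: dist_norm norm_mult norm_divide a) simp
qed

text \<open>Even a graph over the whole imaginary axis has an image of finite length, as
  \<open>norm (p + 1)\<close> dominates \<open>sqrt (1 + (Im p)^2)\<close>. The factor 4 is the 2 of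
  \<open>dist_cayley\<close> times the 2 of the graph.\<close>

lemma hausdorff_measure_1_cayley_graph:
  assumes a: "norm a = 1" and P: "\<And>p. p \<in> P \<Longrightarrow> 0 < Re p"
    and steep: "\<And>p p'. p \<in> P \<Longrightarrow> p' \<in> P \<Longrightarrow> \<bar>Re p - Re p'\<bar> \<le> \<bar>Im p - Im p'\<bar>"
  shows "hausdorff_measure_1 (cayley a ` P) < \<infinity>"
proof -
  have "hausdorff_measure_1 (cayley a ` P) \<le> ennreal (4 * (pi / 2) - 4 * (- (pi / 2)))"
  proof (rule hausdorff_measure_1_image_le[where L = "\<lambda>p. 4 * arctan (Im p)"])
    fix p p' assume p: "p \<in> P" and p': "p' \<in> P"
    have norm_ge: "sqrt (1 + (Im r)\<^sup>2) \<le> norm (r + 1)" if "0 < Re r" for r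
      unfolding cmod_def using that one_le_power[of "Re r + 1" 2] by (intro real_sqrt_le_mono) simp
    have pos: "0 < sqrt (1 + (Im r)\<^sup>2)" for r by (simp add: add_pos_nonneg)
    have "dist p p' \<le> \<bar>Re p - Re p'\<bar> + \<bar>Im p - Im p'\<bar>"
      using cmod_le[of "p - p'"] by (simp add: dist_norm)
    then have d: "dist p p' \<le> 2 * \<bar>Im p - Im p'\<bar>" using steep[OF p p'] by simp
    have "dist (cayley a p) (cayley a p') = 2 * dist p p' / (norm (p + 1) * norm (p' + 1))"
      using a P p p' by (intro dist_cayley) auto
    also have "\<dots> \<le> 2 * (2 * \<bar>Im p - Im p'\<bar>) / (sqrt (1 + (Im p)\<^sup>2) * sqrt (1 + (Im p')\<^sup>2))"
      using d pos P p p' by (intro frac_le mult_mono norm_ge mult_pos_pos) auto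
    also have "\<dots> = 4 * (\<bar>Im p - Im p'\<bar> / (sqrt (1 + (Im p)\<^sup>2) * sqrt (1 + (Im p')\<^sup>2)))"
      by simp
    also have "\<dots> \<le> 4 * \<bar>arctan (Im p) - arctan (Im p')\<bar>"
      by (intro mult_left_mono abs_diff_le_arctan) auto
    also have "\<dots> = \<bar>4 * (arctan (Im p) - arctan (Im p'))\<bar>" unfolding abs_mult by simp
    finally show "dist (cayley a p) (cayley a p') \<le> \<bar>4 * arctan (Im p) - 4 * arctan (Im p')\<bar>"
by (simp only: right_diff_distrib)
  next
    fix p
    show "4 * (- (pi / 2)) \<le> 4 * arctan (Im p) \<and> 4 * arctan (Im p) \<le> 4 * (pi / 2)"
      using arctan_lbound[of "Im p"] arctan_ubound[of "Im p"] by simp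
  qed simp
  then show ?thesis by (rule le_less_trans) simp
qed

lemma hausdorff_measure_1_full_orbit_half_plane:
  assumes F: "F holomorphic_on \<H>" and nonneg: "\<And>s. s \<in> \<H> \<Longrightarrow> 0 \<le> Re (F s)" and a: "norm a = 1"
  shows "hausdorff_measure_1 (cayley a ` full_orbit F \<H> s0) < \<infinity>"
proof -
  have conn: "connected \<H>" by (rule convex_connected[OF convex_half_plane])
  consider "\<And>s. s \<in> \<H> \<Longrightarrow> 0 < Re (F s)" | c where "Re c = 0" "\<And>s. s \<in> \<H> \<Longrightarrow> F s = c"
    using nonneg_real_part_cases[OF F open_half_plane conn nonneg] by blast
  then show ?thesis
  proof cases
    case 1
    have nz: "F s \<noteq> 0" if "s \<in> \<H>" for s using 1[OF that] by auto
    define q where "q s = 1 / F s" for s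
    have hol: "q holomorphic_on \<H>"
      unfolding q_def using nz by (intro holomorphic_intros F) auto
    obtain h where h: "\<And>z. z \<in> \<H> \<Longrightarrow> (h has_field_derivative q z) (at z)"
      using holomorphic_half_plane_primitive[OF hol] by blast
    have "0 < Re (q s)" if "s \<in> \<H>" for s
      using 1[OF that] nz[OF that] unfolding q_def
      by (simp add: Re_divide zero_less_divide_iff sum_power2_gt_zero_iff complex_eq_iff)
    then have "half_plane_primitive q h" using hol h by unfold_locales auto
    have orbit: "full_orbit F \<H> s0 \<subseteq> {p \<in> \<H>. Im (h p) = Im (h s0)}"
    proof
      fix s assume s: "s \<in> full_orbit F \<H> s0"
      have "Im (h y) = Im (h x)" if "trajectory F \<H> x y" for x y
        using nz by (intro trajectory_Im_const[OF that h]) (auto simp: q_def)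
      then show "s \<in> {p \<in> \<H>. Im (h p) = Im (h s0)}"
        using s full_orbit_subset unfolding full_orbit_def by fastforce
    qed
    have "hausdorff_measure_1 (cayley a ` {p \<in> \<H>. Im (h p) = Im (h s0)}) < \<infinity>"
    proof (rule hausdorff_measure_1_level_set[OF \<open>half_plane_primitive q h\<close>, of 2])
      fix p p' :: complex and X :: real assume X: "0 < X" "X \<le> Re p" "X \<le> Re p'"
      have ge: "1 + X \<le> norm (r + 1)" if "X \<le> Re r" for r
        using that complex_Re_le_cmod[of "r + 1"] by simp
      have "dist (cayley a p) (cayley a p') = 2 * dist p p' / (norm (p + 1) * norm (p' + 1))"
        using a X by (intro dist_cayley) auto
      also have "\<dots> \<le> 2 * dist p p' / ((1 + X) * (1 + X))"
        using X ge by (intro frac_le mult_mono mult_pos_pos) auto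
      finally show "dist (cayley a p) (cayley a p') \<le> 2 / (1 + X)\<^sup>2 * dist p p'"
        by (simp add: power2_eq_square)
    next
      fix P assume "\<And>p. p \<in> P \<Longrightarrow> p \<in> \<H> \<and> Im (h p) = Im (h s0)"
        "\<And>p p'. p \<in> P \<Longrightarrow> p' \<in> P \<Longrightarrow> \<bar>Re p - Re p'\<bar> \<le> \<bar>Im p - Im p'\<bar>"
      then show "hausdorff_measure_1 (cayley a ` P) < \<infinity>"
        by (intro hausdorff_measure_1_cayley_graph[OF a]) auto
    qed simp
    then show ?thesis
      using hausdorff_measure_1_mono[OF image_mono[OF orbit]] le_less_trans by blast
  next
    case (2 c)
    \<comment> \<open>A constant imaginary field moves points vertically, and a vertical line is
      trivially a graph over the imaginary axis.\<close>
    have "Re s = Re s0" if s: "s \<in> full_orbit F \<H> s0" for s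
    proof -
      have "Im (\<i> * y) = Im (\<i> * x)" if "trajectory F \<H> x y" for x y
      proof (rule trajectory_Im_const[OF that])
        show "((*) \<i> has_field_derivative \<i>) (at x)" for x
          by (auto intro!: derivative_eq_intros)
      qed (use 2 in simp)
      then show ?thesis using s unfolding full_orbit_def by auto
    qed
    then show ?thesis
      using full_orbit_subset by (intro hausdorff_measure_1_cayley_graph[OF a]) fastforce+
  qed
qed

lemma hausdorff_measure_1_full_orbit_boundary:
  assumes G: "G holomorphic_on \<D>" and a: "norm a = 1"
    and BP: "\<And>z. z \<in> \<D> \<Longrightarrow> 0 \<le> Re (G z * cnj ((1 - cnj a * z) * (a - z)))"
  shows "hausdorff_measure_1 (full_orbit G \<D> z0) < \<infinity>"
proof -
  define Z where "Z z = (a + z) / (a - z)" for z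
  \<comment> \<open>The push-forward of \<open>G\<close> under \<open>Z\<close>, as
    \<open>2 * a / (a - z)^2\<close> is the derivative of \<open>Z\<close>.\<close>
  define F where "F s = 2 * a * G (cayley a s) / (a - cayley a s)\<^sup>2" for s
  have aa: "a * cnj a = 1" using a complex_norm_square[of a] by simp
  have cayley_in: "cayley a s \<in> \<D>" if "s \<in> \<H>" for s
    using norm_less_norm_add_1[of s] Re_pos_add_1_nonzero[of s] that a
    by (simp add: cayley_def norm_mult norm_divide)
  have ne: "a - z \<noteq> 0" if "z \<in> \<D>" for z using that a by auto
  have CZ: "cayley a (Z z) = z" if "z \<in> \<D>" for z
  proof -
    have "Z z - 1 = 2 * z / (a - z)" "Z z + 1 = 2 * a / (a - z)"
      using ne[OF that] by (simp_all add: Z_def divide_simps)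
    moreover have "a \<noteq> 0" using a by auto
    ultimately show ?thesis using ne[OF that] by (simp add: cayley_def)
  qed
  have Z_in: "Z ` \<D> \<subseteq> \<H>"
  proof clarify
    fix z :: complex assume z: "z \<in> \<D>"
    have "Re ((a + z) * cnj (a - z)) = (norm a)\<^sup>2 - (norm z)\<^sup>2"
      unfolding cmod_power2 by (simp add: power2_eq_square algebra_simps)
    moreover have "(norm z)\<^sup>2 < 1" using z by (simp add: power_less_one_iff)
    ultimately have "0 < Re ((a + z) * cnj (a - z)) / (norm (a - z))\<^sup>2"
      using a ne[OF z] by simp
    then show "0 < Re (Z z)"
      unfolding Z_def complex_div_cnj[of "a + z"] by (simp add: Re_divide_of_real flip: of_real_power)
  qed
  have hol_c: "cayley a holomorphic_on \<H>"
    unfolding cayley_def[abs_def] by (intro holomorphic_intros) (auto dest!: Re_pos_add_1_nonzero)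
  have "(G \<circ> cayley a) holomorphic_on \<H>"
    by (rule holomorphic_on_compose_gen[OF hol_c G]) (use cayley_in in blast)
  then have hol_G: "(\<lambda>s. G (cayley a s)) holomorphic_on \<H>" by (simp only: o_def)
  have F: "F holomorphic_on \<H>"
    unfolding F_def
  proof (rule holomorphic_on_divide)
    show "(\<lambda>s. 2 * a * G (cayley a s)) holomorphic_on \<H>"
      by (intro holomorphic_intros hol_G)
    show "(\<lambda>s. (a - cayley a s)\<^sup>2) holomorphic_on \<H>"
      by (intro holomorphic_intros hol_c)
    show "(a - cayley a s)\<^sup>2 \<noteq> 0" if "s \<in> \<H>" for s
      using ne[OF cayley_in[OF that]] by simp
  qed
  have nonneg: "0 \<le> Re (F s)" if "s \<in> \<H>" for s
  proof -
    let ?z = "cayley a s"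
    have z: "?z \<in> \<D>" by (rule cayley_in[OF that])
    \<comment> \<open>For \<open>norm a = 1\<close> the two factors in the Berkson-Porta inequality
      agree up to \<open>cnj a\<close>, and the inequality becomes the sign condition on
      \<open>Re F\<close>.\<close>
    have e: "1 - cnj a * ?z = cnj a * (a - ?z)" using aa by (simp add: algebra_simps)
    have eq: "G ?z * cnj ((1 - cnj a * ?z) * (a - ?z)) = a * G ?z * cnj ((a - ?z)\<^sup>2)"
      unfolding e by (simp add: power2_eq_square)
    have nonneg: "0 \<le> Re (a * G ?z * cnj ((a - ?z)\<^sup>2))" using BP[OF z] unfolding eq .
    have F_eq: "F s = of_real 2 * (a * G ?z * cnj ((a - ?z)\<^sup>2)) / of_real ((norm ((a - ?z)\<^sup>2))\<^sup>2)"
      unfolding F_def complex_div_cnj[of "2 * a * G ?z"] by (simp add: mult.assoc)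
    have Re_eq: "Re (of_real 2 * x / of_real r) = 2 * Re x / r" for x r
      by (simp add: Re_divide_of_real)
    show ?thesis
      unfolding F_eq Re_eq by (intro divide_nonneg_nonneg mult_nonneg_nonneg nonneg zero_le_power2) simp
  qed
  have "full_orbit G \<D> z0 \<subseteq> cayley a ` full_orbit F \<H> (Z z0)"
  proof
    fix w assume w: "w \<in> full_orbit G \<D> z0"
    have "Z w \<in> full_orbit F \<H> (Z z0)"
    proof (rule full_orbit_map[OF w _ _ Z_in])
      fix x :: complex assume x: "x \<in> \<D>"
      show "(Z has_field_derivative 2 * a / (a - x)\<^sup>2) (at x)"
        unfolding Z_def[abs_def] using ne[OF x]
        by (auto intro!: derivative_eq_intros simp: power2_eq_square)
      show "2 * a / (a - x)\<^sup>2 * G x = F (Z x)" by (simp add: F_def CZ[OF x])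
    qed
    moreover have "cayley a (Z w) = w" using full_orbit_subset w by (intro CZ) blast
    ultimately show "w \<in> cayley a ` full_orbit F \<H> (Z z0)" by (metis imageI)
  qed
  then show ?thesis
    using hausdorff_measure_1_mono hausdorff_measure_1_full_orbit_half_plane[OF F nonneg a]
      le_less_trans by blast
qed

section \<open>Denjoy-Wolff point in the disk\<close>

lemma dist_exp_minus_le:
  fixes p p' :: complex
  assumes "X \<le> Re p" "X \<le> Re p'"
  shows "dist (exp (- p)) (exp (- p')) \<le> exp (- X) * dist p p'"
proof -
  have "norm (exp (- p) - exp (- p')) \<le> exp (- X) * norm (p - p')"
  proof (rule field_differentiable_bound[where S = "{z. X \<le> Re z}" and f = "\<lambda>z. exp (- z)"])
    show "convex {z. X \<le> Re z}" by (rule convex_halfspace_Re_ge)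
    show "((\<lambda>z. exp (- z)) has_field_derivative - exp (- z)) (at z within {z. X \<le> Re z})" for z :: complex
      by (auto intro!: derivative_eq_intros)
  qed (use assms in auto)
  then show ?thesis by (simp add: dist_norm)
qed

text \<open>Brings the exponential under the same decay hypothesis as the Cayley map.\<close>

lemma exp_minus_le_inverse_square:
  assumes "0 \<le> (X::real)"
  shows "exp (- X) \<le> 2 / (1 + X)\<^sup>2"
proof -
  have "(1 + X)\<^sup>2 \<le> 2 * (1 + X + X\<^sup>2 / 2)" using assms by (simp add: power2_eq_square algebra_simps)
  also have "\<dots> \<le> 2 * exp X" using exp_lower_Taylor_quadratic[OF assms] by simp
  finally have "(1 + X)\<^sup>2 * exp (- X) \<le> 2 * (exp X * exp (- X))"
    by (simp only: mult.assoc[symmetric] mult_right_mono exp_ge_zero)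
  moreover have "exp X * exp (- X) = 1" by (simp flip: exp_add)
  ultimately show ?thesis using assms by (simp add: pos_le_divide_eq mult.commute)
qed

text \<open>The maximum modulus principle for \<open>exp (\<i> * R z)\<close>, whose modulus is
  \<open>exp (- Im (R z))\<close> and equals 1 at the centre.\<close>

lemma holomorphic_Im_nonpos_on_circle:
  assumes R: "R holomorphic_on \<D>" "R 0 = 0" and r: "0 < r" "r < 1"
  obtains w where "norm w = r" "Im (R w) \<le> 0"
proof -
  let ?f = "\<lambda>z. exp (\<i> * R z)"
  have sub: "cball 0 r \<subseteq> ball (0::complex) 1" using r by auto
  have hol: "?f holomorphic_on \<D>" by (intro holomorphic_intros R)
  have cont: "continuous_on (cball 0 r) ?f"
    by (rule continuous_on_subset[OF holomorphic_on_imp_continuous_on[OF hol] sub])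
  have "continuous_on (sphere 0 r) (\<lambda>z. norm (?f z))"
    by (intro continuous_on_norm continuous_on_subset[OF cont]) auto
  moreover have "complex_of_real r \<in> sphere 0 r" using r by simp
  ultimately obtain w where w: "w \<in> sphere 0 r" "\<And>z. z \<in> sphere 0 r \<Longrightarrow> norm (?f z) \<le> norm (?f w)"
    using continuous_attains_sup[OF compact_sphere, of 0 r "\<lambda>z. norm (?f z)"] by blast
  have "norm (?f 0) \<le> norm (?f w)"
  proof (rule maximum_modulus_frontier[of ?f "cball 0 r"])
    show "?f holomorphic_on interior (cball 0 r)"
      using sub by (intro holomorphic_on_subset[OF hol]) auto
    show "norm (?f z) \<le> norm (?f w)" if "z \<in> frontier (cball 0 r)" for z
      using w(2) that r by simp
  qed (use cont r in auto)
  then have "Im (R w) \<le> 0" using R(2) by simp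
  with w(1) show thesis by (intro that[of w]) auto
qed

lemma exp_minus_arg_shift:
  assumes w: "norm w = exp (- x)"
  obtains t where "y - 2 * pi \<le> t" "t \<le> y" "exp (- Complex x t) = w"
proof -
  have "w \<noteq> 0" using w by auto
  define t0 where "t0 = - Im (Ln w)"
  have "Re (Ln w) = - x" using Re_Ln[OF \<open>w \<noteq> 0\<close>] w by simp
  then have "- Complex x t0 = Ln w" by (simp add: t0_def complex_eq_iff)
  then have e0: "exp (- Complex x t0) = w" using \<open>w \<noteq> 0\<close> by simp
  define m where "m = \<lfloor>(y - t0) / (2 * pi)\<rfloor>"
  define t where "t = t0 + 2 * pi * m"
  have "m \<le> (y - t0) / (2 * pi)" "(y - t0) / (2 * pi) < m + 1" unfolding m_def by linarith+
  then have "m * (2 * pi) \<le> y - t0" "y - t0 < (m + 1) * (2 * pi)"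
    by (simp_all only: pos_le_divide_eq pos_divide_less_eq pi_gt_zero mult_pos_pos zero_less_numeral)
  then have "y - 2 * pi \<le> t" "t \<le> y" by (simp_all add: t_def algebra_simps)
  moreover have "exp (- Complex x t) = w"
  proof -
    have "exp (- Complex x t) = exp (- Complex x t0)"
      unfolding exp_eq by (rule exI[of _ "- m"]) (simp add: t_def complex_eq_iff algebra_simps)
    then show ?thesis using e0 by simp
  qed
  ultimately show thesis by (rule that)
qed

text \<open>On \<open>n \<le> Re p \<le> n + 1\<close> the exponential contracts by
  \<open>exp (- n)\<close>, but the set could still wind around 0 arbitrarily often.
  \<open>range\<close> prevents this: it confines \<open>P\<close> to a strip around a line, the
  lift of a logarithmic spiral, and so each slice to a window of height \<open>2 * M\<close>.
  \<open>f\<close> leaves room for a Moebius map back to the original disk.\<close>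

lemma hausdorff_measure_1_exp_slices:
  fixes f :: "complex \<Rightarrow> complex"
  assumes f: "\<And>x y. x \<in> \<D> \<Longrightarrow> y \<in> \<D> \<Longrightarrow> dist (f x) (f y) \<le> K * dist x y" and K: "0 \<le> K"
    and P: "\<And>p. p \<in> P \<Longrightarrow> 0 < Re p" and range: "\<And>p. p \<in> P \<Longrightarrow> \<bar>Im p - (\<alpha> + \<beta> * Re p)\<bar> \<le> D"
    and steep: "\<And>p p'. p \<in> P \<Longrightarrow> p' \<in> P \<Longrightarrow> \<bar>Re p - Re p'\<bar> \<le> \<bar>Im p - Im p'\<bar>"
  shows "hausdorff_measure_1 ((\<lambda>s. f (exp (- s))) ` P) < \<infinity>"
proof (cases "P = {}")
  case True
  then show ?thesis by simp
next
  case False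
  then have D: "0 \<le> D" using range by fastforce
  define S where "S n = {p \<in> P. real n \<le> Re p \<and> Re p \<le> real n + 1}" for n
  define M where "M = D + \<bar>\<beta>\<bar>"
  have S_le: "hausdorff_measure_1 ((\<lambda>s. f (exp (- s))) ` S n) \<le> ennreal (4 * K * M * exp (- 1) ^ n)" for n
  proof -
    define k where "k = 2 * K * exp (- real n)"
    have k: "0 \<le> k" using K by (simp add: k_def)
    have "hausdorff_measure_1 ((\<lambda>s. f (exp (- s))) ` S n) \<le>
        ennreal (k * (\<alpha> + \<beta> * n + M) - k * (\<alpha> + \<beta> * n - M))"
    proof (rule hausdorff_measure_1_image_le[where L = "\<lambda>p. k * Im p"])
      fix p p' assume p: "p \<in> S n" and p': "p' \<in> S n"
      have pp: "p \<in> P" "p' \<in> P" using p p' by (auto simp: S_def)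
      have "dist p p' \<le> \<bar>Re p - Re p'\<bar> + \<bar>Im p - Im p'\<bar>"
        using cmod_le[of "p - p'"] by (simp add: dist_norm)
      then have d: "dist p p' \<le> 2 * \<bar>Im p - Im p'\<bar>" using steep[OF pp] by simp
      have "dist (f (exp (- p))) (f (exp (- p'))) \<le> K * dist (exp (- p)) (exp (- p'))"
        using P[OF pp(1)] P[OF pp(2)] by (intro f) auto
      also have "\<dots> \<le> K * (exp (- real n) * dist p p')"
        using p p' K by (intro mult_left_mono dist_exp_minus_le) (auto simp: S_def)
      also have "\<dots> \<le> K * (exp (- real n) * (2 * \<bar>Im p - Im p'\<bar>))"
        using d K by (intro mult_left_mono) auto
      also have "\<dots> = \<bar>k * Im p - k * Im p'\<bar>"
        unfolding right_diff_distrib[symmetric] abs_mult abs_of_nonneg[OF k] by (simp add: k_def)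
      finally show "dist (f (exp (- p))) (f (exp (- p'))) \<le> \<bar>k * Im p - k * Im p'\<bar>" .
    next
      fix p assume p: "p \<in> S n"
      have "\<bar>\<beta> * (Re p - n)\<bar> \<le> \<bar>\<beta>\<bar> * 1"
        unfolding abs_mult using p by (intro mult_left_mono) (auto simp: S_def)
      moreover have "\<beta> * Re p = \<beta> * (Re p - n) + \<beta> * n" by (simp add: algebra_simps)
      moreover have "\<bar>Im p - (\<alpha> + \<beta> * Re p)\<bar> \<le> D" using p by (intro range) (simp add: S_def)
      ultimately have "\<bar>Im p - (\<alpha> + \<beta> * n)\<bar> \<le> M" unfolding M_def by linarith
      then have "\<alpha> + \<beta> * n - M \<le> Im p" "Im p \<le> \<alpha> + \<beta> * n + M" by linarith+
      then show "k * (\<alpha> + \<beta> * n - M) \<le> k * Im p \<and> k * Im p \<le> k * (\<alpha> + \<beta> * n + M)"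
        using k by (intro conjI mult_left_mono)
    next
      show "k * (\<alpha> + \<beta> * n - M) \<le> k * (\<alpha> + \<beta> * n + M)"
        using k D by (intro mult_left_mono) (auto simp: M_def)
    qed
    also have "k * (\<alpha> + \<beta> * n + M) - k * (\<alpha> + \<beta> * n - M) = 4 * K * M * exp (- 1) ^ n"
    proof -
      have "exp (- real n) = exp (- 1) ^ n" using exp_of_nat_mult[of n "- 1 :: real"] by simp
      then show ?thesis by (simp add: k_def algebra_simps)
    qed
    finally show ?thesis .
  qed
  have "hausdorff_measure_1 (\<Union>n. (\<lambda>s. f (exp (- s))) ` S n) < \<infinity>"
  proof (rule hausdorff_measure_1_UN_finite[OF S_le])
    show "summable (\<lambda>n. 4 * K * M * exp (- 1 :: real) ^ n)"
      by (intro summable_mult summable_geometric) simp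
    show "0 \<le> 4 * K * M * exp (- 1 :: real) ^ n" for n
      using K D by (simp add: M_def)
  qed
  moreover have "(\<lambda>s. f (exp (- s))) ` P \<subseteq> (\<Union>n. (\<lambda>s. f (exp (- s))) ` S n)"
  proof clarify
    fix p assume p: "p \<in> P"
    have "p \<in> S (nat \<lfloor>Re p\<rfloor>)" using p P[OF p] by (auto simp: S_def)
    then show "f (exp (- p)) \<in> (\<Union>n. (\<lambda>s. f (exp (- s))) ` S n)" by blast
  qed
  ultimately show ?thesis using hausdorff_measure_1_mono le_less_trans by blast
qed

text \<open>
  For a flow \<open>w' = - w / q w\<close> on the disk, lifted by \<open>w = exp(-s)\<close>. The Koenigs function is
  \<open>w exp(R w / q 0)\<close>, and \<open>- h / q 0\<close> is the logarithm of its lift.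
\<close>

locale elliptic_lift =
  fixes q R :: "complex \<Rightarrow> complex"
  assumes hol_q: "q holomorphic_on \<D>" and pos_q: "\<And>w. w \<in> \<D> \<Longrightarrow> 0 < Re (q w)"
    and R: "\<And>w. w \<in> \<D> \<Longrightarrow> \<exists>R'. (R has_field_derivative R') (at w) \<and> w * R' = q w - q 0"
    and R0: "R 0 = 0"
begin

definition h :: "complex \<Rightarrow> complex"
  where "h s = q 0 * s - R (exp (- s))"

lemma half_plane_primitive_h: "half_plane_primitive (\<lambda>s. q (exp (- s))) h"
proof
  have in_disk: "exp (- s) \<in> \<D>" if "s \<in> \<H>" for s using that by simp
  then show "0 < Re (q (exp (- s)))" if "s \<in> \<H>" for s using that by (intro pos_q)
  have "(q \<circ> (\<lambda>s. exp (- s))) holomorphic_on \<H>"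
    using in_disk by (intro holomorphic_on_compose_gen[OF _ hol_q] holomorphic_intros) auto
  then show "(\<lambda>s. q (exp (- s))) holomorphic_on \<H>" by (simp add: o_def)
  fix s assume s: "s \<in> \<H>"
  obtain R' where R': "(R has_field_derivative R') (at (exp (- s)))" "exp (- s) * R' = q (exp (- s)) - q 0"
    using R[OF in_disk[OF s]] by blast
  have "((\<lambda>s. exp (- s)) has_field_derivative - exp (- s)) (at s)"
    by (auto intro!: derivative_eq_intros)
  from DERIV_chain2[OF R'(1) this]
  have "(h has_field_derivative q 0 - R' * - exp (- s)) (at s)"
    unfolding h_def by (auto intro!: derivative_eq_intros)
  then show "(h has_field_derivative q (exp (- s))) (at s)"
    using R'(2) by (simp add: mult.commute)
qed

sublocale half_plane_primitive "\<lambda>s. q (exp (- s))" h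
  by (rule half_plane_primitive_h)

lemma holomorphic_R: "R holomorphic_on \<D>"
  unfolding holomorphic_on_open[OF open_ball] using R by blast

text \<open>\<open>Im R\<close> takes both signs on every circle, and its angular derivative is bounded on one side.\<close>

lemma Im_R_bound:
  assumes "0 < Re s"
  shows "\<bar>Im (R (exp (- s)))\<bar> \<le> 2 * pi * Re (q 0)"
proof -
  define x y where "x = Re s" and "y = Im s"
  have x: "0 < x" using assms by (simp add: x_def)
  define g where "g t = Im (R (exp (- Complex x t)))" for t
  \<comment> \<open>By monotonicity of \<open>Im h\<close>, \<open>g\<close> rises with slope at
    most \<open>Re (q 0)\<close>; within one turn it cannot rise far from a point where it is
    nonpositive.\<close>
  have mono: "Re (q 0) * a - g a \<le> Re (q 0) * b - g b" if "a \<le> b" for a b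
    using Im_h_mono[OF x that] by (simp add: h_def g_def)
  have q0: "0 < Re (q 0)" by (intro pos_q) simp
  obtain w where w: "norm w = exp (- x)" "Im (R w) \<le> 0"
    using holomorphic_Im_nonpos_on_circle[OF holomorphic_R R0, of "exp (- x)"] x by auto
  obtain t where t: "y - 2 * pi \<le> t" "t \<le> y" "exp (- Complex x t) = w"
    using exp_minus_arg_shift[OF w(1)] by blast
  have "g y \<le> Re (q 0) * (y - t)"
    using mono[OF t(2)] w(2) t(3) by (simp add: g_def algebra_simps)
  also have "\<dots> \<le> Re (q 0) * (2 * pi)" using t q0 by (intro mult_left_mono) auto
  finally have upper: "g y \<le> 2 * pi * Re (q 0)" by (simp add: mult_ac)
  \<comment> \<open>The lower bound follows in the same way from a point at most one turn above
    \<open>y\<close> where \<open>Im R\<close> is nonnegative.\<close>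
  obtain v where v: "norm v = exp (- x)" "Im (- R v) \<le> 0"
    using holomorphic_Im_nonpos_on_circle[of "\<lambda>z. - R z" "exp (- x)"] holomorphic_R R0 x
    by (auto intro: holomorphic_on_minus)
  obtain u where u: "(y + 2 * pi) - 2 * pi \<le> u" "u \<le> y + 2 * pi" "exp (- Complex x u) = v"
    using exp_minus_arg_shift[OF v(1)] by blast
  have "y \<le> u" using u(1) by simp
  from mono[OF this] have "- g y \<le> Re (q 0) * (u - y)"
    using v(2) u(3) by (simp add: g_def algebra_simps)
  also have "\<dots> \<le> Re (q 0) * (2 * pi)" using u q0 by (intro mult_left_mono) auto
  finally have "- g y \<le> 2 * pi * Re (q 0)" by (simp add: mult_ac)
  with upper show ?thesis by (simp add: g_def x_def y_def abs_le_iff)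
qed

lemma hausdorff_measure_1_exp_level_set:
  fixes f :: "complex \<Rightarrow> complex"
  assumes f: "\<And>x y. x \<in> \<D> \<Longrightarrow> y \<in> \<D> \<Longrightarrow> dist (f x) (f y) \<le> K * dist x y" and K: "0 \<le> K"
  shows "hausdorff_measure_1 ((\<lambda>s. f (exp (- s))) ` {p \<in> \<H>. Im (h p) = c}) < \<infinity>"
proof (rule hausdorff_measure_1_level_set[where C = "\<lambda>s. f (exp (- s))" and K = "2 * K" and c = c,
      OF half_plane_primitive_h])
  fix p p' :: complex and X :: real assume X: "0 < X" "X \<le> Re p" "X \<le> Re p'"
  have "dist (f (exp (- p))) (f (exp (- p'))) \<le> K * dist (exp (- p)) (exp (- p'))"
    using X by (intro f) auto
  also have "\<dots> \<le> K * (exp (- X) * dist p p')"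
    using X K by (intro mult_left_mono dist_exp_minus_le)
  also have "\<dots> \<le> K * (2 / (1 + X)\<^sup>2 * dist p p')"
    using X K by (intro mult_left_mono mult_right_mono exp_minus_le_inverse_square) auto
  finally show "dist (f (exp (- p))) (f (exp (- p'))) \<le> 2 * K / (1 + X)\<^sup>2 * dist p p'"
    by (simp add: mult_ac)
next
  fix P assume P: "\<And>p. p \<in> P \<Longrightarrow> p \<in> \<H> \<and> Im (h p) = c"
    and steep: "\<And>p p'. p \<in> P \<Longrightarrow> p' \<in> P \<Longrightarrow> \<bar>Re p - Re p'\<bar> \<le> \<bar>Im p - Im p'\<bar>"
  have q0: "0 < Re (q 0)" by (intro pos_q) simp
  show "hausdorff_measure_1 ((\<lambda>s. f (exp (- s))) ` P) < \<infinity>"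
  proof (rule hausdorff_measure_1_exp_slices[OF f K _ _ steep])
    fix p assume p: "p \<in> P"
    then show pos: "0 < Re p" using P by simp
    \<comment> \<open>The equation of the level set, solved for \<open>Im p\<close>, is that of a
      line of slope \<open>- Im (q 0) / Re (q 0)\<close> up to the error
      \<open>Im R / Re (q 0)\<close>, which \<open>Im_R_bound\<close> keeps below
      \<open>2 * pi\<close>.\<close>
    have "Re (q 0) * Im p + Im (q 0) * Re p - Im (R (exp (- p))) = c"
      using P[OF p] by (simp add: h_def algebra_simps)
    then have "Re (q 0) * Im p - (c - Im (q 0) * Re p) = Im (R (exp (- p)))" by linarith
    moreover have "Re (q 0) * (Im p - (c / Re (q 0) + (- Im (q 0) / Re (q 0)) * Re p)) =
        Re (q 0) * Im p - (c - Im (q 0) * Re p)"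
      using q0 by (simp add: divide_simps)
    ultimately have eq: "Re (q 0) * (Im p - (c / Re (q 0) + (- Im (q 0) / Re (q 0)) * Re p)) = Im (R (exp (- p)))"
      by (rule trans[rotated])
    have "Re (q 0) * \<bar>Im p - (c / Re (q 0) + (- Im (q 0) / Re (q 0)) * Re p)\<bar> = \<bar>Im (R (exp (- p)))\<bar>"
      unfolding eq[symmetric] abs_mult abs_of_pos[OF q0] ..
    also have "\<dots> \<le> Re (q 0) * (2 * pi)"
      using Im_R_bound[OF pos] by (simp only: mult.commute[of "2 * pi"])
    finally have "Re (q 0) * \<bar>Im p - (c / Re (q 0) + (- Im (q 0) / Re (q 0)) * Re p)\<bar> \<le> Re (q 0) * (2 * pi)" .
    then show "\<bar>Im p - (c / Re (q 0) + (- Im (q 0) / Re (q 0)) * Re p)\<bar> \<le> 2 * pi"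
      using q0 by (simp only: mult_le_cancel_left_pos)
  qed
qed (use K in simp)

end

lemma full_orbit_exponential:
  assumes "w \<in> full_orbit (\<lambda>x. \<mu> * x) UNIV z"
  obtains t where "w = exp (\<mu> * of_real t) * z"
proof -
  have "\<exists>t. w = exp (\<mu> * of_real t) * z"
  proof (cases "trajectory (\<lambda>x. \<mu> * x) UNIV z w")
    case True
    then show ?thesis by (rule trajectory_exponential)
  next
    case False
    then have "trajectory (\<lambda>x. \<mu> * x) UNIV w z" using assms by (simp add: full_orbit_def)
    then obtain t where "z = exp (\<mu> * of_real t) * w" using trajectory_exponential by blast
    then have "exp (\<mu> * of_real (- t)) * z = w"
      by (simp add: mult.assoc[symmetric] exp_minus)
    then show ?thesis by metis
  qed
  then show thesis using that by blast
qed

lemma hausdorff_measure_1_circle: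
  fixes f :: "complex \<Rightarrow> complex"
  assumes f: "\<And>x y. x \<in> \<D> \<Longrightarrow> y \<in> \<D> \<Longrightarrow> dist (f x) (f y) \<le> K * dist x y" and K: "0 \<le> K"
    and r: "0 \<le> r" "r < 1"
  shows "hausdorff_measure_1 (f ` {w. norm w = r}) < \<infinity>"
proof -
  define c where "c t = of_real r * exp (\<i> * of_real t)" for t
  have norm_c: "norm (c t) = r" for t using r by (simp add: c_def norm_mult)
  have le: "hausdorff_measure_1 ((\<lambda>t. f (c t)) ` {-pi..pi}) \<le> ennreal (K * pi - K * (- pi))"
  proof (rule hausdorff_measure_1_image_le[where L = "\<lambda>t. K * t"])
    fix t u assume "t \<in> {-pi..pi}" "u \<in> {-pi..pi}"
    have "dist (f (c t)) (f (c u)) \<le> K * dist (c t) (c u)"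
      using norm_c r by (intro f) auto
    also have "dist (c t) (c u) = r * dist (exp (\<i> * of_real t)) (exp (\<i> * of_real u))"
      unfolding c_def dist_norm right_diff_distrib[symmetric] norm_mult using r by simp
    also have "\<dots> \<le> 1 * \<bar>t - u\<bar>"
    proof (rule mult_mono)
      have "\<i> * of_real t - \<i> * of_real u = \<i> * of_real (t - u)" by (simp add: algebra_simps)
      then have "dist (- (\<i> * of_real t)) (- (\<i> * of_real u)) = norm (\<i> * of_real (t - u))"
        by (metis dist_minus dist_norm)
      also have "\<dots> = \<bar>t - u\<bar>" by (simp only: norm_mult norm_of_real norm_ii mult_1)
      finally have "dist (- (\<i> * of_real t)) (- (\<i> * of_real u)) = \<bar>t - u\<bar>" .
      then show "dist (exp (\<i> * of_real t)) (exp (\<i> * of_real u)) \<le> \<bar>t - u\<bar>"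
        using dist_exp_minus_le[of 0 "- (\<i> * of_real t)" "- (\<i> * of_real u)"] by simp
    qed (use r in auto)
    finally show "dist (f (c t)) (f (c u)) \<le> \<bar>K * t - K * u\<bar>"
      unfolding right_diff_distrib[symmetric] abs_mult abs_of_nonneg[OF K]
      using K by (simp add: mult_left_mono)
  next
    fix t assume "t \<in> {-pi..pi}"
    then show "K * (- pi) \<le> K * t \<and> K * t \<le> K * pi" using K by (intro conjI mult_left_mono) auto
  qed (use K in \<open>intro mult_left_mono, auto\<close>)
  have sub: "f ` {w. norm w = r} \<subseteq> (\<lambda>t. f (c t)) ` {-pi..pi}"
  proof clarify
    fix w :: complex assume "r = norm w"
    then have "w = c (Arg w)" using Arg_eq[of w] by (cases "w = 0") (auto simp: c_def)
    moreover have "Arg w \<in> {-pi..pi}" using Arg_bounded[of w] by auto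
    ultimately show "f w \<in> (\<lambda>t. f (c t)) ` {-pi..pi}" by (metis imageI)
  qed
  show ?thesis
    using order_trans[OF hausdorff_measure_1_mono[OF sub] le] by (rule le_less_trans) simp
qed

text \<open>A nonzero \<open>G 0\<close> would point outwards at points near 0 on the ray in its own
  direction, against \<open>BP\<close>.\<close>

lemma inward_field_vanishes:
  assumes G: "G holomorphic_on \<D>" and BP: "\<And>w. w \<in> \<D> \<Longrightarrow> Re (G w * cnj w) \<le> 0"
  shows "G 0 = 0"
proof (rule ccontr)
  assume nz: "G 0 \<noteq> 0"
  define u where "u = sgn (G 0)"
  have u: "norm u = 1" using nz by (simp add: u_def norm_sgn)
  have "isCont G 0"
    using holomorphic_on_imp_continuous_on[OF G] by (simp add: continuous_on_eq_continuous_at)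
  moreover have "((\<lambda>r. of_real r * u) \<longlongrightarrow> 0) (at_right 0)"
    by (auto intro!: tendsto_eq_intros)
  ultimately have "((\<lambda>r. G (of_real r * u)) \<longlongrightarrow> G 0) (at_right 0)"
    by (rule isCont_tendsto_compose)
  then have lim: "((\<lambda>r. Re (G (of_real r * u) * cnj u)) \<longlongrightarrow> Re (G 0 * cnj u)) (at_right 0)"
    by (intro tendsto_intros)
  moreover have "\<forall>\<^sub>F r in at_right 0. Re (G (of_real r * u) * cnj u) \<le> 0"
    unfolding eventually_at_right_field
  proof (intro exI[of _ 1] conjI allI impI)
    fix r :: real assume r: "0 < r" "r < 1"
    then have "Re (G (of_real r * u) * cnj (of_real r * u)) \<le> 0"
      using u by (intro BP) (simp add: norm_mult)
    also have "G (of_real r * u) * cnj (of_real r * u) = of_real r * (G (of_real r * u) * cnj u)"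
      by simp
    also have "Re (of_real r * x) = r * Re x" for x by simp
    finally have "r * Re (G (of_real r * u) * cnj u) \<le> 0" .
    then show "Re (G (of_real r * u) * cnj u) \<le> 0" using r by (simp add: mult_le_0_iff)
  qed simp
  ultimately have "Re (G 0 * cnj u) \<le> 0"
    by (intro tendsto_upperbound) auto
  moreover have "G 0 * cnj u = of_real (norm (G 0))"
    using nz complex_norm_square[of "G 0"]
    by (simp add: u_def sgn_div_norm scaleR_conv_of_real field_simps power2_eq_square)
  ultimately show False using nz by simp
qed

text \<open>\<open>G w = - (w * P w)\<close> with \<open>Re P \<ge> 0\<close>. An imaginary constant
  \<open>P\<close> gives rotations; otherwise \<open>1 / P\<close> feeds
  \<open>elliptic_lift\<close>. Instead of lifting trajectories continuously through the logarithm,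
  the proof chooses a branch separately at each point, using the Koenigs function.\<close>

lemma hausdorff_measure_1_full_orbit_center:
  fixes f :: "complex \<Rightarrow> complex"
  assumes G: "G holomorphic_on \<D>" and BP: "\<And>w. w \<in> \<D> \<Longrightarrow> Re (G w * cnj w) \<le> 0"
    and z: "z \<in> \<D>"
    and f: "\<And>x y. x \<in> \<D> \<Longrightarrow> y \<in> \<D> \<Longrightarrow> dist (f x) (f y) \<le> K * dist x y" and K: "0 \<le> K"
  shows "hausdorff_measure_1 (f ` full_orbit G \<D> z) < \<infinity>"
proof -
  have G0: "G 0 = 0" by (rule inward_field_vanishes[OF G BP])
  define P where "P w = - (if w = 0 then deriv G 0 else (G w - G 0) / (w - 0))" for w
  have hol_P: "P holomorphic_on \<D>"
    unfolding P_def by (intro holomorphic_on_minus pole_lemma[OF G]) simp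
  have GP: "G w = - (w * P w)" for w by (simp add: P_def G0)
  have P_nonneg': "0 \<le> Re (P w)" if w: "w \<in> \<D>" "w \<noteq> 0" for w
  proof -
    have "G w * cnj w = - (P w * of_real ((norm w)\<^sup>2))"
      unfolding GP complex_norm_square by simp
    then have "Re (P w) * (norm w)\<^sup>2 \<ge> 0" using BP[OF w(1)] by simp
    then show ?thesis using w(2) by (simp add: zero_le_mult_iff)
  qed
  have "isCont P 0"
    using holomorphic_on_imp_continuous_on[OF hol_P] by (simp add: continuous_on_eq_continuous_at)
  then have "((\<lambda>w. Re (P w)) \<longlongrightarrow> Re (P 0)) (at 0)"
    by (intro tendsto_intros) (simp add: isCont_def)
  moreover have "\<forall>\<^sub>F w in at 0. 0 \<le> Re (P w)"
    unfolding eventually_at using P_nonneg' by (intro exI[of _ 1]) auto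
  ultimately have "0 \<le> Re (P 0)" by (rule tendsto_lowerbound) simp
  with P_nonneg' have P_nonneg: "0 \<le> Re (P w)" if "w \<in> \<D>" for w
    using that by (cases "w = 0") auto
  consider "\<And>w. w \<in> \<D> \<Longrightarrow> 0 < Re (P w)" | c where "Re c = 0" "\<And>w. w \<in> \<D> \<Longrightarrow> P w = c"
    using nonneg_real_part_cases[OF hol_P open_ball connected_ball P_nonneg] by blast
  then show ?thesis
  proof cases
    case (2 c)
    have "full_orbit G \<D> z \<subseteq> {w. norm w = norm z}"
    proof clarify
      fix w assume "w \<in> full_orbit G \<D> z"
      then have "w \<in> full_orbit (\<lambda>x. - c * x) UNIV z"
        by (rule full_orbit_map[where Z = "\<lambda>x. x" and Z' = "\<lambda>_. 1"]) (auto simp: GP 2(2))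
      then obtain t where "w = exp (- c * of_real t) * z" by (rule full_orbit_exponential)
      then show "norm w = norm z" using 2(1) by (simp add: norm_mult)
    qed
    moreover have "hausdorff_measure_1 (f ` {w. norm w = norm z}) < \<infinity>"
      using z by (intro hausdorff_measure_1_circle[OF f K]) auto
    ultimately show ?thesis by (meson hausdorff_measure_1_mono image_mono le_less_trans)
  next
    case 1
    define q where "q w = 1 / P w" for w
    have nzP: "P w \<noteq> 0" if "w \<in> \<D>" for w using 1[OF that] by auto
    have hol_q: "q holomorphic_on \<D>"
      unfolding q_def using nzP by (intro holomorphic_on_divide holomorphic_on_const hol_P)
    have pos_q: "0 < Re (q w)" if "w \<in> \<D>" for w
      using 1[OF that] nzP[OF that] unfolding q_def
      by (simp add: Re_divide zero_less_divide_iff sum_power2_gt_zero_iff complex_eq_iff)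
    define Q where "Q = (\<lambda>w. if w = 0 then deriv q 0 else (q w - q 0) / (w - 0))"
    have Q: "w * Q w = q w - q 0" for w by (simp add: Q_def)
    have "Q holomorphic_on \<D>"
      unfolding Q_def by (rule pole_lemma[OF hol_q]) simp
    then obtain R0 where R0: "\<And>w. w \<in> \<D> \<Longrightarrow> (R0 has_field_derivative Q w) (at w)"
      using holomorphic_convex_primitive'[OF convex_ball open_ball] at_within_open[OF _ open_ball] by metis
    define R where "R w = R0 w - R0 0" for w
    have deriv_R: "(R has_field_derivative Q w) (at w)" if "w \<in> \<D>" for w
      unfolding R_def using R0[OF that] by (auto intro!: derivative_eq_intros)
    interpret elliptic_lift q R
      by unfold_locales (use hol_q pos_q deriv_R Q in \<open>auto simp: R_def\<close>)
    define l where "l = P 0"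
    have lq: "l * q 0 = 1" using nzP[of 0] by (simp add: l_def q_def)
    \<comment> \<open>The Koenigs function: it carries \<open>G\<close> to the linear field
      \<open>- l * x\<close>, whose orbits are explicit.\<close>
    define k where "k w = w * exp (l * R w)" for w
    have k_orbit: "\<exists>t. k w = exp (- l * of_real t) * k z" if w: "w \<in> full_orbit G \<D> z" for w
    proof -
      have "k w \<in> full_orbit (\<lambda>x. - l * x) UNIV (k z)"
      proof (rule full_orbit_map[OF w])
        fix x :: complex assume x: "x \<in> \<D>"
        have "(k has_field_derivative exp (l * R x) + x * (exp (l * R x) * (l * Q x))) (at x)"
          unfolding k_def using deriv_R[OF x] by (auto intro!: derivative_eq_intros)
        moreover have "exp (l * R x) + x * (exp (l * R x) * (l * Q x)) = exp (l * R x) * (1 + l * (x * Q x))"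
          by (simp add: algebra_simps)
        moreover have "1 + l * (x * Q x) = l * q x" unfolding Q using lq by (simp add: algebra_simps)
        ultimately show "(k has_field_derivative exp (l * R x) * (l * q x)) (at x)" by simp
        have "q x * P x = 1" using nzP[OF x] by (simp add: q_def)
        then have "exp (l * R x) * (l * q x) * G x = - l * (x * exp (l * R x)) * 1"
          unfolding GP by (metis (no_types, opaque_lifting) mult.assoc mult.commute mult_minus_left mult_minus_right)
        then show "exp (l * R x) * (l * q x) * G x = - l * k x" by (simp add: k_def)
      qed simp
      then show ?thesis using full_orbit_exponential by blast
    qed
    show ?thesis
    proof (cases "z = 0")
      \<comment> \<open>The fixed point has no logarithm; since \<open>k\<close> vanishes only at 0,
        its orbit is a single point, the circle of radius 0.\<close>
      case True
      have "full_orbit G \<D> z \<subseteq> {w. norm w = 0}"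
        using k_orbit True by (force simp: k_def)
      moreover have "hausdorff_measure_1 (f ` {w. norm w = 0}) < \<infinity>"
        by (intro hausdorff_measure_1_circle[OF f K]) auto
      ultimately show ?thesis by (meson hausdorff_measure_1_mono image_mono le_less_trans)
    next
      case False
      have lift: "- Ln w \<in> \<H>" "exp (- (- Ln w)) = w" if "w \<in> \<D>" "w \<noteq> 0" for w
        using that by (auto simp: ln_less_zero_iff)
      have exp_h: "exp (- l * h s) = k (exp (- s))" for s
      proof -
        have "- l * h s = - s * (l * q 0) + l * R (exp (- s))" by (simp add: h_def algebra_simps)
        also have "\<dots> = - s + l * R (exp (- s))" by (simp only: lq mult_1_right)
        finally show ?thesis by (simp only: exp_add k_def)
      qed
      define s0 where "s0 = - Ln z"
      have "f ` full_orbit G \<D> z \<subseteq> (\<lambda>s. f (exp (- s))) ` {p \<in> \<H>. Im (h p) = Im (h s0)}"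
      proof clarify
        fix w assume w: "w \<in> full_orbit G \<D> z"
        then have wD: "w \<in> \<D>" using full_orbit_subset by blast
        obtain t where t: "k w = exp (- l * of_real t) * k z" using k_orbit[OF w] by blast
        then have "w \<noteq> 0" using False by (auto simp: k_def)
        define s1 where "s1 = - Ln w"
        have "exp (- l * h s1) = exp (- l * of_real t + - l * h s0)"
          unfolding exp_add exp_h using t lift(2)[OF wD \<open>w \<noteq> 0\<close>] lift(2)[OF z False]
          by (simp add: s0_def s1_def)
        then obtain n :: int where n: "- l * h s1 = - l * of_real t + - l * h s0 + (of_int (2 * n) * pi) * \<i>"
          unfolding exp_eq by blast
        \<comment> \<open>The exponential determines \<open>- l * h s1\<close> only up to this
          multiple of the period. Passing to \<open>s1 + d\<close> keeps the point of the disk and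
          adds \<open>q 0 * d\<close> to \<open>h\<close>; as \<open>l * q 0 = 1\<close>, this
          cancels the ambiguity exactly, and \<open>h s2 - h s0\<close> is the real number
          \<open>t\<close>.\<close>
        define d where "d = (of_int (2 * n) * pi) * \<i>"
        define s2 where "s2 = s1 + d"
        have "exp (- s2) = exp (- s1)"
          unfolding exp_eq s2_def d_def by (rule exI[of _ "- n"]) (simp add: algebra_simps)
        then have w2: "exp (- s2) = w" using lift(2)[OF wD \<open>w \<noteq> 0\<close>] by (simp add: s1_def)
        have "h s2 = h s1 + q 0 * d"
          using \<open>exp (- s2) = exp (- s1)\<close> by (simp add: h_def s2_def algebra_simps)
        also have "\<dots> = h s0 + of_real t"
        proof -
          have "q 0 * (- l * h s1) = q 0 * (- l * of_real t + - l * h s0 + d)"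
            using n by (simp add: d_def)
          then have "- (l * q 0) * h s1 = - (l * q 0) * of_real t - (l * q 0) * h s0 + q 0 * d"
            by (simp add: algebra_simps)
          then show ?thesis by (simp add: lq algebra_simps)
        qed
        finally have "Im (h s2) = Im (h s0)" by simp
        moreover have "s2 \<in> \<H>"
          using lift(1)[OF wD \<open>w \<noteq> 0\<close>] by (simp add: s2_def s1_def d_def)
        ultimately show "f w \<in> (\<lambda>s. f (exp (- s))) ` {p \<in> \<H>. Im (h p) = Im (h s0)}"
          using w2 by (intro image_eqI[of _ _ s2]) auto
      qed
      then show ?thesis
        using hausdorff_measure_1_exp_level_set[OF f K] hausdorff_measure_1_mono le_less_trans by blast
    qed
  qed
qed

text \<open>A disk automorphism moves \<open>a\<close> to 0. Its inverse is Lipschitz on the whole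
  disk because \<open>norm a < 1\<close>, so finite length is carried back.\<close>

lemma hausdorff_measure_1_full_orbit_interior:
  assumes G: "G holomorphic_on \<D>" and a: "norm a < 1"
    and BP: "\<And>z. z \<in> \<D> \<Longrightarrow> 0 \<le> Re (G z * cnj ((1 - cnj a * z) * (a - z)))"
    and z0: "z0 \<in> \<D>"
  shows "hausdorff_measure_1 (full_orbit G \<D> z0) < \<infinity>"
proof -
  define W where "W = Moebius_function 0 a"
  define V where "V = Moebius_function 0 (- a)"
  have W_eq: "W z = (z - a) / (1 - cnj a * z)" and V_eq: "V z = (z + a) / (1 + cnj a * z)" for z
    by (simp_all add: W_def V_def Moebius_function_simple)
  have W_in: "W ` \<D> \<subseteq> \<D>" and V_in: "V ` \<D> \<subseteq> \<D>"
    using a Moebius_function_norm_lt_1[of a] Moebius_function_norm_lt_1[of "- a"] by (auto simp: W_def V_def)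
  have VW: "V (W z) = z" and WV: "W (V z) = z" if "z \<in> \<D>" for z
    unfolding V_def W_def using a that by (auto intro!: Moebius_function_compose)
  define \<kappa> where "\<kappa> = 1 - (norm a)\<^sup>2"
  have \<kappa>: "0 < \<kappa>" "\<kappa> \<le> 1" using a by (auto simp: \<kappa>_def power_less_one_iff)
  have aa: "of_real \<kappa> = 1 - a * cnj a" by (simp add: \<kappa>_def complex_norm_square del: of_real_power)
  have ge: "1 - norm a \<le> norm (1 + cnj a * z)" if "z \<in> \<D>" for z
  proof -
    have "norm a * norm z \<le> norm a * 1" using that by (intro mult_left_mono) auto
    then show ?thesis using norm_triangle_ineq2[of 1 "- (cnj a * z)"] by (simp add: norm_mult)
  qed
  have ne: "1 + cnj a * z \<noteq> 0" "1 - cnj a * z \<noteq> 0" if "z \<in> \<D>" for z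
    using ge[OF that] ge[of "- z"] that a by auto
  \<comment> \<open>The push-forward of \<open>G\<close> under \<open>W\<close>, with the derivative
    of \<open>W\<close> rewritten in the variable \<open>w = W z\<close> by means of 1 / (1 - cnj a
    z) = (1 + cnj a w) / \<kappa>.\<close>
  define H where "H w = G (V w) * (1 + cnj a * w)\<^sup>2 / of_real \<kappa>" for w
  have V_hol: "V holomorphic_on \<D>"
    unfolding V_def using a by (intro Moebius_function_holomorphic) simp
  have "(G \<circ> V) holomorphic_on \<D>"
    using V_in by (rule holomorphic_on_compose_gen[OF V_hol G])
  then have GV: "(\<lambda>w. G (V w)) holomorphic_on \<D>" by (simp only: o_def)
  have H: "H holomorphic_on \<D>"
    unfolding H_def using \<kappa> by (intro holomorphic_intros GV) auto
  have HW: "H (W z) = of_real \<kappa> / (1 - cnj a * z)\<^sup>2 * G z" if z: "z \<in> \<D>" for z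
  proof -
    have "1 + cnj a * W z = of_real \<kappa> / (1 - cnj a * z)"
      unfolding W_eq aa using ne[OF z] by (simp add: divide_simps) (simp add: algebra_simps)
    then show ?thesis
      unfolding H_def VW[OF z] using \<kappa> by (simp add: power_divide power2_eq_square)
  qed
  have H_BP: "Re (H w * cnj w) \<le> 0" if w: "w \<in> \<D>" for w
  proof -
    define z where "z = V w"
    have z: "z \<in> \<D>" using V_in w by (simp add: z_def image_subset_iff)
    have wz: "w = W z" by (simp add: z_def WV[OF w])
    define D where "D = 1 - cnj a * z"
    have D: "D \<noteq> 0" using ne[OF z] by (simp add: D_def)
    have "H w * cnj w = of_real \<kappa> / D\<^sup>2 * G z * (cnj (z - a) / cnj D)"
      unfolding wz HW[OF z] unfolding W_eq D_def by simp
    also have "\<dots> = of_real \<kappa> * (- (G z * cnj (D * (a - z)))) / (D * cnj D)\<^sup>2"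
      using D by (simp add: power2_eq_square field_simps)
    also have "(D * cnj D)\<^sup>2 = of_real (((norm D)\<^sup>2)\<^sup>2)"
      unfolding complex_norm_square[symmetric] by simp
    finally have eq: "H w * cnj w = of_real \<kappa> * (- (G z * cnj (D * (a - z)))) / of_real (((norm D)\<^sup>2)\<^sup>2)" .
    have Re_eq: "Re (of_real u * (- x) / of_real v) = - (u * Re x / v)" for u v x
      by (simp add: Re_divide_of_real)
    have "0 \<le> Re (G z * cnj (D * (a - z)))" using BP[OF z] by (simp only: D_def)
    then have "0 \<le> \<kappa> * Re (G z * cnj (D * (a - z))) / ((norm D)\<^sup>2)\<^sup>2"
      using \<kappa> by (intro divide_nonneg_nonneg mult_nonneg_nonneg) auto
    then show ?thesis unfolding eq Re_eq by linarith
  qed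
  have V_lip: "dist (V x) (V y) \<le> 1 / (1 - norm a)\<^sup>2 * dist x y" if x: "x \<in> \<D>" and y: "y \<in> \<D>" for x y
  proof -
    have "V x - V y = of_real \<kappa> * (x - y) / ((1 + cnj a * x) * (1 + cnj a * y))"
      unfolding V_eq aa using ne[OF x] ne[OF y] by (simp add: divide_simps) (simp add: algebra_simps)
    then have "dist (V x) (V y) = \<kappa> * dist x y / (norm (1 + cnj a * x) * norm (1 + cnj a * y))"
      using \<kappa> by (simp only: dist_norm norm_mult norm_divide norm_of_real abs_of_pos)
    also have "\<dots> \<le> 1 * dist x y / ((1 - norm a) * (1 - norm a))"
      using \<kappa> a ge[OF x] ge[OF y] by (intro frac_le mult_mono mult_pos_pos) auto
    finally show ?thesis by (simp add: power2_eq_square)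
  qed
  have "full_orbit G \<D> z0 \<subseteq> V ` full_orbit H \<D> (W z0)"
  proof
    fix w assume w: "w \<in> full_orbit G \<D> z0"
    have "W w \<in> full_orbit H \<D> (W z0)"
    proof (rule full_orbit_map[OF w _ _ W_in])
      fix x :: complex assume x: "x \<in> \<D>"
      show "(W has_field_derivative of_real \<kappa> / (1 - cnj a * x)\<^sup>2) (at x)"
        unfolding W_eq[abs_def] aa using ne[OF x]
        by (auto intro!: derivative_eq_intros simp: power2_eq_square divide_simps) (simp add: algebra_simps)
      show "of_real \<kappa> / (1 - cnj a * x)\<^sup>2 * G x = H (W x)" by (rule HW[OF x, symmetric])
    qed
    moreover have "V (W w) = w" using full_orbit_subset w by (intro VW) blast
    ultimately show "w \<in> V ` full_orbit H \<D> (W z0)" by (metis imageI)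
  qed
  moreover have "hausdorff_measure_1 (V ` full_orbit H \<D> (W z0)) < \<infinity>"
    by (rule hausdorff_measure_1_full_orbit_center[OF H H_BP _ V_lip])
      (use W_in z0 a in \<open>auto simp: image_subset_iff\<close>)
  ultimately show ?thesis using hausdorff_measure_1_mono le_less_trans by blast
qed

section \<open>The orbits of the semigroup\<close>

context disk_semigroup
begin

lemma trajectory_semigroup:
  assumes "z \<in> \<D>" "0 \<le> t"
  shows "trajectory generator \<D> z (\<phi> t z)"
  unfolding trajectory_def
  using assms flow[OF assms(1)] in_disk zero by (intro exI[of _ t] conjI exI[of _ "\<lambda>t. \<phi> t z"]) auto

lemma hausdorff_measure_1_full_orbit_generator:
  assumes "z \<in> \<D>"
  shows "hausdorff_measure_1 (full_orbit generator \<D> z) < \<infinity>"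
proof -
  obtain a where a: "norm a \<le> 1"
    and BP: "\<And>z. z \<in> \<D> \<Longrightarrow> 0 \<le> Re (generator z * cnj ((1 - cnj a * z) * (a - z)))"
    by (rule Berkson_Porta) blast
  show ?thesis
  proof (cases "norm a = 1")
    case True
    show ?thesis by (rule hausdorff_measure_1_full_orbit_boundary[OF holomorphic_generator True BP])
  next
    case False
    with a have "norm a < 1" by simp
    then show ?thesis
      by (rule hausdorff_measure_1_full_orbit_interior[OF holomorphic_generator _ BP assms])
  qed
qed

lemma forward_orbit_subset:
  assumes "z \<in> \<D>"
  shows "forward_orbit \<phi> z ` {0..} \<subseteq> full_orbit generator \<D> z"
  using trajectory_semigroup[OF assms] by (auto simp: forward_orbit_def full_orbit_def)

text \<open>A point \<open>w\<close> of the backward orbit satisfies \<open>\<phi> t w = z\<close>,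
  so its forward trajectory ends at \<open>z\<close>.\<close>

lemma backward_orbit_subset:
  assumes "z \<in> \<D>"
  shows "backward_orbit \<phi> z ` {t. 0 \<le> t \<and> ereal t < backward_time \<phi> z} \<subseteq> full_orbit generator \<D> z"
proof clarify
  fix t assume t: "0 \<le> t" "ereal t < backward_time \<phi> z"
  then obtain T where "t < T" "\<forall>s\<in>{0..<T}. z \<in> \<phi> s ` \<D>"
    unfolding backward_time_def less_Sup_iff by auto
  with t have z: "z \<in> \<phi> t ` \<D>" by simp
  define w where "w = backward_orbit \<phi> z t"
  have "w \<in> \<D>" "\<phi> t w = z"
    unfolding w_def backward_orbit_def by (rule inv_into_into[OF z], rule f_inv_into_f[OF z])
  then have "trajectory generator \<D> w z" using trajectory_semigroup[of w t] t by simp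
  then show "backward_orbit \<phi> z t \<in> full_orbit generator \<D> z" by (simp add: full_orbit_def w_def)
qed

end

theorem theorem1p1:
  fixes \<phi> :: "real \<Rightarrow> complex \<Rightarrow> complex" and z :: complex
  assumes "holomorphic_semigroup \<phi>" and "z \<in> \<D>"
  shows "rectifiable_curve {0..} (forward_orbit \<phi> z) \<and>
         rectifiable_curve {t. 0 \<le> t \<and> ereal t < backward_time \<phi> z} (backward_orbit \<phi> z)"
proof -
  interpret disk_semigroup \<phi> by unfold_locales fact
  have "hausdorff_measure_1 E < \<infinity>" if "E \<subseteq> full_orbit generator \<D> z" for E
    using hausdorff_measure_1_mono[OF that] hausdorff_measure_1_full_orbit_generator[OF assms(2)]
    by (rule le_less_trans)
  then show ?thesis
    unfolding rectifiable_curve_def curve_length_def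
    using forward_orbit_subset[OF assms(2)] backward_orbit_subset[OF assms(2)] by blast
qed

end
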